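(* Assume that for every $t=0,1,\dots,T-1$ and every admissible attention allocation $\bm\lambda_t$ the conditional covariance matrix $\bm\Sigma_{\bm b,t+}(\bm\lambda_t)$ of $\bm b_{t+1}$ given $\mathcal F_{t+}$ is positive definite. Define functions $h_t(\Lambda_t,\bm f_t)$ backward in time by $h_T(\Lambda_T,\bm f_T)=q_T$ and, for $t=T-1,\dots,0$, let $h_t(\Lambda_t,\bm f_t)$ be the optimal objective value of the optimization problem $$\min_{\bm\lambda_t\ge \bm 0,\ \bm\lambda_t^\prime\bm 1\le\Lambda_t} E_t\Big[E_{t+}[h_{t+1}(\Lambda_{t+1},\bm f_{t+1})]\,a_{t+1}^2+q_t-\big(\bm p_t+E_{t+}[h_{t+1}(\Lambda_{t+1},\bm f_{t+1})\bm b_{t+1}]a_{t+1}\big)^\prime\big(\bm A_t+E_{t+}[h_{t+1}(\Lambda_{t+1},\bm f_{t+1})\bm b_{t+1}\bm b_{t+1}^\prime]\big)^{-1}\big(\bm p_t+E_{t+}[h_{t+1}(\Lambda_{t+1},\bm f_{t+1})\bm b_{t+1}]a_{t+1}\big)\Big],\qquad(\ast)$$ where $\Lambda_{t+1}=\Lambda_t-\bm\lambda_t^\prime\bm 1$ and the conditional expectations $E_{t+}$ are taken after the signal $\bm s_{t+}(\bm\lambda_t)$ has been observed. Then for problem $(P_{AC})$: (i) the optimal attention allocation policy at period $t$ is $\bm\lambda_t^\star(\Lambda_t,\bm f_t)$, given as the minimizer ($\arg\min$) of $(\ast)$; (ii) the optimal control policy at period $t$ is $$\bm u_{t+}^\star(x_t,\Lambda_t,\bm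 f_t,\bm s_{t+}(\bm\lambda_t^\star))=-\big(\bm A_t+E_{t+}[h_{t+1}(\Lambda_{t+1},\bm f_{t+1})\bm b_{t+1}\bm b_{t+1}^\prime]\big)^{-1}\big(\bm p_t+E_{t+}[h_{t+1}(\Lambda_{t+1},\bm f_{t+1})\bm b_{t+1}]a_{t+1}\big)x_t,$$ where $\Lambda_{t+1}=\Lambda_t-(\bm\lambda_t^\star)^\prime\bm 1$ and $E_{t+}$ is taken with the signal $\bm s_{t+}(\bm\lambda_t^\star)$; (iii) the optimal objective value of $(P_{AC})$ is $J_0(x_0,\Lambda_0,\bm f_0)=h_0(\Lambda_0,\bm f_0)\,x_0^2$.
   Context: Problem $(P_{AC})$ (linear quadratic control with limited attention allocation) is $$\min_{\{\bm\lambda_t,\bm u_{t+}\}_{t=0}^{T-1}} E_0\Big[\sum_{t=0}^{T-1}\big(\bm u_{t+}^\prime\bm A_t\bm u_{t+}+2\bm u_{t+}^\prime\bm p_t x_t+q_tx_t^2\big)+q_Tx_T^2\Big]$$ subject to, for $t=0,\dots,T-1$: $x_{t+1}=a_{t+1}x_t+\bm b_{t+1}^\prime\bm u_{t+}$, $\bm u_{t+}\in\mathbb R^n$; $\bm b_{t+1}=\bm c+\bm D\bm f_{t+1}+\bm\epsilon_{t+1}$; $\bm f_{t+1}=(\bm I-\bm\varPhi)\bm f_t+\bm\eta_{t+1}$; $\Lambda_{t+1}=\Lambda_t-\bm\lambda_t^\prime\bm 1$; $\bm s_{t+}(\bm\lambda_t)=\bm f_{t+1}+\bm v_{t+1}(\bm\lambda_t)$;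 $\bm\lambda_t\in\mathbb R_+^k$, $\bm\lambda_t^\prime\bm 1\le\Lambda_t$; with $x_0\in\mathbb R$ and $\Lambda_0\ge 0$ given. Data. The state $x_t$ is scalar; $^\prime$ is transpose; $\bm 1$ and $\bm 0$ are the all-ones and zero vectors; $\bm I$ is the identity matrix. $\bm A_t\succeq 0$ is a deterministic symmetric $n\times n$ matrix, $\bm p_t\in\mathbb R^n$, $q_t\ge 0$ for $t<T$ and $q_T>0$ are deterministic, and $\bm B_t=\begin{pmatrix}\bm A_t&\bm p_t\\ \bm p_t^\prime&q_t\end{pmatrix}\succeq 0$ (symmetric positive semidefinite). $a_{t+1}>0$ is deterministic. $\bm c\in\mathbb R^n$, the $n\times k$ matrix $\bm D$ ($k<n$), and the $k\times k$ mean-reverting matrix $\bm\varPhi$ are deterministic. $\bm\epsilon_{t+1}\sim N(\bm 0,\bm\Sigma_{\bm\epsilon})$ in $\mathbb R^n$ and $\bm\eta_{t+1}\sim N(\bm 0,\bm\Sigma_{\bm\eta})$ in $\mathbb R^k$, where $\bm\Sigma_{\bm\eta}$ has diagonal entries $\sigma_{\eta_1}^2,\dots,\sigma_{\eta_k}^2$. $\bm v_{t+1}(\bm\lambda_t)$ is Gaussian white noise in $\mathbb R^k$ with mean zero and diagonal covariance $$\bm\Sigma_{\bm v}(\bm\lambda_t)=\mathrm{diag}\Big(\frac{\sigma_{\eta_1}^2}{e^{\lambda_{1,t}\theta_1}-1},\dots,\frac{\sigma_{\eta_k}^2}{e^{\lambda_{k,t}\theta_k}-1}\Big),$$ with deterministic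 efficiency parameters $\theta_j>0$; if $\lambda_{j,t}=0$ the $j$-th variance is infinite, meaning that the $j$-th signal component carries no information. The noises $\bm\epsilon_t,\bm\eta_t,\bm v_t$ are mutually independent, independent over time and independent of $\bm f_0$. Information. $\mathcal F_t=\sigma(\bm f_0,\bm\epsilon_1,\dots,\bm\epsilon_t,\bm\eta_1,\dots,\bm\eta_t,\bm s_{0+}(\bm\lambda_0),\dots,\bm s_{(t-1)+}(\bm\lambda_{t-1}))$ and $\mathcal F_{t+}=\sigma(\mathcal F_t,\bm s_{t+}(\bm\lambda_t))$. $E_t[\cdot]=E[\cdot|\mathcal F_t]$ and $E_{t+}[\cdot]=E[\cdot|\mathcal F_{t+}]$. At time $t$ the decision maker chooses $\bm\lambda_t$ based on $\mathcal F_t$, then observes the signal $\bm s_{t+}(\bm\lambda_t)$, and then chooses $\bm u_{t+}$ based on $\mathcal F_{t+}$. Conditional laws. Given $\mathcal F_t$, $\bm f_{t+1}\sim N((\bm I-\bm\varPhi)\bm f_t,\bm\Sigma_{\bm\eta})$. Given $\mathcal F_{t+}$, $\bm f_{t+1}$ and $\bm b_{t+1}$ are Gaussian: with $\bm K=\bm\Sigma_{\bm\eta}(\bm\Sigma_{\bm\eta}+\bm\Sigma_{\bm v}(\bm\lambda_t))^{-1}$, $\bm f_{t+1}$ has mean $(\bm I-\bm\varPhi)\bm f_t+\bm K(\bm s_{t+}(\bm\lambda_t)-(\bm I-\bm\varPhi)\bm f_t)$ and covariance $\bm\Sigma_{\bm\eta}-\bm K\bm\Sigma_{\bm\eta}$,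 while $\bm b_{t+1}$ has mean $\bm c+\bm D(\bm I-\bm\varPhi)\bm f_t+\bm D\bm K(\bm s_{t+}(\bm\lambda_t)-(\bm I-\bm\varPhi)\bm f_t)$ and covariance $\bm\Sigma_{\bm b,t+}(\bm\lambda_t)=\bm D[\bm\Sigma_{\bm\eta}-\bm K\bm\Sigma_{\bm\eta}]\bm D^\prime+\bm\Sigma_{\bm\epsilon}$. *)

theory Defs
  imports "HOL-Probability.Probability"
begin

section \<open>Matrices and Gaussian laws\<close>

definition psd :: "real^'i^'i \<Rightarrow> bool" where
  "psd S \<longleftrightarrow> transpose S = S \<and> (\<forall>x. 0 \<le> x \<bullet> (S *v x))"

definition posdef :: "real^'i^'i \<Rightarrow> bool" where
  "posdef S \<longleftrightarrow> transpose S = S \<and> (\<forall>x. x \<noteq> 0 \<longrightarrow> 0 < x \<bullet> (S *v x))"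

definition outer :: "real^'i \<Rightarrow> real^'i^'i" where
  "outer b = (\<chi> i j. b $ i * b $ j)"

text \<open>The block matrix with blocks \<open>A\<close>, \<open>p\<close>, \<open>p'\<close>, \<open>q\<close>; the additional last index is \<open>None\<close>.\<close>

definition bordered :: "real^'n^'n \<Rightarrow> real^'n \<Rightarrow> real \<Rightarrow> real^('n option)^('n option)" where
  "bordered A p q = (\<chi> i j.
     case i of
       Some i' \<Rightarrow> (case j of Some j' \<Rightarrow> A $ i' $ j' | None \<Rightarrow> p $ i')
     | None \<Rightarrow> (case j of Some j' \<Rightarrow> p $ j' | None \<Rightarrow> q))"

text \<open>
  The law \<open>N(m, S)\<close> for \<open>S\<close> positive semidefinite (possibly singular), realised as the law of
  \<open>m + L z\<close> with \<open>z\<close> standard normal and \<open>L L' = S\<close>; it does not depend on the choice of \<open>L\<close>.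
\<close>

definition mvnormal :: "real^'i \<Rightarrow> real^'i^'i \<Rightarrow> (real^'i) measure" where
  "mvnormal m S =
     distr (density lborel (\<lambda>z. ennreal (\<Prod>i\<in>UNIV. std_normal_density (z $ i)))) borel
       (\<lambda>z. m + (SOME L :: real^'i^'i. L ** transpose L = S) *v z)"


section \<open>Data of the problem\<close>

text \<open>
  \<open>acoef t\<close> is the coefficient \<open>a\<^sub>t\<close> for \<open>1 \<le> t \<le> T\<close>; \<open>Dmat\<close> has \<open>n\<close> rows and \<open>k\<close> columns.
\<close>

record ('n::finite, 'k::finite) lq_data =
  horizon :: nat
  Amat :: "nat \<Rightarrow> real^'n^'n"
  pvec :: "nat \<Rightarrow> real^'n"
  qcoef :: "nat \<Rightarrow> real"
  acoef :: "nat \<Rightarrow> real"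
  cvec :: "real^'n"
  Dmat :: "real^'k^'n"
  Phi :: "real^'k^'k"
  Sig_eps :: "real^'n^'n"
  Sig_eta :: "real^'k^'k"
  theta :: "real^'k"

definition valid_data :: "('n::finite, 'k::finite) lq_data \<Rightarrow> bool" where
  "valid_data P \<longleftrightarrow>
     CARD('k) < CARD('n) \<and>
     (\<forall>t<horizon P. psd (Amat P t) \<and> psd (bordered (Amat P t) (pvec P t) (qcoef P t)) \<and>
        0 \<le> qcoef P t \<and> 0 < acoef P (Suc t)) \<and>
     0 < qcoef P (horizon P) \<and>
     psd (Sig_eps P) \<and> psd (Sig_eta P) \<and> (\<forall>j. 0 < theta P $ j)"

definition allocations :: "real \<Rightarrow> (real^'k) set" where
  "allocations \<Lambda> = {l. (\<forall>j. 0 \<le> l $ j) \<and> (\<Sum>j\<in>UNIV. l $ j) \<le> \<Lambda>}"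

text \<open>
  Covariance of the observation noise. If \<open>l $ j = 0\<close>, the variance is infinite in the model; the
  entry is then \<open>0\<close> by the convention on division, but it is never used: the \<open>j\<close>-th signal component
  is suppressed in \<open>signal\<close> below, and the gain uses the precision matrix \<open>Prec_v\<close>.
\<close>

definition Sig_v :: "('n::finite, 'k::finite) lq_data \<Rightarrow> real^'k \<Rightarrow> real^'k^'k" where
  "Sig_v P l = (\<chi> i j. if i = j then Sig_eta P $ i $ i / (exp (l $ i * theta P $ i) - 1) else 0)"

definition Prec_v :: "('n::finite, 'k::finite) lq_data \<Rightarrow> real^'k \<Rightarrow> real^'k^'k" where
  "Prec_v P l = (\<chi> i j. if i = j then (exp (l $ i * theta P $ i) - 1) / Sig_eta P $ i $ i else 0)"

text \<open>
  The gain \<open>K = \<Sigma>\<^sub>\<eta> (\<Sigma>\<^sub>\<eta> + \<Sigma>\<^sub>v)\<^sup>-\<^sup>1\<close>, with \<open>(\<Sigma>\<^sub>\<eta> + \<Sigma>\<^sub>v)\<^sup>-\<^sup>1\<close> written as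
  \<open>W (I + \<Sigma>\<^sub>\<eta> W)\<^sup>-\<^sup>1\<close>, \<open>W = \<Sigma>\<^sub>v\<^sup>-\<^sup>1\<close>. This form remains meaningful for infinite variances (zero
  precisions): column \<open>j\<close> of \<open>K\<close> vanishes when \<open>l $ j = 0\<close>. See \<open>gain_eq\<close> for finite variances.
\<close>

definition gain :: "('n::finite, 'k::finite) lq_data \<Rightarrow> real^'k \<Rightarrow> real^'k^'k" where
  "gain P l = Sig_eta P ** (Prec_v P l ** matrix_inv (mat 1 + Sig_eta P ** Prec_v P l))"

lemma gain_eq:
  fixes P :: "('n::finite, 'k::finite) lq_data"
  assumes S: "psd (Sig_eta P)" and pos: "\<And>j. 0 < Sig_eta P $ j $ j"
    and th: "\<And>j. 0 < theta P $ j" and l: "\<And>j. 0 < l $ j"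
  shows "gain P l = Sig_eta P ** matrix_inv (Sig_eta P + Sig_v P l)"
proof -
  let ?S = "Sig_eta P" and ?V = "Sig_v P l" and ?W = "Prec_v P l"
  have e: "0 < exp (l $ j * theta P $ j) - 1" for j
    using l[of j] th[of j] by simp
  have VW: "?V ** ?W = mat 1"
  proof -
    have "(\<Sum>m\<in>UNIV. ?V $ i $ m * ?W $ m $ j) = (if i = j then 1 else 0)" for i j
    proof -
      have "(\<Sum>m\<in>UNIV. ?V $ i $ m * ?W $ m $ j)
          = (\<Sum>m\<in>UNIV. if m = i then ?V $ i $ i * ?W $ i $ j else 0)"
        by (rule sum.cong) (auto simp: Sig_v_def)
      also have "\<dots> = ?V $ i $ i * ?W $ i $ j"
        by simp
      also have "\<dots> = (if i = j then 1 else 0)"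
        using e[of i] pos[of i] by (auto simp: Sig_v_def Prec_v_def)
      finally show ?thesis .
    qed
    then show ?thesis
      by (simp add: matrix_matrix_mult_def mat_def vec_eq_iff)
  qed
  have Vx: "(?V *v x) $ i = ?V $ i $ i * x $ i" for x i
  proof -
    have "(?V *v x) $ i = (\<Sum>m\<in>UNIV. if m = i then ?V $ i $ i * x $ i else 0)"
      unfolding matrix_vector_mult_def vec_lambda_beta by (rule sum.cong) (auto simp: Sig_v_def)
    then show ?thesis by simp
  qed
  have Vpos: "0 < x \<bullet> (?V *v x)" if x: "x \<noteq> 0" for x
  proof -
    obtain i where i: "x $ i \<noteq> 0" using x by (auto simp: vec_eq_iff)
    have d: "0 < ?V $ m $ m" for m using e[of m] pos[of m] by (simp add: Sig_v_def)
    have "0 < (\<Sum>m\<in>UNIV. ?V $ m $ m * (x $ m)\<^sup>2)"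
      by (rule sum_pos2[of UNIV i]) (use d i in \<open>auto intro!: mult_nonneg_nonneg intro: less_imp_le\<close>)
    also have "\<dots> = x \<bullet> (?V *v x)"
      unfolding inner_vec_def by (rule sum.cong) (auto simp: Vx power2_eq_square)
    finally show ?thesis .
  qed
  have ker: "x = 0" if "(?S + ?V) *v x = 0" for x
  proof (rule ccontr)
    assume "x \<noteq> 0"
    then have "0 < x \<bullet> (?S *v x) + x \<bullet> (?V *v x)"
      using Vpos[of x] S by (simp add: psd_def add_nonneg_pos)
    also have "\<dots> = x \<bullet> ((?S + ?V) *v x)"
      by (simp add: matrix_vector_mult_add_rdistrib inner_add_right)
    finally show False using that by simp
  qed
  have inv: "A ** matrix_inv A = mat 1 \<and> matrix_inv A ** A = mat 1" if "invertible A"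
    for A :: "real^'k^'k"
    using that unfolding invertible_def matrix_inv_def by (rule someI_ex)
  have invB: "invertible (?S + ?V)"
    using ker by (simp add: invertible_left_inverse matrix_left_invertible_ker)
  have invW: "invertible ?W"
    using VW by (auto simp: invertible_left_inverse)
  have distrib: "(?S + ?V) ** ?W = ?S ** ?W + ?V ** ?W"
    by (simp add: matrix_matrix_mult_def vec_eq_iff distrib_right sum.distrib)
  have eq: "mat 1 + ?S ** ?W = (?S + ?V) ** ?W"
    by (simp add: distrib VW add.commute)
  have "invertible ((?S + ?V) ** ?W)"
    using invB invW by (rule invertible_mult)
  then have R: "(?S + ?V) ** (?W ** matrix_inv ((?S + ?V) ** ?W)) = mat 1"
    by (metis inv matrix_mul_assoc)
  have "matrix_inv (?S + ?V) = matrix_inv (?S + ?V) ** ((?S + ?V) ** (?W ** matrix_inv ((?S + ?V) ** ?W)))"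
    by (simp only: R matrix_mul_rid)
  also have "\<dots> = ?W ** matrix_inv ((?S + ?V) ** ?W)"
    by (metis invB inv matrix_mul_assoc matrix_mul_lid)
  finally show ?thesis
    by (simp add: gain_def eq)
qed

text \<open>The signal \<open>f\<^sub>t\<^sub>+\<^sub>1 + v\<close>; components receiving no attention carry no information.\<close>

definition signal :: "real^'k \<Rightarrow> real^'k \<Rightarrow> real^'k \<Rightarrow> real^'k" where
  "signal l f v = (\<chi> j. if l $ j = 0 then 0 else f $ j + v $ j)"


section \<open>Conditional expectations given the current state, and the value recursion\<close>

definition prior_mean :: "('n::finite, 'k::finite) lq_data \<Rightarrow> real^'k \<Rightarrow> real^'k" where
  "prior_mean P f = (mat 1 - Phi P) *v f"

definition post_mean ::
    "('n::finite, 'k::finite) lq_data \<Rightarrow> real^'k \<Rightarrow> real^'k \<Rightarrow> real^'k \<Rightarrow> real^'k" where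
  "post_mean P f l s = prior_mean P f + gain P l *v (s - prior_mean P f)"

definition post_cov :: "('n::finite, 'k::finite) lq_data \<Rightarrow> real^'k \<Rightarrow> real^'k^'k" where
  "post_cov P l = Sig_eta P - gain P l ** Sig_eta P"

definition Sig_b :: "('n::finite, 'k::finite) lq_data \<Rightarrow> real^'k \<Rightarrow> real^'n^'n" where
  "Sig_b P l = Dmat P ** post_cov P l ** transpose (Dmat P) + Sig_eps P"

text \<open>
  \<open>exp_pre P f l G\<close> is \<open>E\<^sub>t[G(s)]\<close> when \<open>f\<^sub>t = f\<close> and the attention is \<open>l\<close>;
  \<open>exp_post P f l s g\<close> is \<open>E\<^sub>t\<^sub>+[g(f\<^sub>t\<^sub>+\<^sub>1, b\<^sub>t\<^sub>+\<^sub>1)]\<close> when moreover the observed signal is \<open>s\<close>.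
\<close>

definition exp_pre ::
    "('n::finite, 'k::finite) lq_data \<Rightarrow> real^'k \<Rightarrow> real^'k \<Rightarrow> (real^'k \<Rightarrow> real) \<Rightarrow> real" where
  "exp_pre P f l G =
     (\<integral>f'. (\<integral>v. G (signal l f' v) \<partial>mvnormal 0 (Sig_v P l)) \<partial>mvnormal (prior_mean P f) (Sig_eta P))"

definition exp_post ::
    "('n::finite, 'k::finite) lq_data \<Rightarrow> real^'k \<Rightarrow> real^'k \<Rightarrow> real^'k \<Rightarrow>
      (real^'k \<Rightarrow> real^'n \<Rightarrow> 'b::{banach, second_countable_topology}) \<Rightarrow> 'b" where
  "exp_post P f l s g =
     (\<integral>f'. (\<integral>e. g f' (cvec P + Dmat P *v f' + e) \<partial>mvnormal 0 (Sig_eps P))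
        \<partial>mvnormal (post_mean P f l s) (post_cov P l))"

text \<open>
  In the next three definitions \<open>h\<close> stands for \<open>h\<^sub>t\<^sub>+\<^sub>1\<close> and \<open>\<Lambda>\<close>, \<open>f\<close> for \<open>\<Lambda>\<^sub>t\<close>, \<open>f\<^sub>t\<close>.
\<close>

definition lin_term ::
    "('n::finite, 'k::finite) lq_data \<Rightarrow> nat \<Rightarrow> (real \<Rightarrow> real^'k \<Rightarrow> real) \<Rightarrow>
      real \<Rightarrow> real^'k \<Rightarrow> real^'k \<Rightarrow> real^'k \<Rightarrow> real^'n" where
  "lin_term P t h \<Lambda> f l s =
     pvec P t + acoef P (Suc t) *\<^sub>R
       exp_post P f l s (\<lambda>f' b. h (\<Lambda> - (\<Sum>j\<in>UNIV. l $ j)) f' *\<^sub>R b)"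

definition quad_term ::
    "('n::finite, 'k::finite) lq_data \<Rightarrow> nat \<Rightarrow> (real \<Rightarrow> real^'k \<Rightarrow> real) \<Rightarrow>
      real \<Rightarrow> real^'k \<Rightarrow> real^'k \<Rightarrow> real^'k \<Rightarrow> real^'n^'n" where
  "quad_term P t h \<Lambda> f l s =
     Amat P t + exp_post P f l s
       (\<lambda>f' b. h (\<Lambda> - (\<Sum>j\<in>UNIV. l $ j)) f' *\<^sub>R outer b)"

definition stage_objective ::
    "('n::finite, 'k::finite) lq_data \<Rightarrow> nat \<Rightarrow> (real \<Rightarrow> real^'k \<Rightarrow> real) \<Rightarrow>
      real \<Rightarrow> real^'k \<Rightarrow> real^'k \<Rightarrow> real" where
  "stage_objective P t h \<Lambda> f l = exp_pre P f l (\<lambda>s.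
     exp_post P f l s (\<lambda>f' b. h (\<Lambda> - (\<Sum>j\<in>UNIV. l $ j)) f') * (acoef P (Suc t))\<^sup>2 + qcoef P t
     - lin_term P t h \<Lambda> f l s \<bullet>
         (matrix_inv (quad_term P t h \<Lambda> f l s) *v lin_term P t h \<Lambda> f l s))"

text \<open>\<open>value_togo P m\<close> is \<open>h\<close> at the period with \<open>m\<close> periods remaining.\<close>

primrec value_togo ::
    "('n::finite, 'k::finite) lq_data \<Rightarrow> nat \<Rightarrow> real \<Rightarrow> real^'k \<Rightarrow> real" where
  "value_togo P 0 = (\<lambda>\<Lambda> f. qcoef P (horizon P))"
| "value_togo P (Suc m) = (\<lambda>\<Lambda> f. INF l\<in>allocations \<Lambda>.
     stage_objective P (horizon P - Suc m) (value_togo P m) \<Lambda> f l)"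

definition hfun :: "('n::finite, 'k::finite) lq_data \<Rightarrow> nat \<Rightarrow> real \<Rightarrow> real^'k \<Rightarrow> real" where
  "hfun P t = value_togo P (horizon P - t)"

text \<open>
  Minimizers of the stage problems as functions of \<open>(\<Lambda>\<^sub>t, f\<^sub>t)\<close>, for the budgets \<open>\<Lambda>\<^sub>t \<in> [0, \<Lambda>\<^sub>0]\<close>
  that can occur. Minimizers need not be unique; measurability of the selection is what makes the
  resulting allocations random variables.
\<close>

definition argmin_selector ::
    "('n::finite, 'k::finite) lq_data \<Rightarrow> real \<Rightarrow> (nat \<Rightarrow> real \<Rightarrow> real^'k \<Rightarrow> real^'k) \<Rightarrow> bool" where
  "argmin_selector P \<Lambda>0 ls \<longleftrightarrow> (\<forall>t<horizon P.
     (\<lambda>(\<Lambda>, f). ls t \<Lambda> f) \<in> borel_measurable (restrict_space borel ({0..\<Lambda>0} \<times> UNIV)) \<and>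
     (\<forall>\<Lambda>\<in>{0..\<Lambda>0}. \<forall>f.
        is_arg_min (stage_objective P t (hfun P (Suc t)) \<Lambda> f) (\<lambda>l. l \<in> allocations \<Lambda>) (ls t \<Lambda> f)))"

definition control_law ::
    "('n::finite, 'k::finite) lq_data \<Rightarrow> (nat \<Rightarrow> real \<Rightarrow> real^'k \<Rightarrow> real^'k) \<Rightarrow>
      nat \<Rightarrow> real \<Rightarrow> real \<Rightarrow> real^'k \<Rightarrow> real^'k \<Rightarrow> real^'n" where
  "control_law P ls t x \<Lambda> f s =
     - (x *\<^sub>R (matrix_inv (quad_term P t (hfun P (Suc t)) \<Lambda> f (ls t \<Lambda> f) s)
          *v lin_term P t (hfun P (Suc t)) \<Lambda> f (ls t \<Lambda> f) s))"


section \<open>The stochastic model\<close>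

text \<open>\<open>vnoise N t l\<close> is the observation noise \<open>v\<^sub>t(l)\<close> under the attention \<open>l\<close>.\<close>

record ('w, 'n::finite, 'k::finite) shocks =
  base :: "'w measure"
  finit :: "'w \<Rightarrow> real^'k"
  eps :: "nat \<Rightarrow> 'w \<Rightarrow> real^'n"
  eta :: "nat \<Rightarrow> 'w \<Rightarrow> real^'k"
  vnoise :: "nat \<Rightarrow> real^'k \<Rightarrow> 'w \<Rightarrow> real^'k"

definition events_of :: "'w measure \<Rightarrow> ('w \<Rightarrow> 'b::topological_space) \<Rightarrow> 'w set set" where
  "events_of M X = {X -` B \<inter> space M | B. B \<in> sets borel}"

definition vnoise_algebra :: "('w, 'n::finite, 'k::finite) shocks \<Rightarrow> nat \<Rightarrow> 'w measure" where
  "vnoise_algebra N t = sigma (space (base N)) (\<Union>l. events_of (base N) (vnoise N t l))"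

datatype source = Init | Eps nat | Eta nat | Vis nat

primrec source_events :: "('w, 'n::finite, 'k::finite) shocks \<Rightarrow> source \<Rightarrow> 'w set set" where
  "source_events N Init = events_of (base N) (finit N)"
| "source_events N (Eps t) = events_of (base N) (eps N t)"
| "source_events N (Eta t) = events_of (base N) (eta N t)"
| "source_events N (Vis t) = sets (vnoise_algebra N t)"

text \<open>
  The noise \<open>v\<^sub>t\<close> is a random field indexed by the attention; its joint measurability ensures that
  \<open>v\<^sub>t\<close> evaluated at a random attention is a random vector. The law of its components without
  attention is immaterial (see \<open>Sig_v\<close>).
\<close>

definition valid_shocks ::
    "('n::finite, 'k::finite) lq_data \<Rightarrow> ('w, 'n, 'k) shocks \<Rightarrow> bool" where
  "valid_shocks P N \<longleftrightarrow>
     prob_space (base N) \<and>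
     finit N \<in> borel_measurable (base N) \<and>
     (\<forall>t\<in>{1..horizon P}.
        eps N t \<in> borel_measurable (base N) \<and>
        distr (base N) borel (eps N t) = mvnormal 0 (Sig_eps P) \<and>
        eta N t \<in> borel_measurable (base N) \<and>
        distr (base N) borel (eta N t) = mvnormal 0 (Sig_eta P) \<and>
        (\<lambda>(l, \<omega>). vnoise N t l \<omega>) \<in> borel_measurable (borel \<Otimes>\<^sub>M vnoise_algebra N t) \<and>
        (\<forall>l. vnoise N t l \<in> borel_measurable (base N)) \<and>
        (\<forall>l. (\<forall>j. 0 \<le> l $ j) \<longrightarrow>
           distr (base N) borel (vnoise N t l) = mvnormal 0 (Sig_v P l))) \<and>
     prob_space.indep_sets (base N) (source_events N)
       ({Init} \<union> Eps ` {1..horizon P} \<union> Eta ` {1..horizon P} \<union> Vis ` {1..horizon P})"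

primrec factor ::
    "('n::finite, 'k::finite) lq_data \<Rightarrow> ('w, 'n, 'k) shocks \<Rightarrow> nat \<Rightarrow> 'w \<Rightarrow> real^'k" where
  "factor P N 0 \<omega> = finit N \<omega>"
| "factor P N (Suc t) \<omega> = (mat 1 - Phi P) *v factor P N t \<omega> + eta N (Suc t) \<omega>"

definition bvec ::
    "('n::finite, 'k::finite) lq_data \<Rightarrow> ('w, 'n, 'k) shocks \<Rightarrow> nat \<Rightarrow> 'w \<Rightarrow> real^'n" where
  "bvec P N t \<omega> = cvec P + Dmat P *v factor P N t \<omega> + eps N t \<omega>"

primrec budget :: "real \<Rightarrow> (nat \<Rightarrow> 'w \<Rightarrow> real^'k::finite) \<Rightarrow> nat \<Rightarrow> 'w \<Rightarrow> real" where
  "budget \<Lambda>0 lam 0 \<omega> = \<Lambda>0"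
| "budget \<Lambda>0 lam (Suc t) \<omega> = budget \<Lambda>0 lam t \<omega> - (\<Sum>j\<in>UNIV. lam t \<omega> $ j)"

primrec state ::
    "('n::finite, 'k::finite) lq_data \<Rightarrow> ('w, 'n, 'k) shocks \<Rightarrow> real \<Rightarrow> (nat \<Rightarrow> 'w \<Rightarrow> real^'n) \<Rightarrow>
      nat \<Rightarrow> 'w \<Rightarrow> real" where
  "state P N x0 u 0 \<omega> = x0"
| "state P N x0 u (Suc t) \<omega> =
     acoef P (Suc t) * state P N x0 u t \<omega> + bvec P N (Suc t) \<omega> \<bullet> u t \<omega>"

definition sig ::
    "('n::finite, 'k::finite) lq_data \<Rightarrow> ('w, 'n, 'k) shocks \<Rightarrow> (nat \<Rightarrow> 'w \<Rightarrow> real^'k) \<Rightarrow>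
      nat \<Rightarrow> 'w \<Rightarrow> real^'k" where
  "sig P N lam t \<omega> =
     signal (lam t \<omega>) (factor P N (Suc t) \<omega>) (vnoise N (Suc t) (lam t \<omega>) \<omega>)"

text \<open>
  \<open>info\<close> and \<open>info_plus\<close> are \<open>\<F>\<^sub>t\<close> and \<open>\<F>\<^sub>t\<^sub>+\<close>; they depend on the past attention through the signals.
\<close>

definition info ::
    "('n::finite, 'k::finite) lq_data \<Rightarrow> ('w, 'n, 'k) shocks \<Rightarrow> (nat \<Rightarrow> 'w \<Rightarrow> real^'k) \<Rightarrow>
      nat \<Rightarrow> 'w measure" where
  "info P N lam t = sigma (space (base N))
     (events_of (base N) (finit N) \<union>
      (\<Union>i\<in>{1..t}. events_of (base N) (eps N i) \<union> events_of (base N) (eta N i)) \<union>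
      (\<Union>i<t. events_of (base N) (sig P N lam i)))"

definition info_plus ::
    "('n::finite, 'k::finite) lq_data \<Rightarrow> ('w, 'n, 'k) shocks \<Rightarrow> (nat \<Rightarrow> 'w \<Rightarrow> real^'k) \<Rightarrow>
      nat \<Rightarrow> 'w measure" where
  "info_plus P N lam t = sigma (space (base N))
     (sets (info P N lam t) \<union> events_of (base N) (sig P N lam t))"

definition admissible ::
    "('n::finite, 'k::finite) lq_data \<Rightarrow> ('w, 'n, 'k) shocks \<Rightarrow> real \<Rightarrow>
      (nat \<Rightarrow> 'w \<Rightarrow> real^'k) \<Rightarrow> (nat \<Rightarrow> 'w \<Rightarrow> real^'n) \<Rightarrow> bool" where
  "admissible P N \<Lambda>0 lam u \<longleftrightarrow> (\<forall>t<horizon P.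
     lam t \<in> borel_measurable (info P N lam t) \<and>
     (\<forall>\<omega>\<in>space (base N). lam t \<omega> \<in> allocations (budget \<Lambda>0 lam t \<omega>)) \<and>
     u t \<in> borel_measurable (info_plus P N lam t))"

definition total_cost ::
    "('n::finite, 'k::finite) lq_data \<Rightarrow> ('w, 'n, 'k) shocks \<Rightarrow> real \<Rightarrow> (nat \<Rightarrow> 'w \<Rightarrow> real^'n) \<Rightarrow>
      'w \<Rightarrow> real" where
  "total_cost P N x0 u \<omega> =
     (\<Sum>t<horizon P. u t \<omega> \<bullet> (Amat P t *v u t \<omega>)
        + 2 * (u t \<omega> \<bullet> pvec P t) * state P N x0 u t \<omega>
        + qcoef P t * (state P N x0 u t \<omega>)\<^sup>2)
     + qcoef P (horizon P) * (state P N x0 u (horizon P) \<omega>)\<^sup>2"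

text \<open>
  The objective \<open>E\<^sub>0[cost]\<close>, a random variable since \<open>f\<^sub>0\<close> is random. The cost is nonnegative for
  valid data, so that the extended nonnegative conditional expectation exists for every policy.
\<close>

definition objective ::
    "('n::finite, 'k::finite) lq_data \<Rightarrow> ('w, 'n, 'k) shocks \<Rightarrow> real \<Rightarrow>
      (nat \<Rightarrow> 'w \<Rightarrow> real^'k) \<Rightarrow> (nat \<Rightarrow> 'w \<Rightarrow> real^'n) \<Rightarrow> 'w \<Rightarrow> ennreal" where
  "objective P N x0 lam u =
     nn_cond_exp (base N) (info P N lam 0) (\<lambda>\<omega>. ennreal (total_cost P N x0 u \<omega>))"

definition optimal_policy ::
    "('n::finite, 'k::finite) lq_data \<Rightarrow> ('w, 'n, 'k) shocks \<Rightarrow> real \<Rightarrow> real \<Rightarrow>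
      (nat \<Rightarrow> 'w \<Rightarrow> real^'k) \<Rightarrow> (nat \<Rightarrow> 'w \<Rightarrow> real^'n) \<Rightarrow> bool" where
  "optimal_policy P N x0 \<Lambda>0 lam u \<longleftrightarrow>
     admissible P N \<Lambda>0 lam u \<and>
     (\<forall>lam' u'. admissible P N \<Lambda>0 lam' u' \<longrightarrow>
        (AE \<omega> in base N. objective P N x0 lam u \<omega> \<le> objective P N x0 lam' u' \<omega>))"

definition optimal_value ::
    "('n::finite, 'k::finite) lq_data \<Rightarrow> ('w, 'n, 'k) shocks \<Rightarrow> real \<Rightarrow> real \<Rightarrow>
      ('w \<Rightarrow> ennreal) \<Rightarrow> bool" where
  "optimal_value P N x0 \<Lambda>0 J \<longleftrightarrow>
     (\<forall>lam u. admissible P N \<Lambda>0 lam u \<longrightarrow> (AE \<omega> in base N. J \<omega> \<le> objective P N x0 lam u \<omega>)) \<and>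
     (\<exists>lam u. admissible P N \<Lambda>0 lam u \<and> (AE \<omega> in base N. objective P N x0 lam u \<omega> = J \<omega>))"

text \<open>The policy obtained by applying \<open>ls\<close> and the associated control law along the trajectory.\<close>

definition follows ::
    "('n::finite, 'k::finite) lq_data \<Rightarrow> ('w, 'n, 'k) shocks \<Rightarrow> real \<Rightarrow> real \<Rightarrow>
      (nat \<Rightarrow> real \<Rightarrow> real^'k \<Rightarrow> real^'k) \<Rightarrow>
      (nat \<Rightarrow> 'w \<Rightarrow> real^'k) \<Rightarrow> (nat \<Rightarrow> 'w \<Rightarrow> real^'n) \<Rightarrow> bool" where
  "follows P N x0 \<Lambda>0 ls lam u \<longleftrightarrow> (\<forall>t<horizon P. \<forall>\<omega>\<in>space (base N).
     lam t \<omega> = ls t (budget \<Lambda>0 lam t \<omega>) (factor P N t \<omega>) \<and>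
     u t \<omega> = control_law P ls t (state P N x0 u t \<omega>) (budget \<Lambda>0 lam t \<omega>) (factor P N t \<omega>)
       (sig P N lam t \<omega>))"

end

theory Submission
  imports Defs
begin

text \<open>
  A centred Gaussian law is the image of a standard Gaussian under a linear map \<open>A\<close> and depends only
  on \<open>A A'\<close>, by rotation invariance. Hence the part of \<open>f\<^sub>t\<^sub>+\<^sub>1\<close> left unexplained by the signal,
  being uncorrelated with the signal, is independent of it, which gives the conditional law under \<open>\<F>\<^sub>t\<^sub>+\<close>. The
  gain and the posterior covariance have factors that are continuous in the attention, even where a component
  vanishes; by dominated convergence and induction, \<open>h\<^sub>t\<close> is continuous, bounded and positive on
  \<open>[0, \<Lambda>\<^sub>0] \<times> \<real>\<^sup>k\<close>. Positivity and the positive definite \<open>\<Sigma>\<^sub>b\<close> make the expected cost a strictly convex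
  quadratic in the control, minimized by completing the square; a minimizing attention is selected measurably. As the
  shocks of the next period are independent of the past, \<open>h\<^sub>t x\<^sub>t\<^sup>2\<close> plus the cost so far has nondecreasing integral
  over every event of \<open>\<F>\<^sub>0\<close> under any admissible policy, and constant integral under the candidate.
\<close>

section \<open>Standard Gaussian measures\<close>

text \<open>Three obstacles shape the proof. The covariances may be singular, and
  \<open>mvnormal\<close> hides an arbitrary square root, so laws are compared as linear images of
  standard Gaussians and not through densities. The attention ranges over a set that moves with the
  budget; writing it as the budget times a point of the unit budget set lets infima and selections
  run over one fixed compact set. Finally, the information algebras depend on the chosen attention,
  and a policy may have infinite cost. Hence every policy is pulled back to the larger algebra
  generated by the shocks themselves, including the whole field of observation noise; there the
  control is written as a function of the past and the signal, and all costs are compared through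
  nonnegative integrals.\<close>

definition gauss :: "'a::euclidean_space measure" where
  "gauss = density lborel (\<lambda>z. ennreal (\<Prod>b\<in>Basis. std_normal_density (z \<bullet> b)))"

lemma sets_gauss [simp, measurable_cong]: "sets gauss = sets borel"
  and space_gauss [simp]: "space gauss = UNIV"
  by (simp_all add: gauss_def)

lemma prob_space_gauss: "prob_space (gauss :: 'a::euclidean_space measure)"
proof
  have "emeasure (gauss :: 'a measure) (space gauss)
      = (\<integral>\<^sup>+z. (\<Prod>b\<in>Basis. ennreal (std_normal_density ((z::'a) \<bullet> b))) \<partial>lborel)"
    by (simp add: gauss_def emeasure_density prod_ennreal)
  also have "\<dots> = 1"
    by (subst nn_integral_lborel_prod)
      (simp_all add: nn_integral_eq_integral[OF integrable_normal_density])
  finally show "emeasure (gauss :: 'a measure) (space gauss) = 1" .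
qed

interpretation gauss: prob_space "gauss :: 'a::euclidean_space measure"
  by (rule prob_space_gauss)

text \<open>Only the norm enters. This yields both the factorization over product spaces, where
  squared norms add, and the invariance under rotations.\<close>

lemma gauss_density_eq:
  fixes z :: "'a::euclidean_space"
  shows "(\<Prod>b\<in>Basis. std_normal_density (z \<bullet> b))
    = (1 / sqrt (2 * pi)) ^ DIM('a) * exp (- (norm z)\<^sup>2 / 2)"
proof -
  have "(\<Prod>b\<in>Basis. std_normal_density (z \<bullet> b))
      = (1 / sqrt (2 * pi)) ^ DIM('a) * exp (\<Sum>b\<in>Basis. - (z \<bullet> b)\<^sup>2 / 2)"
    by (simp add: std_normal_density_def prod.distrib prod_dividef exp_sum power_divide)
  also have "(\<Sum>b\<in>Basis. - (z \<bullet> b)\<^sup>2 / 2) = - (norm z)\<^sup>2 / 2"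
    unfolding power2_norm_eq_inner euclidean_inner[of z z]
    by (simp add: power2_eq_square sum_negf flip: sum_divide_distrib)
  finally show ?thesis .
qed

lemma gauss_prod: "(gauss :: ('a::euclidean_space \<times> 'b::euclidean_space) measure) = gauss \<Otimes>\<^sub>M gauss"
proof -
  have s: "sigma_finite_measure (density lborel
      (\<lambda>z. ennreal (\<Prod>b\<in>Basis. std_normal_density ((z::'b) \<bullet> b))))"
    using gauss.sigma_finite_measure_axioms[where 'a = 'b] by (simp add: gauss_def)
  have "(gauss :: 'a measure) \<Otimes>\<^sub>M (gauss :: 'b measure) =
      density (lborel \<Otimes>\<^sub>M lborel) (\<lambda>(x, y). ennreal (\<Prod>b\<in>Basis. std_normal_density (x \<bullet> b))
        * ennreal (\<Prod>b\<in>Basis. std_normal_density (y \<bullet> b)))"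
    unfolding gauss_def by (rule pair_measure_density) (auto intro: lborel.sigma_finite_measure_axioms s)
  also have "\<dots> = gauss"
    unfolding gauss_def lborel_prod
    by (intro arg_cong2[where f = density] refl ext)
      (auto simp: gauss_density_eq norm_Pair ennreal_mult[symmetric] power_add exp_add[symmetric] add_divide_distrib
        intro!: arg_cong[where f = ennreal])
  finally show ?thesis ..
qed

lemma nn_integral_gauss_prod:
  assumes "f \<in> borel_measurable borel"
  shows "(\<integral>\<^sup>+z. f z \<partial>(gauss :: ('a::euclidean_space \<times> 'b::euclidean_space) measure))
    = (\<integral>\<^sup>+x. (\<integral>\<^sup>+y. f (x, y) \<partial>gauss) \<partial>gauss)"
  unfolding gauss_prod using assms
  by (intro gauss.nn_integral_fst[symmetric]) (simp add: gauss_prod[symmetric])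

lemma integral_gauss_prod:
  fixes f :: "'a::euclidean_space \<times> 'b::euclidean_space \<Rightarrow> 'c::{banach, second_countable_topology}"
  assumes "integrable gauss f"
  shows "(\<integral>z. f z \<partial>gauss) = (\<integral>x. (\<integral>y. f (x, y) \<partial>gauss) \<partial>gauss)"
proof -
  interpret pair_prob_space "gauss :: 'a measure" "gauss :: 'b measure" ..
  show ?thesis using assms unfolding gauss_prod by (rule integral_fst'[symmetric])
qed

text \<open>Fubini against the indicator \<open>g\<close> of the unit ball: \<open>\<integral>\<integral> f (Q x + y) g y dx dy\<close> is
  computed by translating either \<open>x\<close> by \<open>Q\<^sup>-\<^sup>1 y\<close> or \<open>y\<close> by \<open>Q x\<close>.\<close>

lemma nn_integral_lborel_orthogonal:
  fixes Q :: "'a::euclidean_space \<Rightarrow> 'a"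
  assumes Q: "orthogonal_transformation Q" and f [measurable]: "f \<in> borel_measurable borel"
  shows "(\<integral>\<^sup>+x. f (Q x) \<partial>lborel) = (\<integral>\<^sup>+x. f x \<partial>lborel)"
proof -
  define g :: "'a \<Rightarrow> ennreal" where "g = indicator (ball 0 1)"
  have [measurable]: "g \<in> borel_measurable borel" unfolding g_def by (intro borel_measurable_indicator) auto
  have lin: "linear Q" and isom: "\<And>x. norm (Q x) = norm x"
    using Q by (auto simp: orthogonal_transformation)
  have [measurable]: "Q \<in> borel_measurable borel"
    using lin by (intro borel_measurable_continuous_onI linear_continuous_on linear_linear[THEN iffD1])
      (auto simp: linear_conv_bounded_linear)
  obtain R where R: "\<And>x. Q (R x) = x"
    using orthogonal_transformation_surj[OF Q] by (metis surj_f_inv_f)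
  have tr: "(\<integral>\<^sup>+x. \<phi> (c + x) \<partial>lborel) = (\<integral>\<^sup>+x. \<phi> x \<partial>lborel)"
    if [measurable]: "\<phi> \<in> borel_measurable borel" for \<phi> :: "'a \<Rightarrow> ennreal" and c
  proof -
    have "(\<integral>\<^sup>+x. \<phi> x \<partial>lborel) = (\<integral>\<^sup>+x. \<phi> x \<partial>distr lborel borel ((+) c))"
      by (simp add: lborel_distr_plus)
    also have "\<dots> = (\<integral>\<^sup>+x. \<phi> (c + x) \<partial>lborel)"
      by (rule nn_integral_distr) auto
    finally show ?thesis by simp
  qed
  \<comment> \<open>The ball is invariant under \<open>Q\<close> and under negation, and
    \<open>y = Q (R y)\<close>; so a translate by \<open>Q x\<close> in \<open>y\<close> is a
    translate by \<open>- R y\<close> in \<open>x\<close>.\<close>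
  have sym: "g (y - Q x) = g (- R y + x)" for x y
  proof -
    have "norm (y - Q x) = norm (Q (- R y + x))"
      using lin by (simp add: linear_add linear_diff linear_neg R norm_minus_commute)
    then show ?thesis by (auto simp: g_def isom indicator_def)
  qed
  have "(\<integral>\<^sup>+x. f (Q x) \<partial>lborel) * (\<integral>\<^sup>+y. g y \<partial>lborel) = (\<integral>\<^sup>+y. (\<integral>\<^sup>+x. f (Q x) * g y \<partial>lborel) \<partial>lborel)"
    by (simp add: nn_integral_multc nn_integral_cmult)
  also have "\<dots> = (\<integral>\<^sup>+y. (\<integral>\<^sup>+x. f (Q x + y) * g y \<partial>lborel) \<partial>lborel)"
  proof (rule nn_integral_cong)
    fix y
    show "(\<integral>\<^sup>+x. f (Q x) * g y \<partial>lborel) = (\<integral>\<^sup>+x. f (Q x + y) * g y \<partial>lborel)"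
      using tr[of "\<lambda>x. f (Q x) * g y" "R y"] lin by (simp add: linear_add R add.commute)
  qed
  also have "\<dots> = (\<integral>\<^sup>+x. (\<integral>\<^sup>+y. f (Q x + y) * g y \<partial>lborel) \<partial>lborel)"
    by (rule lborel_pair.Fubini') measurable
  also have "\<dots> = (\<integral>\<^sup>+x. (\<integral>\<^sup>+y. f y * g (y - Q x) \<partial>lborel) \<partial>lborel)"
  proof (rule nn_integral_cong)
    fix x
    show "(\<integral>\<^sup>+y. f (Q x + y) * g y \<partial>lborel) = (\<integral>\<^sup>+y. f y * g (y - Q x) \<partial>lborel)"
      using tr[of "\<lambda>y. f y * g (y - Q x)" "Q x"] by simp
  qed
  also have "\<dots> = (\<integral>\<^sup>+y. (\<integral>\<^sup>+x. f y * g (y - Q x) \<partial>lborel) \<partial>lborel)"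
    by (rule lborel_pair.Fubini') measurable
  also have "\<dots> = (\<integral>\<^sup>+y. f y * (\<integral>\<^sup>+x. g x \<partial>lborel) \<partial>lborel)"
    by (simp only: sym nn_integral_cmult measurable_compose[OF _ \<open>g \<in> borel_measurable borel\<close>] tr \<open>g \<in> borel_measurable borel\<close>) (subst nn_integral_cmult; simp add: tr del: uminus_add_conv_diff)
  also have "\<dots> = (\<integral>\<^sup>+y. f y \<partial>lborel) * (\<integral>\<^sup>+x. g x \<partial>lborel)"
    by (simp add: nn_integral_multc)
  finally have *: "(\<integral>\<^sup>+x. f (Q x) \<partial>lborel) * (\<integral>\<^sup>+y. g y \<partial>lborel)
      = (\<integral>\<^sup>+y. f y \<partial>lborel) * (\<integral>\<^sup>+x. g x \<partial>lborel)" .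
  \<comment> \<open>The ball has positive and finite volume, so its measure cancels.\<close>
  have g0: "(\<integral>\<^sup>+y. g y \<partial>lborel) = emeasure lborel (ball 0 1 :: 'a set)"
    by (simp add: g_def)
  have "(\<integral>\<^sup>+y. g y \<partial>lborel) \<noteq> 0"
    unfolding g0 using content_ball_pos[of 1 "0::'a"] by (auto simp: measure_def)
  moreover have "(\<integral>\<^sup>+y. g y \<partial>lborel) \<noteq> top"
    unfolding g0 using emeasure_lborel_ball_finite[of "0::'a" 1] by auto
  ultimately show ?thesis
    using * by (simp add: mult.commute[of _ "\<integral>\<^sup>+y. g y \<partial>lborel"] ennreal_mult_cancel_left)
qed

lemma nn_integral_gauss_orthogonal:
  fixes Q :: "'a::euclidean_space \<Rightarrow> 'a"
  assumes Q: "orthogonal_transformation Q" and f [measurable]: "f \<in> borel_measurable borel"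
  shows "(\<integral>\<^sup>+x. f (Q x) \<partial>gauss) = (\<integral>\<^sup>+x. f x \<partial>gauss)"
proof -
  have isom: "\<And>x. norm (Q x) = norm x"
    using Q by (auto simp: orthogonal_transformation)
  have [measurable]: "Q \<in> borel_measurable borel"
    using Q by (auto simp: orthogonal_transformation linear_conv_bounded_linear
      intro!: borel_measurable_continuous_onI linear_continuous_on)
  have *: "(\<Prod>b\<in>Basis. std_normal_density (x \<bullet> b)) = (\<Prod>b\<in>Basis. std_normal_density (Q x \<bullet> b))" for x
    unfolding gauss_density_eq isom ..
  have "(\<integral>\<^sup>+x. f (Q x) \<partial>gauss)
      = (\<integral>\<^sup>+x. ennreal (\<Prod>b\<in>Basis. std_normal_density (Q x \<bullet> b)) * f (Q x) \<partial>lborel)"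
    unfolding gauss_def by (subst nn_integral_density) (auto simp flip: *)
  also have "\<dots> = (\<integral>\<^sup>+x. f x \<partial>gauss)"
    unfolding gauss_def by (subst nn_integral_density)
      (auto intro!: nn_integral_lborel_orthogonal[OF Q, of "\<lambda>x. ennreal (\<Prod>b\<in>Basis. std_normal_density (x \<bullet> b)) * f x"])
  finally show ?thesis .
qed

text \<open>Equal norms make the assignment of \<open>B x\<close> to \<open>A x\<close> a
  well-defined isometry between the ranges. The orthogonal complements of the ranges then have equal
  dimension, and an isometry between them completes the map.\<close>

lemma isometry_extension:
  fixes A B :: "'g::euclidean_space \<Rightarrow> 'h::euclidean_space"
  assumes A: "linear A" and B: "linear B" and eq: "\<And>x. norm (A x) = norm (B x)"
  shows "\<exists>Q. orthogonal_transformation Q \<and> (\<forall>x. Q (A x) = B x)"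
proof -
  obtain h where h: "linear h" "\<And>v. v \<in> range A \<Longrightarrow> A (h v) = v"
    using linear_exists_right_inverse_on[OF A subspace_UNIV] by auto
  define \<phi> where "\<phi> = B \<circ> h"
  have lphi: "linear \<phi>" unfolding \<phi>_def using h B by (simp add: linear_compose)
  have phi: "\<phi> (A x) = B x" for x
  proof -
    \<comment> \<open>\<open>h (A x)\<close> and \<open>x\<close> differ by a vector in the kernel
      of \<open>A\<close>; by equality of norms \<open>B\<close> kills it too.\<close>
    have "A (h (A x) - x) = 0" using A h by (simp add: linear_diff)
    then have "norm (B (h (A x) - x)) = 0" by (metis eq norm_zero)
    then show ?thesis using B by (simp add: linear_diff \<phi>_def)
  qed
  define S T where "S = range A" and "T = range B"
  have sub: "subspace S" "subspace T"
    using A B by (auto simp: S_def T_def intro: linear_subspace_image)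
  have phin: "norm (\<phi> x) = norm x" if "x \<in> S" for x
    using that phi eq by (auto simp: S_def)
  have phiS: "\<phi> ` S = T" by (auto simp: S_def T_def phi image_iff)
  have dimST: "dim S = dim T"
    unfolding phiS[symmetric]
  proof (rule dim_image_eq[symmetric, OF lphi])
    show "inj_on \<phi> (span S)"
      unfolding span_eq_iff[THEN iffD2, OF sub(1)]
    proof (rule inj_onI)
      fix x y assume "x \<in> S" "y \<in> S" and e: "\<phi> x = \<phi> y"
      then have "norm (\<phi> (x - y)) = norm (x - y)" using sub(1) by (intro phin subspace_diff)
      then show "x = y" using e lphi by (simp add: linear_diff)
    qed
  qed
  define S' T' where "S' = {y \<in> UNIV. \<forall>x\<in>S. orthogonal x y}" and "T' = {y \<in> UNIV. \<forall>x\<in>T. orthogonal x y}"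
  have "dim S' + dim S = dim T' + dim T"
    unfolding S'_def T'_def using dim_subspace_orthogonal_to_vectors[OF sub(1) subspace_UNIV]
      dim_subspace_orthogonal_to_vectors[OF sub(2) subspace_UNIV] by simp
  then have d': "dim S' = dim T'" using dimST by simp
  have sub': "subspace S'" "subspace T'"
    unfolding S'_def T'_def using subspace_orthogonal_to_vectors by auto
  obtain \<psi> where psi: "linear \<psi>" "\<psi> ` S' = T'" "\<And>x. x \<in> S' \<Longrightarrow> norm (\<psi> x) = norm x"
    using isometries_subspaces[OF sub' d'] by metis
  obtain C where C: "C \<subseteq> S" "pairwise orthogonal C" "\<And>x. x \<in> C \<Longrightarrow> norm x = 1" "span C = S"
    using orthonormal_basis_subspace[OF sub(1)] by metis
  \<comment> \<open>The orthogonal projection onto \<open>S\<close>, written in the orthonormal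
    basis \<open>C\<close>. The map \<open>Q\<close> will act by \<open>\<phi>\<close> on the
    projection and by \<open>\<psi>\<close> on the rest.\<close>
  define p where "p = (\<lambda>x. \<Sum>b\<in>C. (b \<bullet> x / (b \<bullet> b)) *\<^sub>R b)"
  have lp: "linear p"
    unfolding p_def by (intro linear_compose_sum ballI)
      (auto intro!: linearI simp: inner_right_distrib add_divide_distrib scaleR_add_left)
  have pS: "p x \<in> S" for x
    unfolding p_def using C(1) sub(1) by (intro subspace_sum subspace_scale) auto
  have pS': "x - p x \<in> S'" for x
    unfolding S'_def p_def using Gram_Schmidt_step[OF C(2), of _ x] C(4) by auto
  define Q where "Q = (\<lambda>x. \<phi> (p x) + \<psi> (x - p x))"
  have "linear Q" unfolding Q_def
    by (intro linear_compose_add linear_compose[OF lp lphi, unfolded o_def]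
        linear_compose[OF _ psi(1), unfolded o_def] linear_compose_sub lp linear_ident)
  moreover have "norm (Q x) = norm x" for x
  proof -
    have a: "\<phi> (p x) \<in> T" "\<psi> (x - p x) \<in> T'" using pS pS' phiS psi(2) by blast+
    have "(norm (Q x))\<^sup>2 = (norm (\<phi> (p x)))\<^sup>2 + (norm (\<psi> (x - p x)))\<^sup>2"
      unfolding Q_def by (rule norm_add_Pythagorean) (use a in \<open>auto simp: T'_def\<close>)
    also have "\<dots> = (norm (p x))\<^sup>2 + (norm (x - p x))\<^sup>2"
      by (simp add: phin pS pS' psi(3))
    also have "\<dots> = (norm (p x + (x - p x)))\<^sup>2"
      by (rule norm_add_Pythagorean[symmetric]) (use pS[of x] pS'[of x] in \<open>auto simp: S'_def\<close>)
    finally show ?thesis by simp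
  qed
  moreover have "Q (A x) = B x" for x
  proof -
    \<comment> \<open>This vector lies both in \<open>S\<close> and in its orthogonal complement, so
      it is zero.\<close>
    have "A x - p (A x) \<in> S" using pS sub(1) by (auto intro: subspace_diff simp: S_def)
    then have "orthogonal (A x - p (A x)) (A x - p (A x))" using pS'[of "A x"] by (auto simp: S'_def)
    then have "p (A x) = A x" by (simp add: orthogonal_self)
    then show ?thesis using psi(1) by (simp add: Q_def phi linear_0)
  qed
  ultimately show ?thesis by (auto simp: orthogonal_transformation)
qed

section \<open>Linear images of a standard Gaussian\<close>

lemma borel_measurable_linear:
  fixes A :: "'a::euclidean_space \<Rightarrow> 'b::euclidean_space"
  shows "linear A \<Longrightarrow> A \<in> borel_measurable borel"
  by (auto simp: linear_conv_bounded_linear intro!: borel_measurable_continuous_onI linear_continuous_on)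

lemma linear_Pair:
  "linear A \<Longrightarrow> linear B \<Longrightarrow> linear (\<lambda>z. (A z, B z))"
  by (auto simp: linear_iff)

text \<open>Both maps are extended to the product space, where a rotation carries one to the other.\<close>

lemma gauss_linear_image_unique:
  fixes A :: "'a::euclidean_space \<Rightarrow> 'g::euclidean_space" and B :: "'b::euclidean_space \<Rightarrow> 'g"
  assumes A: "linear A" and B: "linear B" and eq: "\<And>x. norm (adjoint A x) = norm (adjoint B x)"
    and f [measurable]: "f \<in> borel_measurable borel"
  shows "(\<integral>\<^sup>+z. f (A z) \<partial>gauss) = (\<integral>\<^sup>+z. f (B z) \<partial>gauss)"
proof -
  have [measurable]: "A \<in> borel_measurable borel" "B \<in> borel_measurable borel"
    using A B by (auto intro: borel_measurable_linear)
  \<comment> \<open>Equal norms of the adjoints say that the two images have the same covariance.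
    The adjoints are placed in different factors, padded by zeros, so that one orthogonal map can
    exchange them.\<close>
  define A' B' where "A' = (\<lambda>x. (adjoint A x, 0::'b))" and "B' = (\<lambda>x. (0::'a, adjoint B x))"
  have "linear A'" "linear B'" unfolding A'_def B'_def
    using adjoint_linear[OF A] adjoint_linear[OF B] by (auto simp: linear_iff)
  moreover have "norm (A' x) = norm (B' x)" for x by (simp add: A'_def B'_def norm_Pair eq)
  ultimately obtain Q where Q: "orthogonal_transformation Q" and QA: "\<And>x. Q (A' x) = B' x"
    using isometry_extension by metis
  \<comment> \<open>The dual form of \<open>Q (A' x) = B' x\<close>: after applying
    \<open>Q\<close>, the map \<open>B\<close> of the second component is \<open>A\<close> of the
    original first component.\<close>
  have AB: "A (fst z) = B (snd (Q z))" for z :: "'a \<times> 'b"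
  proof (rule vector_eq_ldot[THEN iffD1], rule allI)
    fix x
    have "x \<bullet> A (fst z) = A' x \<bullet> z"
      by (cases z) (simp add: A'_def adjoint_clauses[OF A])
    also have "\<dots> = B' x \<bullet> Q z"
      using Q by (simp only: orthogonal_transformation_def flip: QA)
    also have "\<dots> = x \<bullet> B (snd (Q z))"
      by (cases "Q z") (simp add: B'_def adjoint_clauses[OF B])
    finally show "x \<bullet> A (fst z) = x \<bullet> B (snd (Q z))" .
  qed
  have m: "(\<lambda>z::'a \<times> 'b. f (A (fst z))) \<in> borel_measurable borel"
    "(\<lambda>z::'a \<times> 'b. f (B (snd z))) \<in> borel_measurable borel"
    unfolding borel_prod[symmetric] by measurable
  have "(\<integral>\<^sup>+z. f (A z) \<partial>gauss) = (\<integral>\<^sup>+z. f (A (fst z)) \<partial>(gauss :: ('a \<times> 'b) measure))"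
    by (simp add: nn_integral_gauss_prod[OF m(1)] gauss.emeasure_space_1[simplified])
  also have "\<dots> = (\<integral>\<^sup>+z. f (B (snd z)) \<partial>(gauss :: ('a \<times> 'b) measure))"
    unfolding AB by (rule nn_integral_gauss_orthogonal[OF Q m(2)])
  also have "\<dots> = (\<integral>\<^sup>+z. f (B z) \<partial>gauss)"
    by (simp add: nn_integral_gauss_prod[OF m(2)] gauss.emeasure_space_1[simplified])
  finally show ?thesis .
qed

lemma adjoint_Pair:
  fixes A :: "'h::euclidean_space \<Rightarrow> 'a::euclidean_space" and B :: "'h \<Rightarrow> 'b::euclidean_space"
  assumes "linear A" "linear B"
  shows "adjoint (\<lambda>z. (A z, B z)) = (\<lambda>(x, y). adjoint A x + adjoint B y)"
  by (rule adjoint_unique) (auto simp: adjoint_clauses[OF assms(1)] adjoint_clauses[OF assms(2)]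
      adjoint_works[OF assms(1)] adjoint_works[OF assms(2)] inner_add_right)

lemma adjoint_fst_snd:
  fixes A :: "'h::euclidean_space \<Rightarrow> 'a::euclidean_space" and B :: "'i::euclidean_space \<Rightarrow> 'a"
  assumes "linear A" "linear B"
  shows "adjoint (\<lambda>z. A (fst z) + B (snd z)) = (\<lambda>x. (adjoint A x, adjoint B x))"
  by (rule adjoint_unique) (auto simp: adjoint_works[OF assms(1)] adjoint_works[OF assms(2)] inner_add_left)

text \<open>Orthogonal adjoints mean that \<open>A z\<close> and \<open>B z\<close> are
  uncorrelated. The pair then has the covariance, hence the law, of a pair computed from two
  independent Gaussians.\<close>

lemma gauss_uncorrelated_independent:
  fixes A :: "'h::euclidean_space \<Rightarrow> 'a::euclidean_space" and B :: "'h \<Rightarrow> 'b::euclidean_space"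
  assumes A: "linear A" and B: "linear B" and orth: "\<And>x y. adjoint A x \<bullet> adjoint B y = 0"
    and f [measurable]: "f \<in> borel_measurable borel"
  shows "(\<integral>\<^sup>+z. f (A z, B z) \<partial>gauss) = (\<integral>\<^sup>+z. (\<integral>\<^sup>+z'. f (A z', B z) \<partial>gauss) \<partial>gauss)"
proof -
  have [measurable]: "A \<in> borel_measurable borel" "B \<in> borel_measurable borel"
    using A B by (auto intro: borel_measurable_linear)
  let ?C = "\<lambda>z. (A (snd z), B (fst z))"
  have fs: "linear (\<lambda>z. A (snd z))" "linear (\<lambda>z. B (fst z))"
    using linear_compose[OF linear_snd A] linear_compose[OF linear_fst B] by (simp_all add: o_def)
  have adj: "adjoint ?C = (\<lambda>(x, y). (adjoint B y, adjoint A x))"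
    by (rule adjoint_unique) (auto simp: adjoint_works[OF A] adjoint_works[OF B])
  have "(\<integral>\<^sup>+z. f (A z, B z) \<partial>gauss) = (\<integral>\<^sup>+z. f (?C z) \<partial>gauss)"
  proof (rule gauss_linear_image_unique[OF linear_Pair[OF A B] linear_Pair[OF fs] _ f])
    fix w :: "'a \<times> 'b"
    obtain x y where w: "w = (x, y)" by (cases w)
    have "(norm (adjoint A x + adjoint B y))\<^sup>2 = (norm (adjoint A x))\<^sup>2 + (norm (adjoint B y))\<^sup>2"
      by (rule norm_add_Pythagorean) (simp add: orthogonal_def orth)
    then show "norm (adjoint (\<lambda>z. (A z, B z)) w) = norm (adjoint ?C w)"
      by (simp add: w adj adjoint_Pair[OF A B] norm_Pair real_sqrt_unique add.commute)
  qed
  also have "\<dots> = (\<integral>\<^sup>+z. (\<integral>\<^sup>+z'. f (A z', B z) \<partial>gauss) \<partial>gauss)"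
    by (subst nn_integral_gauss_prod) (auto simp: measurable_compose[OF _ f] fs borel_measurable_linear linear_Pair)
  finally show ?thesis .
qed

text \<open>A hyperplane is a Lebesgue null set and \<open>gauss\<close> has a density. This later
  excludes that an expected square degenerates to zero.\<close>

lemma AE_gauss_hyperplane:
  fixes w :: "'a::euclidean_space"
  assumes "w \<noteq> 0"
  shows "AE z in gauss. c + w \<bullet> z \<noteq> 0"
proof -
  have "negligible {z. w \<bullet> z = - c}"
    using assms by (intro negligible_hyperplane) auto
  then have "{z. w \<bullet> z = - c} \<in> null_sets lebesgue"
    by (simp add: negligible_iff_null_sets)
  moreover have "{z. w \<bullet> z = - c} \<in> sets borel" by measurable
  ultimately have "{z. w \<bullet> z = - c} \<in> null_sets lborel"
    by (auto simp: null_sets_def)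
  then have "AE z in lborel. c + w \<bullet> z \<noteq> 0"
    by (rule AE_I') (auto simp: add_eq_0_iff)
  then show ?thesis unfolding gauss_def by (subst AE_density) auto
qed

text \<open>Source of the dominating functions: values are bounded and the moments grow at most
  quadratically. The square of one coordinate is absorbed into its own factor of the density, which
  leaves one-dimensional moments.\<close>

lemma integrable_gauss_norm_squared: "integrable gauss (\<lambda>z::'a::euclidean_space. (norm z)\<^sup>2)"
proof -
  have "integrable gauss (\<lambda>z::'a. (z \<bullet> a)\<^sup>2)" if a: "a \<in> Basis" for a
  proof (rule integrableI_bounded)
    have "(\<integral>\<^sup>+z. ennreal (norm ((z \<bullet> a)\<^sup>2)) \<partial>(gauss :: 'a measure))
      = (\<integral>\<^sup>+z. (\<Prod>b\<in>Basis. ennreal (std_normal_density (z \<bullet> b)) * (if b = a then ennreal ((z \<bullet> b)\<^sup>2) else 1)) \<partial>lborel)"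
      unfolding gauss_def
      by (subst nn_integral_density)
        (auto simp: prod_ennreal prod.distrib prod.If_cases a prod.delta intro!: nn_integral_cong)
    also have "\<dots> = (\<Prod>b\<in>Basis. (\<integral>\<^sup>+x. ennreal (std_normal_density x) * (if b = a then ennreal (x\<^sup>2) else 1) \<partial>lborel))"
      by (rule nn_integral_lborel_prod) auto
    also have "\<dots> < \<infinity>"
    proof -
      have "(\<integral>\<^sup>+x. ennreal (std_normal_density x) * (if b = a then ennreal (x\<^sup>2) else 1) \<partial>lborel) \<noteq> \<infinity>" for b
        using integrable_std_normal_moment[of 2] integrable_std_normal_moment[of 0]
        by (cases "b = a") (auto simp: nn_integral_eq_integral simp flip: ennreal_mult)
      then show ?thesis by (auto simp: ennreal_prod_eq_top simp flip: less_top)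
    qed
    finally show "(\<integral>\<^sup>+z. ennreal (norm ((z \<bullet> a)\<^sup>2)) \<partial>(gauss :: 'a measure)) < \<infinity>" .
  qed auto
  then have "integrable gauss (\<lambda>z::'a. \<Sum>a\<in>Basis. (z \<bullet> a)\<^sup>2)" by auto
  also have "(\<lambda>z::'a. \<Sum>a\<in>Basis. (z \<bullet> a)\<^sup>2) = (\<lambda>z. (norm z)\<^sup>2)"
    unfolding power2_norm_eq_inner euclidean_inner[of z z for z] by (simp add: power2_eq_square)
  finally show ?thesis .
qed


section \<open>Gaussian laws with a given covariance matrix\<close>

lemma outer_mult_vec: "outer b *v x = (b \<bullet> x) *\<^sub>R b"
  by (simp add: outer_def matrix_vector_mult_def vec_eq_iff inner_vec_def sum_distrib_left sum_distrib_right mult_ac)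

lemma symmetric_entry: "transpose S = S \<Longrightarrow> S $ i $ j = S $ j $ i"
  by (drule arg_cong[where f = "\<lambda>M. M $ i $ j"]) (simp add: transpose_def)

text \<open>With a zero diagonal entry, the quadratic form at \<open>r\<close> times the
  \<open>i\<close>-th plus the \<open>j\<close>-th unit vector is affine in \<open>r\<close>. A
  nonzero slope would make it negative somewhere.\<close>

lemma psd_entry_zero:
  assumes S: "psd S" and z: "S $ i $ i = 0"
  shows "S $ i $ j = 0"
proof (rule ccontr)
  assume nz: "S $ i $ j \<noteq> 0"
  \<comment> \<open>Chosen so that the affine function \<open>2 * r * S $ i $ j + S $ j $ j\<close>
    takes the value -1.\<close>
  define r where "r = - (S $ j $ j + 1) / (2 * S $ i $ j)"
  have sym: "S $ j $ i = S $ i $ j" using S symmetric_entry by (auto simp: psd_def)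
  have col: "(S *v axis m 1) $ l = S $ l $ m" for m l
    by (simp add: matrix_vector_mult_basis column_def)
  define x where "x = r *\<^sub>R axis i 1 + axis j (1::real)"
  have "x \<bullet> (S *v x) = r * (r * S $ i $ i + S $ i $ j) + (r * S $ j $ i + S $ j $ j)"
    by (simp add: x_def inner_add_left inner_axis' matrix_vector_right_distrib col
        matrix_vector_mult_scaleR)
  also have "\<dots> = 2 * r * S $ i $ j + S $ j $ j" by (simp add: z sym)
  also have "\<dots> = - 1" using nz by (simp add: r_def field_simps)
  finally show False using S unfolding psd_def by (metis neg_0_le_iff_le not_one_le_zero)
qed

text \<open>Cholesky factorisation: eliminating the nonzero rows one at a time yields \<open>S\<close> as a sum of
  rank-one matrices.\<close>

lemma psd_sum_outer:
  fixes S :: "real^'i^'i"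
  assumes "psd S" and "finite J" and "\<And>i. i \<notin> J \<Longrightarrow> S $ i $ i = 0"
  shows "\<exists>v. \<forall>x. x \<bullet> (S *v x) = (\<Sum>j\<in>J. (v j \<bullet> x)\<^sup>2)"
  using assms(2,1,3)
proof (induction J arbitrary: S rule: finite_induct)
  case empty
  have "S $ i $ j = 0" for i j
    by (rule psd_entry_zero[OF empty.prems(1) empty.prems(2)]) simp
  then have "S = 0" by (simp add: vec_eq_iff)
  then show ?case by simp
next
  case (insert m J)
  have sym: "S $ a $ b = S $ b $ a" for a b
    using insert.prems(1) symmetric_entry by (auto simp: psd_def)
  have col: "axis m 1 \<bullet> (S *v axis m 1) = S $ m $ m"
    by (simp add: matrix_vector_mult_basis column_def inner_axis')
  have nn: "0 \<le> S $ m $ m"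
    using insert.prems(1) col unfolding psd_def by metis
  \<comment> \<open>Scaled so that \<open>outer w\<close> reproduces row and column \<open>m\<close>
    of \<open>S\<close>. If the pivot is zero, division by zero gives \<open>w = 0\<close>, which is
    right because the row then vanishes already.\<close>
  define w where "w = (1 / sqrt (S $ m $ m)) *\<^sub>R row m S"
  define S' where "S' = S - outer w"
  have Se: "x \<bullet> (S *v axis m 1) = row m S \<bullet> x" for x
    by (simp add: matrix_vector_mult_basis column_def row_def inner_commute sym[of _ m])
  have row_axis: "row m S \<bullet> axis m 1 = S $ m $ m"
    by (simp add: inner_axis row_def)
  have q': "x \<bullet> (S' *v x) = x \<bullet> (S *v x) - (w \<bullet> x)\<^sup>2" for x
    by (simp add: S'_def matrix_vector_mult_diff_rdistrib inner_diff_right outer_mult_vec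
        power2_eq_square inner_commute)
  have psd': "psd S'"
    unfolding psd_def
  proof (intro conjI allI)
    show "transpose S' = S'"
      by (simp add: S'_def outer_def transpose_def vec_eq_iff sym mult.commute)
    fix x
    \<comment> \<open>Subtracting this multiple of the \<open>m\<close>-th unit vector minimizes the
      form, and the minimum is the Schur complement. A zero pivot gives
      \<open>r = 0\<close>.\<close>
    define r where "r = (row m S \<bullet> x) / S $ m $ m"
    have "0 \<le> (x - r *\<^sub>R axis m 1) \<bullet> (S *v (x - r *\<^sub>R axis m 1))"
      using insert.prems(1) by (simp add: psd_def)
    also have "\<dots> = x \<bullet> (S *v x) - r * (axis m 1 \<bullet> (S *v x)) - r * (row m S \<bullet> x) + r\<^sup>2 * S $ m $ m"
      by (simp add: matrix_vector_mult_diff_distrib matrix_vector_mult_scaleR inner_diff_left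
          inner_diff_right Se row_axis power2_eq_square algebra_simps)
    also have "axis m 1 \<bullet> (S *v x) = row m S \<bullet> x"
      by (simp add: inner_axis' matrix_vector_mul_component row_def vec_nth_inverse)
    also have "x \<bullet> (S *v x) - r * (row m S \<bullet> x) - r * (row m S \<bullet> x) + r\<^sup>2 * S $ m $ m
        = x \<bullet> (S *v x) - (row m S \<bullet> x)\<^sup>2 / S $ m $ m"
      by (cases "S $ m $ m = 0") (simp_all add: r_def power2_eq_square field_simps)
    also have "\<dots> = x \<bullet> (S' *v x)"
      using nn by (simp add: q' w_def power_mult_distrib power_divide)
    finally show "0 \<le> x \<bullet> (S' *v x)" .
  qed
  have "S' $ i $ i = 0" if "i \<notin> J" for i
  proof (cases "i = m")
    case True
    then show ?thesis using nn by (simp add: S'_def outer_def w_def row_def)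
  next
    case False
    then have "S $ i $ i = 0" using that insert.prems(2) by simp
    then have "S $ i $ m = 0" by (rule psd_entry_zero[OF insert.prems(1)])
    then have "S $ m $ i = 0" using sym[of m i] by simp
    then show ?thesis using \<open>S $ i $ i = 0\<close> by (simp add: S'_def outer_def w_def row_def)
  qed
  from insert.IH[OF psd' this] obtain v where v: "\<And>x. x \<bullet> (S' *v x) = (\<Sum>j\<in>J. (v j \<bullet> x)\<^sup>2)"
    by auto
  show ?case
  proof (intro exI allI)
    fix x
    have "(\<Sum>j\<in>J. ((v(m := w)) j \<bullet> x)\<^sup>2) = (\<Sum>j\<in>J. (v j \<bullet> x)\<^sup>2)"
      using insert.hyps by (intro sum.cong) auto
    then show "x \<bullet> (S *v x) = (\<Sum>j\<in>insert m J. ((v(m := w)) j \<bullet> x)\<^sup>2)"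
      using insert.hyps v[of x] q'[of x] by simp
  qed
qed

text \<open>By polarization.\<close>

lemma symmetric_quadratic_form_eqI:
  fixes S R :: "real^'i^'i"
  assumes "transpose S = S" "transpose R = R" and q: "\<And>x. x \<bullet> (S *v x) = x \<bullet> (R *v x)"
  shows "S = R"
proof -
  have "x \<bullet> (S *v y) = x \<bullet> (R *v y)" for x y
  proof -
    have c: "y \<bullet> (S *v x) = x \<bullet> (S *v y)" "y \<bullet> (R *v x) = x \<bullet> (R *v y)"
      using dot_lmul_matrix[of y S x] dot_lmul_matrix[of y R x] transpose_matrix_vector[of S y]
        transpose_matrix_vector[of R y] by (simp_all only: assms(1,2) inner_commute)
    show ?thesis
      using q[of "x + y"] q[of x] q[of y]
      by (simp add: matrix_vector_right_distrib inner_add_left inner_add_right c)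
  qed
  then have "S *v y = R *v y" for y by (metis vector_eq_ldot)
  then show ?thesis by (simp add: matrix_eq)
qed

lemma norm_transpose_squared:
  fixes L :: "real^'j^'i"
  shows "(norm (transpose L *v x))\<^sup>2 = x \<bullet> ((L ** transpose L) *v x)"
  unfolding power2_norm_eq_inner matrix_vector_mul_assoc[symmetric]
  by (simp add: dot_lmul_matrix)

text \<open>The vectors of the sum of squares become the columns of \<open>L\<close>.\<close>

lemma psd_factor:
  fixes S :: "real^'i^'i"
  assumes "psd S"
  shows "\<exists>L :: real^'i^'i. L ** transpose L = S"
proof -
  obtain v :: "'i \<Rightarrow> real^'i" where v: "\<And>x. x \<bullet> (S *v x) = (\<Sum>j\<in>UNIV. (v j \<bullet> x)\<^sup>2)"
    using psd_sum_outer[OF assms, of UNIV] by auto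
  define L :: "real^'i^'i" where "L = (\<chi> i j. v j $ i)"
  have "L ** transpose L = S"
  proof (rule symmetric_quadratic_form_eqI)
    show "transpose (L ** transpose L) = L ** transpose L" by (simp add: matrix_transpose_mul)
    show "transpose S = S" using assms by (simp add: psd_def)
    fix x
    have "(transpose L *v x) $ j = v j \<bullet> x" for j
      by (simp add: L_def matrix_vector_mult_def transpose_def inner_vec_def)
    then show "x \<bullet> ((L ** transpose L) *v x) = x \<bullet> (S *v x)"
      unfolding v norm_transpose_squared[symmetric] power2_norm_eq_inner inner_vec_def[of "transpose L *v x"]
      by (simp only: power2_eq_square inner_real_def)
  qed
  then show ?thesis by blast
qed

text \<open>The very choice made in \<open>mvnormal\<close>, so that \<open>mvnormal_gauss\<close>
  is an unfolding.\<close>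

definition chol :: "real^'i^'i \<Rightarrow> real^'i^'i" where
  "chol S = (SOME L. L ** transpose L = S)"

lemma chol: "psd S \<Longrightarrow> chol S ** transpose (chol S) = S"
  unfolding chol_def by (rule someI_ex[OF psd_factor])

lemma prod_Basis_vec:
  fixes z :: "real^'i"
  shows "(\<Prod>b\<in>Basis. f (z \<bullet> b)) = (\<Prod>i\<in>UNIV. f (z $ i))"
proof -
  have "bij_betw (\<lambda>i. axis i (1::real)) (UNIV :: 'i set) Basis"
    by (auto simp: bij_betw_def inj_on_def axis_eq_axis Basis_vec_def)
  from prod.reindex_bij_betw[OF this, of "\<lambda>b. f (z \<bullet> b)"] show ?thesis
    by (simp add: inner_axis)
qed

lemma mvnormal_gauss: "mvnormal m S = distr gauss borel (\<lambda>z. m + chol S *v z)"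
  by (simp add: mvnormal_def gauss_def prod_Basis_vec chol_def)

lemma sets_mvnormal [simp, measurable_cong]: "sets (mvnormal m S) = sets borel"
  and space_mvnormal [simp]: "space (mvnormal m S) = UNIV"
  by (simp_all add: mvnormal_def)

lemma borel_measurable_matrix_vector_mult [measurable (raw)]:
  "f \<in> borel_measurable M \<Longrightarrow> (\<lambda>z. (A :: real^'i^'j) *v f z) \<in> borel_measurable M"
  by (rule measurable_compose[OF _ borel_measurable_linear]) auto

lemma prob_space_mvnormal: "prob_space (mvnormal m S)"
  unfolding mvnormal_gauss by (rule prob_space.prob_space_distr[OF prob_space_gauss]) measurable

interpretation mvnormal: prob_space "mvnormal m S" for m S
  by (rule prob_space_mvnormal)

text \<open>Frees the law from the chosen square root: any linear image of a standard Gaussian, on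
  whatever space, with the right covariance represents it. The posterior error, which lives on a
  product space, needs this freedom.\<close>

lemma mvnormal_eq_distr:
  fixes A :: "'h::euclidean_space \<Rightarrow> real^'i"
  assumes S: "psd S" and A: "linear A" and n: "\<And>x. (norm (adjoint A x))\<^sup>2 = x \<bullet> (S *v x)"
  shows "mvnormal m S = distr gauss borel (\<lambda>z. m + A z)"
proof (rule measure_eqI)
  have [measurable]: "A \<in> borel_measurable borel" using A by (rule borel_measurable_linear)
  fix X assume "X \<in> sets (mvnormal m S)"
  then have [measurable]: "X \<in> sets borel" by simp
  have "norm (adjoint ((*v) (chol S)) x) = norm (adjoint A x)" for x
  proof -
    have "(norm (adjoint ((*v) (chol S)) x))\<^sup>2 = (norm (adjoint A x))\<^sup>2"
      by (simp only: n adjoint_matrix norm_transpose_squared chol[OF S])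
    then show ?thesis by simp
  qed
  then have "(\<integral>\<^sup>+z. indicator X (m + chol S *v z) \<partial>gauss) = (\<integral>\<^sup>+z. indicator X (m + A z) \<partial>gauss)"
    by (rule gauss_linear_image_unique[where f = "\<lambda>y. indicator X (m + y)", OF matrix_vector_mul_linear A]) measurable
  then show "emeasure (mvnormal m S) X = emeasure (distr gauss borel (\<lambda>z. m + A z)) X"
    unfolding mvnormal_gauss by (simp add: nn_integral_distr flip: nn_integral_indicator)
qed simp


section \<open>Conditioning on a noisy signal\<close>

lemma matrix_inv_right: "invertible A \<Longrightarrow> A ** matrix_inv A = mat 1"
  and matrix_inv_left: "invertible A \<Longrightarrow> matrix_inv A ** A = mat 1"
  for A :: "real^'i^'i"
  unfolding invertible_def matrix_inv_def by (metis (mono_tags, lifting) someI_ex)+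

section \<open>Continuity of matrix expressions\<close>

lemma continuous_on_matrix_vector_mult [continuous_intros]:
  fixes A :: "'a::topological_space \<Rightarrow> real^'i^'j"
  shows "continuous_on X A \<Longrightarrow> continuous_on X b \<Longrightarrow> continuous_on X (\<lambda>x. A x *v b x)"
  unfolding matrix_vector_mult_def
  by (intro continuous_on_vec_lambda continuous_on_sum continuous_on_mult continuous_on_component)

lemma continuous_on_matrix_matrix_mult [continuous_intros]:
  fixes A :: "'a::topological_space \<Rightarrow> real^'i^'j"
  shows "continuous_on X A \<Longrightarrow> continuous_on X B \<Longrightarrow> continuous_on X (\<lambda>x. A x ** B x)"
  unfolding matrix_matrix_mult_def
  by (intro continuous_on_vec_lambda continuous_on_sum continuous_on_mult continuous_on_component)

lemma continuous_on_det [continuous_intros]: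
  fixes A :: "'a::topological_space \<Rightarrow> real^'i^'i"
  shows "continuous_on X A \<Longrightarrow> continuous_on X (\<lambda>x. det (A x))"
  unfolding det_def
  by (intro continuous_on_sum continuous_on_mult continuous_on_prod continuous_on_component continuous_on_const)

text \<open>By Cramer's rule the solution of a linear system is a quotient of determinants, which
  are polynomials in the entries.\<close>

lemma continuous_on_matrix_inv_mult:
  fixes A :: "'a::topological_space \<Rightarrow> real^'i^'i"
  assumes A: "continuous_on X A" and b: "continuous_on X b" and inv: "\<And>x. x \<in> X \<Longrightarrow> invertible (A x)"
  shows "continuous_on X (\<lambda>x. matrix_inv (A x) *v b x)"
proof -
  have "matrix_inv (A x) *v b x = (\<chi> k. det (\<chi> i j. if j = k then b x $ i else A x $ i $ j) / det (A x))"
    if x: "x \<in> X" for x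
  proof (rule cramer[THEN iffD1])
    show "det (A x) \<noteq> 0" using inv[OF x] by (simp add: invertible_det_nz)
    show "A x *v (matrix_inv (A x) *v b x) = b x"
      by (simp add: matrix_vector_mul_assoc matrix_inv_right inv[OF x])
  qed
  moreover have "continuous_on X (\<lambda>x. \<chi> k. det (\<chi> i j. if j = k then b x $ i else A x $ i $ j) / det (A x))"
  proof (intro continuous_on_vec_lambda continuous_on_divide continuous_on_det A)
    show "\<forall>x\<in>X. det (A x) \<noteq> 0" using inv by (simp add: invertible_det_nz)
    show "continuous_on X (\<lambda>x. if j = k then b x $ i else A x $ i $ j)" for i j k
      using A b by (cases "j = k") (auto intro: continuous_on_component)
  qed
  ultimately show ?thesis by (simp cong: continuous_on_cong)
qed

section \<open>Diagonal matrices\<close>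

definition diagm :: "('i \<Rightarrow> real) \<Rightarrow> real^'i^'i" where
  "diagm w = (\<chi> i j. if i = j then w i else 0)"

lemma diagm_mult_vec: "(diagm w *v x) $ i = w i * x $ i"
proof -
  have "(diagm w *v x) $ i = (\<Sum>m\<in>UNIV. if m = i then w i * x $ i else 0)"
    unfolding matrix_vector_mult_def vec_lambda_beta by (rule sum.cong) (auto simp: diagm_def)
  then show ?thesis by simp
qed

lemma inner_diagm: "(diagm w *v x) \<bullet> y = x \<bullet> (diagm w *v y)"
  by (simp add: inner_vec_def diagm_mult_vec mult_ac)

lemma transpose_diagm [simp]: "transpose (diagm w) = diagm w"
  by (auto simp: diagm_def transpose_def vec_eq_iff)

lemma psd_diagm:
  assumes "\<And>i. 0 \<le> w i"
  shows "psd (diagm w)"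
  unfolding psd_def
  by (auto simp: inner_vec_def diagm_mult_vec intro!: sum_nonneg)
    (metis assms mult.left_commute mult_nonneg_nonneg zero_le_square)

lemma invertible_transpose_iff: "invertible (transpose A) \<longleftrightarrow> invertible A" for A :: "real^'i^'i"
  by (simp add: invertible_det_nz)

text \<open>For \<open>x\<close> in the kernel put \<open>y = diagm w *v x\<close>. Pairing
  \<open>x + S *v y = 0\<close> with \<open>y\<close> gives a sum of two nonnegative terms equal to
  zero, so \<open>y = 0\<close> and then \<open>x = 0\<close>. Both matrices may be
  singular.\<close>

lemma invertible_one_plus_psd_diagm:
  fixes S :: "real^'i^'i"
  assumes S: "psd S" and w: "\<And>i. 0 \<le> w i"
  shows "invertible (mat 1 + S ** diagm w)"
proof -
  have "x = 0" if "(mat 1 + S ** diagm w) *v x = 0" for x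
  proof -
    let ?y = "diagm w *v x"
    have e: "x + S *v ?y = 0"
      using that by (simp add: matrix_vector_mult_add_rdistrib matrix_vector_mul_assoc)
    have "?y \<bullet> x + ?y \<bullet> (S *v ?y) = 0"
      using arg_cong[OF e, of "\<lambda>v. ?y \<bullet> v"] by (simp add: inner_add_right)
    moreover have "0 \<le> ?y \<bullet> (S *v ?y)" using S by (simp add: psd_def)
    moreover have s: "?y \<bullet> x = (\<Sum>i\<in>UNIV. w i * (x $ i)\<^sup>2)"
      by (simp add: inner_vec_def diagm_mult_vec power2_eq_square mult_ac)
    moreover have "0 \<le> (\<Sum>i\<in>UNIV. w i * (x $ i)\<^sup>2)" using w by (intro sum_nonneg) simp
    ultimately have "(\<Sum>i\<in>UNIV. w i * (x $ i)\<^sup>2) = 0" by linarith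
    then have "w i * (x $ i)\<^sup>2 = 0" for i
      using w by (subst (asm) sum_nonneg_eq_0_iff) auto
    then have "?y = 0" by (simp add: vec_eq_iff diagm_mult_vec)
    then show "x = 0" using e by simp
  qed
  then show ?thesis by (simp add: invertible_left_inverse matrix_left_invertible_ker)
qed

lemma transpose_add: "transpose (A + B) = transpose A + transpose B" for A B :: "real^'i^'j"
  by (simp add: transpose_def vec_eq_iff)

lemma matrix_mult_add_right: "(A + B) ** C = A ** C + B ** C" for A B :: "real^'i^'j"
  by (simp add: matrix_matrix_mult_def vec_eq_iff distrib_right sum.distrib)

lemma borel_measurable_vec_lambda:
  fixes f :: "'a \<Rightarrow> 'i::finite \<Rightarrow> real"
  shows "(\<And>i. (\<lambda>x. f x i) \<in> borel_measurable M) \<Longrightarrow> (\<lambda>x. \<chi> i. f x i) \<in> borel_measurable M"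
  by (subst borel_measurable_euclidean_space) (auto simp: Basis_vec_def inner_axis)

lemma borel_measurable_vec_nth [measurable (raw)]:
  fixes f :: "'a \<Rightarrow> real^'i"
  shows "f \<in> borel_measurable M \<Longrightarrow> (\<lambda>x. f x $ i) \<in> borel_measurable M"
  by (rule measurable_compose[OF _ borel_measurable_continuous_onI]) (auto intro: continuous_intros)

section \<open>The filter: gain, signal and prediction error\<close>

locale linear_filter =
  fixes P :: "('n::finite, 'k::finite) lq_data"
  assumes psd_eta: "psd (Sig_eta P)" and theta_pos: "\<And>j. 0 < theta P $ j"
begin

definition prec :: "real^'k \<Rightarrow> 'k \<Rightarrow> real" where
  "prec l j = (exp (l $ j * theta P $ j) - 1) / Sig_eta P $ j $ j"

lemma Prec_v_eq: "Prec_v P l = diagm (prec l)"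
  by (auto simp: Prec_v_def diagm_def prec_def vec_eq_iff)

text \<open>At zero precision both sides are zero through division by zero, matching the placeholder
  that \<open>Sig_v\<close> has for an infinite variance.\<close>

lemma Sig_v_eq: "Sig_v P l = diagm (\<lambda>j. inverse (prec l j))"
  by (simp add: Sig_v_def diagm_def prec_def cong: if_cong)

lemma Sig_eta_diag_nonneg: "0 \<le> Sig_eta P $ j $ j"
proof -
  have "0 \<le> axis j 1 \<bullet> (Sig_eta P *v axis j 1)" using psd_eta by (simp add: psd_def)
  then show ?thesis by (simp add: matrix_vector_mult_basis column_def inner_axis')
qed

definition nonneg :: "(real^'k) set" where
  "nonneg = {l. \<forall>j. 0 \<le> l $ j}"

lemma prec_nonneg: "l \<in> nonneg \<Longrightarrow> 0 \<le> prec l j"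
  using theta_pos[of j] Sig_eta_diag_nonneg[of j] by (auto simp: prec_def nonneg_def intro!: divide_nonneg_nonneg)

lemma prec_eq_0: "l $ j = 0 \<Longrightarrow> prec l j = 0"
  by (simp add: prec_def)

lemma prec_eq_0D: "prec l j = 0 \<Longrightarrow> l $ j \<noteq> 0 \<Longrightarrow> Sig_eta P $ j $ j = 0"
  using theta_pos[of j] by (auto simp: prec_def)

definition Lm :: "real^'k^'k" where "Lm = chol (Sig_eta P)"

lemma Lm_Lm: "Lm *v (x v* Lm) = Sig_eta P *v x"
proof -
  have "Lm *v (transpose Lm *v x) = (Lm ** transpose Lm) *v x" by (rule matrix_vector_mul_assoc)
  then show ?thesis using chol[OF psd_eta] by (simp add: Lm_def)
qed

text \<open>The gain is \<open>core l ** Prec_v P l\<close>. Applied to the noise, the separated precision turns the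
  standard deviation \<open>vh l\<close>, which explodes as attention vanishes, into the continuous \<open>wh l\<close>.\<close>

definition core :: "real^'k \<Rightarrow> real^'k^'k" where
  "core l = Sig_eta P ** matrix_inv (mat 1 + Prec_v P l ** Sig_eta P)"

lemma invertible_core: "l \<in> nonneg \<Longrightarrow> invertible (mat 1 + Prec_v P l ** Sig_eta P)"
  using invertible_one_plus_psd_diagm[OF psd_eta, of "prec l"] psd_eta prec_nonneg
    invertible_transpose_iff[of "mat 1 + Sig_eta P ** diagm (prec l)"]
  by (simp add: Prec_v_eq transpose_add transpose_mat matrix_transpose_mul psd_def)

text \<open>The push-through identity: (I + W S) W = W (I + S W), multiplied by the inverses on
  either side. It moves the precision to the right, where it meets the noise first.\<close>

lemma gain_eq_core:
  assumes l: "l \<in> nonneg"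
  shows "gain P l = core l ** Prec_v P l"
proof -
  let ?S = "Sig_eta P" and ?W = "Prec_v P l"
  let ?A = "mat 1 + ?S ** ?W" and ?B = "mat 1 + ?W ** ?S"
  have A: "invertible ?A"
    using invertible_one_plus_psd_diagm[OF psd_eta, of "prec l"] prec_nonneg[OF l] by (simp add: Prec_v_eq)
  have BA: "?B ** ?W = ?W ** ?A"
    by (simp add: matrix_add_ldistrib matrix_mult_add_right matrix_mul_assoc)
  have "?W ** matrix_inv ?A = (matrix_inv ?B ** ?B) ** ?W ** matrix_inv ?A"
    by (simp add: matrix_inv_left invertible_core[OF l])
  also have "\<dots> = matrix_inv ?B ** (?B ** ?W) ** matrix_inv ?A"
    by (simp only: matrix_mul_assoc)
  also have "\<dots> = matrix_inv ?B ** ?W ** (?A ** matrix_inv ?A)"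
    by (simp only: BA matrix_mul_assoc)
  finally have "?W ** matrix_inv ?A = matrix_inv ?B ** ?W"
    by (simp add: matrix_inv_right A)
  then show ?thesis by (simp add: gain_def core_def matrix_mul_assoc)
qed

lemma core_mult: "l \<in> nonneg \<Longrightarrow> core l *v (y + Prec_v P l *v (Sig_eta P *v y)) = Sig_eta P *v y"
proof -
  assume l: "l \<in> nonneg"
  have "y + Prec_v P l *v (Sig_eta P *v y) = (mat 1 + Prec_v P l ** Sig_eta P) *v y"
    by (simp add: matrix_vector_mult_add_rdistrib matrix_vector_mul_assoc)
  then show ?thesis
    by (simp add: core_def matrix_vector_mul_assoc invertible_core[OF l] matrix_inv_left
        flip: matrix_mul_assoc)
qed

definition wh :: "real^'k \<Rightarrow> real^'k^'k" where
  "wh l = diagm (\<lambda>j. sqrt (prec l j))"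

definition vh :: "real^'k \<Rightarrow> real^'k^'k" where
  "vh l = diagm (\<lambda>j. sqrt (inverse (prec l j)))"

text \<open>The suppression of unattended components in \<open>signal\<close>, as a linear
  map.\<close>

definition act :: "real^'k \<Rightarrow> real^'k^'k" where
  "act l = diagm (\<lambda>j. if l $ j = 0 then 0 else 1)"

text \<open>Here \<open>f\<^sub>t\<^sub>+\<^sub>1 = prior_mean P f + Lm *v fst z\<close> and \<open>v = vh l *v snd z\<close>, with \<open>z\<close> standard normal: \<open>obs\<close> is the
  centred signal, \<open>dev\<close> the correction of the prior mean by the signal and \<open>err\<close> the posterior error.\<close>

definition obs :: "real^'k \<Rightarrow> (real^'k) \<times> (real^'k) \<Rightarrow> real^'k" where
  "obs l z = act l *v (Lm *v fst z + vh l *v snd z)"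

definition dev :: "real^'k \<Rightarrow> (real^'k) \<times> (real^'k) \<Rightarrow> real^'k" where
  "dev l z = core l *v (Prec_v P l *v (Lm *v fst z) + wh l *v snd z)"

definition err :: "real^'k \<Rightarrow> (real^'k) \<times> (real^'k) \<Rightarrow> real^'k" where
  "err l z = Lm *v fst z - dev l z"

lemma linear_obs: "linear (obs l)" and linear_dev: "linear (dev l)" and linear_err: "linear (err l)"
  unfolding obs_def dev_def err_def
  by (auto simp: linear_iff matrix_vector_right_distrib matrix_vector_mult_scaleR algebra_simps)

text \<open>Components without attention have zero precision, so the gain does not notice that they
  are masked.\<close>

lemma Prec_act: "Prec_v P l *v (act l *v x) = Prec_v P l *v x"
  by (auto simp: vec_eq_iff Prec_v_eq act_def diagm_mult_vec prec_eq_0)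

lemma Prec_vh:
  assumes "l \<in> nonneg" shows "Prec_v P l *v (vh l *v x) = wh l *v x"
proof -
  have "prec l i * sqrt (inverse (prec l i)) = sqrt (prec l i)" for i
    using prec_nonneg[OF assms, of i] by (simp add: real_sqrt_inverse real_div_sqrt flip: divide_inverse)
  then show ?thesis by (simp add: vec_eq_iff Prec_v_eq vh_def wh_def diagm_mult_vec flip: mult.assoc)
qed

text \<open>The observation is discontinuous in the attention at zero, but it enters the posterior
  mean only through \<open>dev\<close>, which is continuous.\<close>

lemma gain_obs: "l \<in> nonneg \<Longrightarrow> gain P l *v obs l z = dev l z"
  by (simp add: gain_eq_core obs_def dev_def Prec_act matrix_vector_right_distrib Prec_vh
      flip: matrix_vector_mul_assoc)

lemma adjoint_obs: "adjoint (obs l) y = ((act l *v y) v* Lm, vh l *v (act l *v y))"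
proof -
  have "adjoint (obs l) = (\<lambda>y. ((act l *v y) v* Lm, vh l *v (act l *v y)))"
  proof (rule adjoint_unique, intro allI)
    fix x :: "(real^'k) \<times> (real^'k)" and y
    have "obs l x \<bullet> y = (Lm *v fst x + vh l *v snd x) \<bullet> (act l *v y)"
      by (simp add: obs_def act_def inner_diagm)
    also have "\<dots> = x \<bullet> ((act l *v y) v* Lm, vh l *v (act l *v y))"
      by (cases x) (simp add: inner_add_left vh_def inner_diagm inner_commute[of _ "_ v* _"] dot_lmul_matrix
          inner_commute[of "Lm *v _"])
    finally show "obs l x \<bullet> y = x \<bullet> ((act l *v y) v* Lm, vh l *v (act l *v y))" .
  qed
  then show ?thesis by simp
qed

text \<open>Composing \<open>err\<close> with the adjoint of \<open>obs\<close> computes their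
  covariance. Its vanishing is the normal equation of the best linear estimate.\<close>

lemma err_adjoint_obs:
  assumes l: "l \<in> nonneg"
  shows "err l (adjoint (obs l) y) = 0"
proof -
  let ?y = "act l *v y" and ?S = "Sig_eta P" and ?W = "Prec_v P l"
  \<comment> \<open>Precision times variance: the identity, except that components of zero precision
    are lost to division by zero.\<close>
  define d where "d = diagm (\<lambda>j. if prec l j = 0 then 0 else 1 :: real)"
  have "sqrt (prec l j) * sqrt (inverse (prec l j)) = (if prec l j = 0 then 0 else 1)" for j
    using prec_nonneg[OF l, of j] by (auto simp: real_sqrt_inverse)
  then have whvh: "wh l *v (vh l *v x) = d *v x" for x
    by (simp add: vec_eq_iff wh_def vh_def d_def diagm_mult_vec flip: mult.assoc)
  \<comment> \<open>A component that is observed but dropped by \<open>d\<close> has attention and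
    yet zero precision. Its diagonal entry of \<open>Sig_eta\<close> is then zero, and positive
    semidefiniteness kills the whole column.\<close>
  have S0: "?S *v (?y - d *v ?y) = 0"
  proof -
    have zero: "?S $ i $ j * (?y - d *v ?y) $ j = 0" for i j
    proof (cases "prec l j = 0 \<and> l $ j \<noteq> 0")
      case True
      then have "?S $ j $ i = 0" using prec_eq_0D psd_entry_zero[OF psd_eta] by blast
      then show ?thesis using symmetric_entry[of ?S i j] psd_eta by (simp add: psd_def)
    qed (auto simp: d_def act_def diagm_mult_vec)
    have "?S *v w = 0" if "\<And>i j. ?S $ i $ j * w $ j = 0" for w
      by (simp only: matrix_vector_mult_def that sum.neutral_const) (simp add: vec_eq_iff)
    then show ?thesis using zero by blast
  qed
  have "core l *v (?y - d *v ?y) = 0"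
    using core_mult[OF l, of "?y - d *v ?y"] S0 by simp
  moreover have "core l *v (?y + ?W *v (?S *v ?y)) = ?S *v ?y"
    by (rule core_mult[OF l])
  ultimately have "core l *v (?W *v (?S *v ?y) + d *v ?y) = ?S *v ?y"
    by (simp add: matrix_vector_right_distrib matrix_vector_mult_diff_distrib algebra_simps)
  then show ?thesis
    by (simp add: err_def dev_def adjoint_obs Lm_Lm whvh)
qed

lemma err_obs_orth: "l \<in> nonneg \<Longrightarrow> adjoint (err l) x \<bullet> adjoint (obs l) y = 0"
  by (simp add: adjoint_clauses[OF linear_err] err_adjoint_obs)

text \<open>The error is the factor shock minus the gain times the observation. Being uncorrelated
  with the observation, it has covariance with itself equal to its covariance with the factor
  shock.\<close>

lemma err_adjoint_err:
  assumes l: "l \<in> nonneg"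
  shows "err l (adjoint (err l) x) = post_cov P l *v x"
proof -
  have "adjoint (err l) = (\<lambda>x. (x v* Lm, 0) - adjoint (obs l) (transpose (gain P l) *v x))"
  proof (rule adjoint_unique, intro allI)
    fix z :: "(real^'k) \<times> (real^'k)" and x
    have "err l z \<bullet> x = (Lm *v fst z) \<bullet> x - (gain P l *v obs l z) \<bullet> x"
      by (simp add: err_def gain_obs[OF l] inner_diff_left)
    also have "(Lm *v fst z) \<bullet> x = z \<bullet> (x v* Lm, 0)"
      by (cases z) (simp add: inner_commute[of _ "_ v* _"] dot_lmul_matrix inner_commute[of "Lm *v _"])
    also have "(gain P l *v obs l z) \<bullet> x = obs l z \<bullet> (transpose (gain P l) *v x)"
      by (simp add: inner_commute[of _ "_ v* _"] dot_lmul_matrix inner_commute[of "gain P l *v _"])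
    also have "\<dots> = z \<bullet> adjoint (obs l) (transpose (gain P l) *v x)"
      by (simp only: adjoint_works[OF linear_obs])
    finally show "err l z \<bullet> x = z \<bullet> ((x v* Lm, 0) - adjoint (obs l) (transpose (gain P l) *v x))"
      by (simp add: inner_diff_right)
  qed
  then have "err l (adjoint (err l) x) = err l (x v* Lm, 0)"
    by (simp add: linear_diff[OF linear_err] err_adjoint_obs[OF l])
  also have "\<dots> = post_cov P l *v x"
    by (simp add: err_def dev_def Lm_Lm post_cov_def gain_eq_core[OF l] matrix_vector_mult_diff_rdistrib
        flip: matrix_vector_mul_assoc)
  finally show ?thesis .
qed

lemma norm_adjoint_err: "l \<in> nonneg \<Longrightarrow> (norm (adjoint (err l) x))\<^sup>2 = x \<bullet> (post_cov P l *v x)"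
  by (simp add: power2_norm_eq_inner adjoint_clauses[OF linear_err] err_adjoint_err inner_commute)

text \<open>Symmetry and nonnegativity are not visible in the defining difference; they come from
  its being the covariance of \<open>err\<close>.\<close>

lemma psd_post_cov:
  assumes l: "l \<in> nonneg" shows "psd (post_cov P l)"
  unfolding psd_def
proof (intro conjI allI)
  fix x
  show "0 \<le> x \<bullet> (post_cov P l *v x)" unfolding norm_adjoint_err[OF l, symmetric] by simp
next
  have "x \<bullet> (transpose (post_cov P l) *v y) = x \<bullet> (post_cov P l *v y)" for x y
  proof -
    have "x \<bullet> (transpose (post_cov P l) *v y) = y \<bullet> (post_cov P l *v x)"
      by (simp add: inner_commute[of _ "_ v* _"] dot_lmul_matrix)
    also have "\<dots> = x \<bullet> (post_cov P l *v y)"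
      unfolding err_adjoint_err[OF l, symmetric]
      by (metis adjoint_clauses(2)[OF linear_err] inner_commute)
    finally show ?thesis .
  qed
  then have "transpose (post_cov P l) *v y = post_cov P l *v y" for y by (metis vector_eq_ldot)
  then show "transpose (post_cov P l) = post_cov P l" by (simp only: matrix_eq) simp
qed

lemma mvnormal_post_cov:
  "l \<in> nonneg \<Longrightarrow> mvnormal m (post_cov P l) = distr gauss borel (\<lambda>z. m + err l z)"
  by (intro mvnormal_eq_distr psd_post_cov linear_err norm_adjoint_err)

lemma psd_Sig_v: "l \<in> nonneg \<Longrightarrow> psd (Sig_v P l)"
  unfolding Sig_v_eq using prec_nonneg by (intro psd_diagm) simp

lemma mvnormal_Sig_v: "l \<in> nonneg \<Longrightarrow> mvnormal m (Sig_v P l) = distr gauss borel (\<lambda>z. m + vh l *v z)"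
proof (intro mvnormal_eq_distr psd_Sig_v)
  fix x assume l: "l \<in> nonneg"
  have "adjoint ((*v) (vh l)) = (*v) (vh l)"
    by (rule adjoint_unique) (simp add: vh_def inner_diagm)
  moreover have "(norm (vh l *v x))\<^sup>2 = x \<bullet> (vh l *v (vh l *v x))"
    by (simp add: power2_norm_eq_inner vh_def inner_diagm)
  moreover have "vh l *v (vh l *v x) = Sig_v P l *v x"
  proof -
    have "sqrt (inverse (prec l i)) * (sqrt (inverse (prec l i)) * y) = inverse (prec l i) * y" for i y
      using prec_nonneg[OF l, of i] by (simp flip: mult.assoc)
    then show ?thesis by (simp add: vec_eq_iff vh_def Sig_v_eq diagm_mult_vec)
  qed
  ultimately show "(norm (adjoint ((*v) (vh l)) x))\<^sup>2 = x \<bullet> (Sig_v P l *v x)" by simp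
qed auto

lemma mvnormal_eta: "mvnormal m (Sig_eta P) = distr gauss borel (\<lambda>z. m + Lm *v z)"
  unfolding mvnormal_gauss Lm_def ..

lemma measurable_lin [measurable]:
  "obs l \<in> borel_measurable borel" "dev l \<in> borel_measurable borel" "err l \<in> borel_measurable borel"
  by (auto intro: borel_measurable_linear linear_obs linear_dev linear_err)

lemma measurable_signal [measurable (raw)]:
  assumes [measurable]: "f \<in> borel_measurable M" "g \<in> borel_measurable M" "h \<in> borel_measurable M"
  shows "(\<lambda>x. signal (f x) (g x) (h x) :: real^'i) \<in> borel_measurable M"
  unfolding signal_def by (rule borel_measurable_vec_lambda) measurable

definition sig_of :: "real^'k \<Rightarrow> real^'k \<Rightarrow> (real^'k) \<times> (real^'k) \<Rightarrow> real^'k" where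
  "sig_of f l z = act l *v prior_mean P f + obs l z"

lemma signal_eq: "signal l (prior_mean P f + Lm *v fst z) (vh l *v snd z) = sig_of f l z"
  by (auto simp: vec_eq_iff signal_def sig_of_def obs_def act_def diagm_mult_vec)

lemma post_mean_sig_of:
  assumes "l \<in> nonneg" shows "post_mean P f l (sig_of f l z) = prior_mean P f + dev l z"
proof -
  have "gain P l *v (act l *v x) = gain P l *v x" for x
    by (simp add: gain_eq_core[OF assms] Prec_act flip: matrix_vector_mul_assoc)
  then show ?thesis
    by (simp add: post_mean_def sig_of_def matrix_vector_right_distrib matrix_vector_mult_diff_distrib
        gain_obs[OF assms])
qed

lemma nn_integral_prior:
  assumes l: "l \<in> nonneg" and [measurable]: "(\<lambda>(f', v). G f' v) \<in> borel_measurable (borel \<Otimes>\<^sub>M borel)"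
  shows "(\<integral>\<^sup>+f'. (\<integral>\<^sup>+v. G f' v \<partial>mvnormal 0 (Sig_v P l)) \<partial>mvnormal m (Sig_eta P))
    = (\<integral>\<^sup>+z. G (m + Lm *v fst z) (vh l *v snd z) \<partial>gauss)"
proof -
  have "(\<integral>\<^sup>+f'. (\<integral>\<^sup>+v. G f' v \<partial>mvnormal 0 (Sig_v P l)) \<partial>mvnormal m (Sig_eta P))
    = (\<integral>\<^sup>+z. (\<integral>\<^sup>+z'. G (m + Lm *v z) (vh l *v z') \<partial>gauss) \<partial>gauss)"
    unfolding mvnormal_Sig_v[OF l] mvnormal_eta
    by (simp add: nn_integral_distr)
  also have "\<dots> = (\<integral>\<^sup>+z. G (m + Lm *v fst z) (vh l *v snd z) \<partial>gauss)"
    by (subst nn_integral_gauss_prod) (auto simp flip: borel_prod)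
  finally show ?thesis .
qed

text \<open>The prediction error is uncorrelated with, hence independent of, the observation.\<close>

lemma nn_integral_signal:
  assumes l: "l \<in> nonneg" and [measurable]: "(\<lambda>(f', s). G f' s) \<in> borel_measurable (borel \<Otimes>\<^sub>M borel)"
  shows "(\<integral>\<^sup>+f'. (\<integral>\<^sup>+v. G f' (signal l f' v) \<partial>mvnormal 0 (Sig_v P l)) \<partial>mvnormal (prior_mean P f) (Sig_eta P))
    = (\<integral>\<^sup>+z. (\<integral>\<^sup>+z'. G (prior_mean P f + dev l z + err l z') (sig_of f l z) \<partial>gauss) \<partial>gauss)"
proof -
  let ?m = "prior_mean P f"
  \<comment> \<open>The integrand as a function of posterior error and centred observation. The next
    factor is the prior mean, plus the gain times the observation, plus the error.\<close>
  define H where "H = (\<lambda>(e, y). G (?m + gain P l *v y + e) (act l *v ?m + y))"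
  have H: "H \<in> borel_measurable borel"
    unfolding H_def borel_prod[symmetric] by measurable
  have "(\<integral>\<^sup>+f'. (\<integral>\<^sup>+v. G f' (signal l f' v) \<partial>mvnormal 0 (Sig_v P l)) \<partial>mvnormal ?m (Sig_eta P))
    = (\<integral>\<^sup>+z. G (?m + Lm *v fst z) (signal l (?m + Lm *v fst z) (vh l *v snd z)) \<partial>gauss)"
    by (rule nn_integral_prior[OF l]) measurable
  also have "\<dots> = (\<integral>\<^sup>+z. H (err l z, obs l z) \<partial>gauss)"
    by (simp add: H_def signal_eq gain_obs[OF l] err_def add.commute sig_of_def)
  also have "\<dots> = (\<integral>\<^sup>+z. (\<integral>\<^sup>+z'. H (err l z', obs l z) \<partial>gauss) \<partial>gauss)"
    by (rule gauss_uncorrelated_independent[OF linear_err linear_obs err_obs_orth[OF l] H])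
  also have "\<dots> = (\<integral>\<^sup>+z. (\<integral>\<^sup>+z'. G (?m + dev l z + err l z') (sig_of f l z) \<partial>gauss) \<partial>gauss)"
    by (simp add: H_def gain_obs[OF l] sig_of_def)
  finally show ?thesis .
qed

section \<open>Continuity in the attention\<close>

lemma continuous_on_Prec: "continuous_on X (Prec_v P)"
  unfolding Prec_v_def
proof (intro continuous_on_vec_lambda)
  show "continuous_on X (\<lambda>l. if i = j then (exp (l $ i * theta P $ i) - 1) / Sig_eta P $ i $ i else 0)" for i j
    unfolding divide_inverse by (cases "i = j") (auto intro!: continuous_intros)
qed

lemma continuous_on_wh: "continuous_on X wh"
  unfolding wh_def diagm_def
proof (intro continuous_on_vec_lambda)
  show "continuous_on X (\<lambda>l. if i = j then sqrt (prec l i) else 0)" for i j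
    unfolding prec_def divide_inverse by (cases "i = j") (auto intro!: continuous_intros)
qed

lemma continuous_on_dev: "continuous_on nonneg (\<lambda>l. dev l z)"
  unfolding dev_def core_def matrix_vector_mul_assoc[symmetric]
  by (intro continuous_on_matrix_vector_mult continuous_on_matrix_inv_mult continuous_on_const continuous_on_add
      continuous_on_matrix_matrix_mult continuous_on_Prec continuous_on_wh invertible_core)

lemma continuous_on_err: "continuous_on nonneg (\<lambda>l. err l z)"
  unfolding err_def by (intro continuous_intros continuous_on_dev)

end


section \<open>The one-stage problem\<close>

lemma integrable_gauss_quadratic: "integrable gauss (\<lambda>z::'h::euclidean_space. c * (1 + (norm z)\<^sup>2))"
  using integrable_gauss_norm_squared by auto

text \<open>The dominating constant may vary with the parameter: along a convergent sequence
  \<open>\<kappa>\<close> converges, so it is bounded there and one integrable function dominates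
  the whole sequence.\<close>

lemma
  fixes \<phi> :: "'p::metric_space \<Rightarrow> 'h::euclidean_space \<Rightarrow> 'b::{banach, second_countable_topology}"
  assumes cont: "\<And>z. continuous_on X (\<lambda>p. \<phi> p z)"
    and meas: "\<And>p. p \<in> X \<Longrightarrow> \<phi> p \<in> borel_measurable borel"
    and bound: "\<And>p z. p \<in> X \<Longrightarrow> norm (\<phi> p z) \<le> \<kappa> p * (1 + (norm z)\<^sup>2)"
    and \<kappa>: "continuous_on X \<kappa>"
  shows continuous_on_gauss_integral: "continuous_on X (\<lambda>p. \<integral>z. \<phi> p z \<partial>gauss)"
    and integrable_gauss_bounded: "p \<in> X \<Longrightarrow> integrable gauss (\<phi> p)"
proof -
  show "integrable gauss (\<phi> p)" if "p \<in> X"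
    using integrable_gauss_quadratic[of "\<kappa> p"] meas[OF that] bound[OF that]
    by (intro Bochner_Integration.integrable_bound[OF integrable_gauss_quadratic[of "\<kappa> p"]])
      (auto intro!: AE_I2 intro: order_trans[OF _ abs_ge_self])
  show "continuous_on X (\<lambda>p. \<integral>z. \<phi> p z \<partial>gauss)"
    unfolding continuous_on_sequentially o_def
  proof (intro allI ballI impI, elim conjE)
    fix x a assume a: "a \<in> X" and x: "\<forall>n. x n \<in> X" and lim: "x \<longlonglongrightarrow> a"
    have "(\<lambda>n. \<kappa> (x n)) \<longlonglongrightarrow> \<kappa> a"
      using \<kappa> a x lim unfolding continuous_on_sequentially o_def by blast
    then have "Bseq (\<lambda>n. \<kappa> (x n))" by (intro convergent_imp_Bseq) (auto simp: convergent_def)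
    then obtain K where K: "\<And>n. norm (\<kappa> (x n)) \<le> K" by (auto simp: Bseq_def)
    show "(\<lambda>n. \<integral>z. \<phi> (x n) z \<partial>gauss) \<longlonglongrightarrow> (\<integral>z. \<phi> a z \<partial>gauss)"
    proof (rule integral_dominated_convergence[OF _ _ integrable_gauss_quadratic[of K]])
      show "AE z in gauss. (\<lambda>n. \<phi> (x n) z) \<longlonglongrightarrow> \<phi> a z"
        using cont a x lim unfolding continuous_on_sequentially o_def by blast
      show "AE z in gauss. norm (\<phi> (x n) z) \<le> K * (1 + (norm z)\<^sup>2)" for n
      proof (rule AE_I2)
        fix z :: 'h
        have "\<kappa> (x n) \<le> K" using K[of n] by simp
        then have "\<kappa> (x n) * (1 + (norm z)\<^sup>2) \<le> K * (1 + (norm z)\<^sup>2)"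
          by (intro mult_right_mono) auto
        then show "norm (\<phi> (x n) z) \<le> K * (1 + (norm z)\<^sup>2)"
          using bound[of "x n" z] x by simp
      qed
    qed (use meas a x in auto)
  qed
qed

text \<open>A substitute for the operator norm that, as a finite sum of norms of values, is
  evidently continuous in any parameter on which \<open>T\<close> depends continuously.\<close>

definition basis_norm :: "('a::euclidean_space \<Rightarrow> 'b::real_normed_vector) \<Rightarrow> real" where
  "basis_norm T = (\<Sum>b\<in>Basis. norm (T b))"

lemma norm_le_basis_norm:
  assumes "linear T" shows "norm (T z) \<le> basis_norm T * norm z"
proof -
  have "T z = T (\<Sum>b\<in>Basis. (z \<bullet> b) *\<^sub>R b)" by (simp add: euclidean_representation)
  also have "\<dots> = (\<Sum>b\<in>Basis. (z \<bullet> b) *\<^sub>R T b)"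
    using assms by (simp add: linear_sum linear_scale)
  also have "norm \<dots> \<le> (\<Sum>b\<in>Basis. norm z * norm (T b))"
    by (rule sum_norm_le) (simp add: mult_right_mono Basis_le_norm)
  finally show ?thesis by (simp add: basis_norm_def sum_distrib_left mult.commute)
qed

lemma basis_norm_nonneg: "0 \<le> basis_norm T"
  by (simp add: basis_norm_def sum_nonneg)

lemma norm_outer: "norm (outer b) = (norm b)\<^sup>2"
proof -
  have "outer b $ i = b $ i *\<^sub>R b" for i by (simp add: outer_def vec_eq_iff)
  then have "norm (outer b) = L2_set (\<lambda>i. norm (b $ i) * norm b) UNIV"
    unfolding norm_vec_def[of "outer b"] by (simp only: norm_scaleR real_norm_def)
  also have "\<dots> = L2_set (\<lambda>i. norm (b $ i)) UNIV * norm b"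
    by (rule L2_set_left_distrib[symmetric]) simp
  also have "\<dots> = norm b * norm b"
    by (simp only: norm_vec_def[of b])
  finally show ?thesis by (simp add: power2_eq_square)
qed

lemma continuous_on_outer [continuous_intros]: "continuous_on X f \<Longrightarrow> continuous_on X (\<lambda>x. outer (f x))"
  unfolding outer_def by (intro continuous_intros continuous_on_vec_lambda)

lemma borel_measurable_outer [measurable (raw)]:
  "f \<in> borel_measurable M \<Longrightarrow> (\<lambda>x. outer (f x)) \<in> borel_measurable M"
  by (rule measurable_compose[OF _ borel_measurable_continuous_onI]) (auto intro: continuous_intros)

lemma inner_outer: "u \<bullet> (outer b *v u) = (b \<bullet> u)\<^sup>2"
  by (simp add: outer_mult_vec power2_eq_square inner_commute)

lemma norm_Pair_squared: "(norm (x, y))\<^sup>2 = (norm x)\<^sup>2 + (norm y)\<^sup>2"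
  by (simp add: norm_Pair)

text \<open>This is the form of the block matrix at the vector composed of \<open>u\<close> and
  \<open>x\<close>.\<close>

lemma bordered_quadratic_nonneg:
  fixes A :: "real^'n^'n"
  assumes "psd (bordered A p q)"
  shows "0 \<le> u \<bullet> (A *v u) + 2 * (u \<bullet> p) * x + q * x\<^sup>2"
proof -
  define v :: "real^('n option)" where "v = (\<chi> i. case i of Some j \<Rightarrow> u $ j | None \<Rightarrow> x)"
  have sum_opt: "(\<Sum>i\<in>(UNIV :: 'n option set). g i) = g None + (\<Sum>j\<in>UNIV. g (Some j))" for g :: "'n option \<Rightarrow> real"
    by (simp add: UNIV_option_conv sum.reindex)
  have v: "v $ None = x" "\<And>j. v $ Some j = u $ j" by (simp_all add: v_def)
  have BS: "(bordered A p q *v v) $ Some i = (A *v u) $ i + p $ i * x" for i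
    by (simp add: matrix_vector_mult_def sum_opt bordered_def v)
  have BN: "(bordered A p q *v v) $ None = p \<bullet> u + q * x"
    by (simp add: matrix_vector_mult_def sum_opt bordered_def v inner_vec_def)
  have "v \<bullet> (bordered A p q *v v) = x * (p \<bullet> u + q * x) + (\<Sum>i\<in>UNIV. u $ i * ((A *v u) $ i + p $ i * x))"
    unfolding inner_vec_def[of v] sum_opt BS BN v by (simp only: inner_real_def)
  also have "\<dots> = u \<bullet> (A *v u) + 2 * (u \<bullet> p) * x + q * x\<^sup>2"
    by (simp add: inner_vec_def sum.distrib sum_distrib_left sum_distrib_right algebra_simps power2_eq_square)
  finally show ?thesis using assms by (metis psd_def)
qed

lemma posdef_invertible: "posdef Q \<Longrightarrow> invertible Q" for Q :: "real^'i^'i"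
  by (subst invertible_left_inverse, subst matrix_left_invertible_ker)
    (metis inner_zero_right less_irrefl posdef_def)

lemma complete_square:
  fixes Q :: "real^'i^'i" and u y :: "real^'i"
  assumes Q: "posdef Q"
  defines "w \<equiv> matrix_inv Q *v y"
  shows "u \<bullet> (Q *v u) + 2 * x * (u \<bullet> y) = (u + x *\<^sub>R w) \<bullet> (Q *v (u + x *\<^sub>R w)) - x\<^sup>2 * (y \<bullet> w)"
proof -
  have Qw: "Q *v w = y"
    by (simp add: w_def matrix_vector_mul_assoc matrix_inv_right posdef_invertible[OF Q])
  have "w \<bullet> (Q *v u) = u \<bullet> (transpose Q *v w)"
    by (simp add: inner_commute[of _ "_ v* _"] dot_lmul_matrix)
  then have "w \<bullet> (Q *v u) = u \<bullet> y" using Q Qw by (simp only: posdef_def)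
  then show ?thesis
    by (simp add: matrix_vector_right_distrib matrix_vector_mult_scaleR Qw inner_add_left inner_add_right
        inner_commute[of w y] power2_eq_square algebra_simps)
qed

section \<open>The next period given the posterior mean\<close>

locale lq = 
  fixes P :: "('n::finite, 'k::finite) lq_data" and \<Lambda>0 :: real
  assumes valid: "valid_data P" and \<Lambda>0: "0 \<le> \<Lambda>0"
    and posdef_b: "\<And>t l. t < horizon P \<Longrightarrow> l \<in> allocations \<Lambda>0 \<Longrightarrow> posdef (Sig_b P l)"
begin

sublocale linear_filter P
  using valid by unfold_locales (auto simp: valid_data_def)

definition Le :: "real^'n^'n" where "Le = chol (Sig_eps P)"

text \<open>All randomness left after the signal is packed into one standard Gaussian
  \<open>y\<close>: \<open>fst y\<close> drives the posterior error and \<open>snd y\<close> the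
  noise in the coefficient vector. The argument \<open>\<mu>\<close> is the posterior mean.\<close>

definition nextf :: "real^'k \<Rightarrow> real^'k \<Rightarrow> ((real^'k) \<times> (real^'k)) \<times> (real^'n) \<Rightarrow> real^'k" where
  "nextf l \<mu> y = \<mu> + err l (fst y)"

definition nextb :: "real^'k \<Rightarrow> real^'k \<Rightarrow> ((real^'k) \<times> (real^'k)) \<times> (real^'n) \<Rightarrow> real^'n" where
  "nextb l \<mu> y = cvec P + Dmat P *v nextf l \<mu> y + Le *v snd y"

definition berr :: "real^'k \<Rightarrow> ((real^'k) \<times> (real^'k)) \<times> (real^'n) \<Rightarrow> real^'n" where
  "berr l y = Dmat P *v err l (fst y) + Le *v snd y"

lemma nextb_eq: "nextb l \<mu> y = cvec P + Dmat P *v \<mu> + berr l y"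
  by (simp add: nextb_def nextf_def berr_def matrix_vector_right_distrib)

lemma linear_berr: "linear (berr l)"
  unfolding berr_def using linear_err[of l]
  by (auto simp: linear_iff matrix_vector_right_distrib matrix_vector_mult_scaleR algebra_simps)

lemma continuous_on_nextf: "continuous_on UNIV (\<lambda>y. nextf l \<mu> y)"
proof -
  have "continuous_on UNIV (err l)"
    using linear_err by (simp add: linear_continuous_on linear_conv_bounded_linear)
  then have "continuous_on UNIV (\<lambda>y :: ((real^'k) \<times> (real^'k)) \<times> (real^'n). err l (fst y))"
    by (rule continuous_on_compose2) (auto intro!: continuous_on_fst continuous_on_id)
  then show ?thesis unfolding nextf_def by (intro continuous_on_add continuous_on_const)
qed

lemma measurable_next [measurable]:
  "nextf l \<mu> \<in> borel_measurable borel" "nextb l \<mu> \<in> borel_measurable borel"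
proof -
  show *: "nextf l \<mu> \<in> borel_measurable borel"
    using continuous_on_nextf[of l \<mu>] by (intro borel_measurable_continuous_onI) simp
  have "berr l \<in> borel_measurable borel" by (rule borel_measurable_linear[OF linear_berr])
  then show "nextb l \<mu> \<in> borel_measurable borel"
    by (simp add: nextb_eq[abs_def])
qed

text \<open>Identifies \<open>Sig_b\<close> as the covariance of \<open>berr\<close>: the two noises
  read separate components of \<open>y\<close>, so their covariances add.\<close>

lemma norm_adjoint_berr:
  assumes "l \<in> nonneg" shows "(norm (adjoint (berr l) u))\<^sup>2 = u \<bullet> (Sig_b P l *v u)"
proof -
  have lin: "linear (\<lambda>z. Dmat P *v err l z)" "linear ((*v) Le)"
    using linear_compose[OF linear_err[of l] matrix_vector_mul_linear[of "Dmat P"]] by (auto simp: o_def)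
  have "psd (Sig_eps P)" using valid by (simp add: valid_data_def)
  then have e: "(norm (adjoint ((*v) Le) u))\<^sup>2 = u \<bullet> (Sig_eps P *v u)"
    by (simp only: adjoint_matrix norm_transpose_squared Le_def chol)
  have "adjoint (\<lambda>z. Dmat P *v err l z) = (\<lambda>u. adjoint (err l) (transpose (Dmat P) *v u))"
    by (rule adjoint_unique)
      (simp add: adjoint_works[OF linear_err] inner_commute[of _ "_ v* _"] dot_lmul_matrix inner_commute[of "Dmat P *v _"])
  then have d: "(norm (adjoint (\<lambda>z. Dmat P *v err l z) u))\<^sup>2
      = (transpose (Dmat P) *v u) \<bullet> (post_cov P l *v (transpose (Dmat P) *v u))"
    by (simp only: norm_adjoint_err[OF assms])
  have "(norm (adjoint (berr l) u))\<^sup>2 = u \<bullet> (Sig_eps P *v u)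
      + (transpose (Dmat P) *v u) \<bullet> (post_cov P l *v (transpose (Dmat P) *v u))"
    unfolding berr_def[abs_def] adjoint_fst_snd[OF lin] by (simp only: norm_Pair_squared d e add.commute)
  also have "\<dots> = u \<bullet> (Sig_b P l *v u)"
    by (simp add: Sig_b_def matrix_vector_mult_add_rdistrib inner_add_right dot_lmul_matrix
      flip: matrix_vector_mul_assoc)
  finally show ?thesis .
qed

lemma exp_post_eq:
  fixes g :: "real^'k \<Rightarrow> real^'n \<Rightarrow> 'b::{banach, second_countable_topology}"
  assumes l: "l \<in> nonneg" and g [measurable]: "(\<lambda>(f', b). g f' b) \<in> borel_measurable (borel \<Otimes>\<^sub>M borel)"
    and int: "integrable gauss (\<lambda>y. g (nextf l (post_mean P f l s) y) (nextb l (post_mean P f l s) y))"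
  shows "exp_post P f l s g = (\<integral>y. g (nextf l (post_mean P f l s) y) (nextb l (post_mean P f l s) y) \<partial>gauss)"
proof -
  let ?\<mu> = "post_mean P f l s"
  have "exp_post P f l s g = (\<integral>z. (\<integral>w. g (?\<mu> + err l z) (cvec P + Dmat P *v (?\<mu> + err l z) + Le *v w) \<partial>gauss) \<partial>gauss)"
    unfolding exp_post_def mvnormal_post_cov[OF l] mvnormal_gauss[of _ "Sig_eps P"] Le_def
    by (simp add: integral_distr)
  also have "\<dots> = (\<integral>z. (\<integral>w. g (nextf l ?\<mu> (z, w)) (nextb l ?\<mu> (z, w)) \<partial>gauss) \<partial>gauss)"
    by (simp add: nextf_def nextb_def)
  also have "\<dots> = (\<integral>y. g (nextf l ?\<mu> y) (nextb l ?\<mu> y) \<partial>gauss)"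
    by (rule integral_gauss_prod[OF int, symmetric])
  finally show ?thesis .
qed

text \<open>The invariant of the backward induction. The upper bound provides domination, and strict
  positivity keeps the quadratic coefficient invertible even where \<open>Amat\<close> is
  zero.\<close>

definition nice :: "(real \<Rightarrow> real^'k \<Rightarrow> real) \<Rightarrow> bool" where
  "nice h \<longleftrightarrow> continuous_on ({0..\<Lambda>0} \<times> UNIV) (\<lambda>(\<Lambda>, f). h \<Lambda> f) \<and>
     (\<exists>C. \<forall>\<Lambda>\<in>{0..\<Lambda>0}. \<forall>f. 0 < h \<Lambda> f \<and> h \<Lambda> f \<le> C)"

text \<open>Budget, attention and posterior mean. The observed signal influences conditional moments
  only through the last component, which ranges over the whole space.\<close>

definition params :: "(real \<times> (real^'k) \<times> (real^'k)) set" where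
  "params = {(\<Lambda>, l, \<mu>). \<Lambda> \<in> {0..\<Lambda>0} \<and> l \<in> allocations \<Lambda>}"

definition cost :: "nat \<Rightarrow> real \<Rightarrow> real^'n \<Rightarrow> real" where
  "cost t x u = u \<bullet> (Amat P t *v u) + 2 * (u \<bullet> pvec P t) * x + qcoef P t * x\<^sup>2"

lemma cost_nonneg: "t < horizon P \<Longrightarrow> 0 \<le> cost t x u"
  unfolding cost_def by (rule bordered_quadratic_nonneg) (use valid in \<open>auto simp: valid_data_def\<close>)

definition rem :: "real \<Rightarrow> real^'k \<Rightarrow> real" where
  "rem \<Lambda> l = \<Lambda> - (\<Sum>j\<in>UNIV. l $ j)"

lemma allocations_nonneg: "l \<in> allocations \<Lambda> \<Longrightarrow> l \<in> nonneg"
  by (simp add: allocations_def nonneg_def)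

lemma rem_range: "\<Lambda> \<in> {0..\<Lambda>0} \<Longrightarrow> l \<in> allocations \<Lambda> \<Longrightarrow> rem \<Lambda> l \<in> {0..\<Lambda>0}"
  using sum_nonneg[of UNIV "\<lambda>j. l $ j"] by (auto simp: allocations_def rem_def)

end

section \<open>Conditional moments and the cost of one stage\<close>

locale lq_stage = lq P \<Lambda>0
  for P :: "('n::finite, 'k::finite) lq_data" and \<Lambda>0 :: real +
  fixes h :: "real \<Rightarrow> real^'k \<Rightarrow> real" and t :: nat
  assumes t: "t < horizon P" and nice: "nice h"
begin

definition "bound = (SOME C. \<forall>\<Lambda>\<in>{0..\<Lambda>0}. \<forall>f. 0 < h \<Lambda> f \<and> h \<Lambda> f \<le> C)"

lemma h_pos: "\<Lambda> \<in> {0..\<Lambda>0} \<Longrightarrow> 0 < h \<Lambda> f" and h_le: "\<Lambda> \<in> {0..\<Lambda>0} \<Longrightarrow> h \<Lambda> f \<le> bound"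
proof -
  have "\<forall>\<Lambda>\<in>{0..\<Lambda>0}. \<forall>f. 0 < h \<Lambda> f \<and> h \<Lambda> f \<le> bound"
    unfolding bound_def by (rule someI_ex) (use nice in \<open>simp add: nice_def\<close>)
  then show "\<Lambda> \<in> {0..\<Lambda>0} \<Longrightarrow> 0 < h \<Lambda> f" "\<Lambda> \<in> {0..\<Lambda>0} \<Longrightarrow> h \<Lambda> f \<le> bound" by auto
qed

lemma bound_nonneg: "0 \<le> bound"
  using h_pos[of 0 undefined] h_le[of 0 undefined] \<Lambda>0 by simp

lemma continuous_on_h:
  assumes "continuous_on X a" "continuous_on X f" "\<And>x. x \<in> X \<Longrightarrow> a x \<in> {0..\<Lambda>0}"
  shows "continuous_on X (\<lambda>x. h (a x) (f x))"
proof -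
  have "continuous_on X (\<lambda>x. (\<lambda>(\<Lambda>, f). h \<Lambda> f) (a x, f x))"
    by (rule continuous_on_compose2[of "{0..\<Lambda>0} \<times> UNIV"])
      (use nice assms in \<open>auto simp: nice_def intro!: continuous_intros\<close>)
  then show ?thesis by simp
qed

lemma h_measurable: "\<Lambda> \<in> {0..\<Lambda>0} \<Longrightarrow> h \<Lambda> \<in> borel_measurable borel"
  by (intro borel_measurable_continuous_onI continuous_on_h) auto

definition hn :: "real \<times> (real^'k) \<times> (real^'k) \<Rightarrow> ((real^'k) \<times> (real^'k)) \<times> (real^'n) \<Rightarrow> real" where
  "hn = (\<lambda>(\<Lambda>, l, \<mu>) y. h (rem \<Lambda> l) (nextf l \<mu> y))"

definition bn :: "real \<times> (real^'k) \<times> (real^'k) \<Rightarrow> ((real^'k) \<times> (real^'k)) \<times> (real^'n) \<Rightarrow> real^'n" where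
  "bn = (\<lambda>(\<Lambda>, l, \<mu>) y. nextb l \<mu> y)"

lemma params_nonneg: "p \<in> params \<Longrightarrow> fst (snd p) \<in> nonneg"
  and params_rem: "p \<in> params \<Longrightarrow> rem (fst p) (fst (snd p)) \<in> {0..\<Lambda>0}"
  unfolding params_def case_prod_beta using allocations_nonneg rem_range by blast+

lemma continuous_on_err_params: "continuous_on params (\<lambda>p. err (fst (snd p)) z)"
  by (rule continuous_on_compose2[OF continuous_on_err]) (auto intro!: continuous_intros params_nonneg)

lemma continuous_on_hn: "continuous_on params (\<lambda>p. hn p y)"
  unfolding hn_def case_prod_beta
proof (rule continuous_on_h[OF _ _ params_rem])
  show "continuous_on params (\<lambda>p. rem (fst p) (fst (snd p)))"
    unfolding rem_def by (intro continuous_intros)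
  show "continuous_on params (\<lambda>p. nextf (fst (snd p)) (snd (snd p)) y)"
    unfolding nextf_def by (intro continuous_intros continuous_on_err_params)
qed

lemma continuous_on_bn: "continuous_on params (\<lambda>p. bn p y)"
  unfolding bn_def case_prod_beta nextb_def nextf_def by (intro continuous_intros continuous_on_err_params)

lemma hn_pos: "p \<in> params \<Longrightarrow> 0 < hn p y" and hn_le: "p \<in> params \<Longrightarrow> hn p y \<le> bound"
  by (auto simp: hn_def params_def intro!: h_pos h_le rem_range simp del: atLeastAtMost_iff)

lemma hn_measurable [measurable]: "p \<in> params \<Longrightarrow> hn p \<in> borel_measurable borel"
  by (auto simp: hn_def params_def simp del: atLeastAtMost_iff
     intro!: measurable_compose[OF measurable_next(1) h_measurable] rem_range)

lemma bn_measurable [measurable]: "bn p \<in> borel_measurable borel"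
  unfolding bn_def case_prod_beta by measurable

definition growth :: "real \<times> (real^'k) \<times> (real^'k) \<Rightarrow> real" where
  "growth = (\<lambda>(\<Lambda>, l, \<mu>). norm (cvec P + Dmat P *v \<mu>) + basis_norm (berr l))"

lemma norm_bn: "norm (bn p y) \<le> growth p * (1 + norm y)"
proof -
  obtain \<Lambda> l \<mu> where p: "p = (\<Lambda>, l, \<mu>)" by (cases p)
  have "norm (bn p y) \<le> norm (cvec P + Dmat P *v \<mu>) + basis_norm (berr l) * norm y"
    unfolding p bn_def using norm_triangle_ineq[of "cvec P + Dmat P *v \<mu>" "berr l y"]
      norm_le_basis_norm[OF linear_berr, of l y] by (simp add: nextb_eq)
  also have "\<dots> \<le> growth p * (1 + norm y)"
    using basis_norm_nonneg[of "berr l"] by (simp add: p growth_def algebra_simps)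
  finally show ?thesis .
qed

lemma continuous_on_growth: "continuous_on params growth"
  unfolding growth_def case_prod_beta basis_norm_def berr_def
  by (intro continuous_intros continuous_on_err_params)

lemma one_plus_norm_squared_le: "(1 + norm y)\<^sup>2 \<le> 2 * (1 + (norm y)\<^sup>2)"
  using zero_le_power2[of "norm y - 1"] by (simp add: power2_eq_square algebra_simps)

text \<open>Treats the three conditional moments at once, with \<open>\<psi> b\<close> equal to 1,
  \<open>b\<close> and \<open>outer b\<close>.\<close>

lemma
  fixes \<psi> :: "real^'n \<Rightarrow> 'b::{banach, second_countable_topology}"
  assumes \<psi>: "continuous_on UNIV \<psi>" and le: "\<And>b. norm (\<psi> b) \<le> (1 + norm b)\<^sup>2"
  shows continuous_on_moment: "continuous_on params (\<lambda>p. \<integral>y. hn p y *\<^sub>R \<psi> (bn p y) \<partial>gauss)"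
    and integrable_moment: "p \<in> params \<Longrightarrow> integrable gauss (\<lambda>y. hn p y *\<^sub>R \<psi> (bn p y))"
proof -
  \<comment> \<open>The value contributes \<open>bound\<close>, the linear growth of
    \<open>bn\<close> contributes \<open>1 + growth p\<close> squared, and the 2 comes from
    \<open>one_plus_norm_squared_le\<close>.\<close>
  let ?\<kappa> = "\<lambda>p. bound * ((1 + growth p)\<^sup>2 * 2)"
  have b: "norm (hn p y *\<^sub>R \<psi> (bn p y)) \<le> ?\<kappa> p * (1 + (norm y)\<^sup>2)" if "p \<in> params" for p y
  proof -
    have "1 + norm (bn p y) \<le> (1 + growth p) * (1 + norm y)"
      using norm_bn[of p y] by (auto simp: algebra_simps intro: add_increasing)
    then have "norm (\<psi> (bn p y)) \<le> ((1 + growth p) * (1 + norm y))\<^sup>2"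
      using le[of "bn p y"] power_mono[of "1 + norm (bn p y)" _ 2] by (fastforce intro: order_trans)
    also have "\<dots> \<le> (1 + growth p)\<^sup>2 * (2 * (1 + (norm y)\<^sup>2))"
      unfolding power_mult_distrib by (intro mult_left_mono one_plus_norm_squared_le zero_le_power2)
    finally have "hn p y * norm (\<psi> (bn p y)) \<le> bound * ((1 + growth p)\<^sup>2 * (2 * (1 + (norm y)\<^sup>2)))"
      using hn_le[OF that, of y] bound_nonneg by (intro mult_mono) auto
    then show ?thesis
      unfolding norm_scaleR abs_of_pos[OF hn_pos[OF that]] by (simp only: mult_ac)
  qed
  have c: "continuous_on params (\<lambda>p. hn p y *\<^sub>R \<psi> (bn p y))" for y
    by (intro continuous_intros continuous_on_hn continuous_on_compose2[OF \<psi> continuous_on_bn]) auto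
  have k: "continuous_on params ?\<kappa>"
    by (intro continuous_intros continuous_on_growth)
  have [measurable]: "\<psi> \<in> borel_measurable borel" using \<psi> by (rule borel_measurable_continuous_onI)
  have m: "p \<in> params \<Longrightarrow> (\<lambda>y. hn p y *\<^sub>R \<psi> (bn p y)) \<in> borel_measurable borel" for p
    by measurable
  show "continuous_on params (\<lambda>p. \<integral>y. hn p y *\<^sub>R \<psi> (bn p y) \<partial>gauss)"
    by (rule continuous_on_gauss_integral[OF c m b k])
  show "p \<in> params \<Longrightarrow> integrable gauss (\<lambda>y. hn p y *\<^sub>R \<psi> (bn p y))"
    by (rule integrable_gauss_bounded[OF c m b k])
qed

definition "Eh p = (\<integral>y. hn p y \<partial>gauss)"
definition "Eb p = (\<integral>y. hn p y *\<^sub>R bn p y \<partial>gauss)"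
definition "Ebb p = (\<integral>y. hn p y *\<^sub>R outer (bn p y) \<partial>gauss)"

lemma moment_bounds:
  "norm (1::real) \<le> (1 + norm b)\<^sup>2" "norm b \<le> (1 + norm b)\<^sup>2" "norm (outer b) \<le> (1 + norm b)\<^sup>2"
  by (auto simp: norm_outer power2_eq_square algebra_simps)

lemma continuous_on_Eh: "continuous_on params Eh"
  and continuous_on_Eb: "continuous_on params Eb"
  and continuous_on_Ebb: "continuous_on params Ebb"
  using continuous_on_moment[OF _ moment_bounds(1)] continuous_on_moment[OF _ moment_bounds(2)]
    continuous_on_moment[OF _ moment_bounds(3)]
  by (simp_all add: Eh_def[abs_def] Eb_def[abs_def] Ebb_def[abs_def] continuous_intros)

lemma integrable_h: "p \<in> params \<Longrightarrow> integrable gauss (hn p)"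
  and integrable_hb: "p \<in> params \<Longrightarrow> integrable gauss (\<lambda>y. hn p y *\<^sub>R bn p y)"
  and integrable_hbb: "p \<in> params \<Longrightarrow> integrable gauss (\<lambda>y. hn p y *\<^sub>R outer (bn p y))"
  using integrable_moment[OF _ moment_bounds(1), of p] integrable_moment[OF _ moment_bounds(2), of p]
    integrable_moment[OF _ moment_bounds(3), of p] by (simp_all add: continuous_intros)

abbreviation "ac \<equiv> acoef P (Suc t)"

definition "lin p = pvec P t + ac *\<^sub>R Eb p"
definition "quad p = Amat P t + Ebb p"
text \<open>The minimizing control at state \<open>x\<close> will be minus \<open>x\<close> times
  \<open>ctrl p\<close>, and the minimal conditional cost will be \<open>psi p\<close> times the
  square of \<open>x\<close>.\<close>

definition "ctrl p = matrix_inv (quad p) *v lin p"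
definition "psi p = Eh p * ac\<^sup>2 + qcoef P t - lin p \<bullet> ctrl p"

abbreviation "stage_cost \<equiv> cost t"

lemma stage_cost_nonneg: "0 \<le> stage_cost x u"
  by (rule cost_nonneg[OF t])

lemma ac_pos: "0 < ac"
  using valid t by (auto simp: valid_data_def)

lemma expected_square:
  assumes p: "p \<in> params"
  shows "integrable gauss (\<lambda>y. hn p y * (ac * x + bn p y \<bullet> u)\<^sup>2)" (is ?I)
    and "stage_cost x u + (\<integral>y. hn p y * (ac * x + bn p y \<bullet> u)\<^sup>2 \<partial>gauss)
      = u \<bullet> (quad p *v u) + 2 * x * (u \<bullet> lin p) + x\<^sup>2 * (Eh p * ac\<^sup>2 + qcoef P t)" (is ?E)
proof -
  have bl: "bounded_linear (\<lambda>M::real^'n^'n. u \<bullet> (M *v u))"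
    unfolding linear_conv_bounded_linear[symmetric]
    by (auto simp: linear_iff matrix_vector_mult_add_rdistrib inner_add_right simp flip: scaleR_matrix_vector_assoc)
  have eq: "hn p y * (ac * x + bn p y \<bullet> u)\<^sup>2
      = (ac\<^sup>2 * x\<^sup>2) * hn p y + (2 * ac * x) * ((hn p y *\<^sub>R bn p y) \<bullet> u) + u \<bullet> ((hn p y *\<^sub>R outer (bn p y)) *v u)" for y
    by (simp add: inner_outer power2_eq_square algebra_simps flip: scaleR_matrix_vector_assoc)
  have i1: "integrable gauss (\<lambda>y. (hn p y *\<^sub>R bn p y) \<bullet> u)"
    using integrable_hb[OF p] by (intro integrable_inner_left) auto
  have i2: "integrable gauss (\<lambda>y. u \<bullet> ((hn p y *\<^sub>R outer (bn p y)) *v u))"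
    by (rule integrable_bounded_linear[OF bl integrable_hbb[OF p]])
  show ?I unfolding eq using i1 i2 integrable_h[OF p] by auto
  have "(\<integral>y. hn p y * (ac * x + bn p y \<bullet> u)\<^sup>2 \<partial>gauss)
      = (ac\<^sup>2 * x\<^sup>2) * Eh p + (2 * ac * x) * (\<integral>y. (hn p y *\<^sub>R bn p y) \<bullet> u \<partial>gauss)
        + (\<integral>y. u \<bullet> ((hn p y *\<^sub>R outer (bn p y)) *v u) \<partial>gauss)"
    unfolding eq Eh_def using i1 i2 integrable_h[OF p] by simp
  also have "(\<integral>y. (hn p y *\<^sub>R bn p y) \<bullet> u \<partial>gauss) = Eb p \<bullet> u"
    unfolding Eb_def using integrable_hb[OF p] by (intro integral_inner_left) auto
  also have "(\<integral>y. u \<bullet> ((hn p y *\<^sub>R outer (bn p y)) *v u) \<partial>gauss) = u \<bullet> (Ebb p *v u)"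
    unfolding Ebb_def by (rule integral_bounded_linear[OF bl integrable_hbb[OF p]])
  finally show ?E
    by (simp add: cost_def quad_def lin_def matrix_vector_mult_add_rdistrib inner_add_right
        inner_commute[of "Eb p" u] algebra_simps)
qed

text \<open>For \<open>u \<noteq> 0\<close>, the next state is a Gaussian whose variance is the form
  of \<open>Sig_b\<close> at \<open>u\<close>, hence positive, so it is almost surely nonzero. For
  \<open>u = 0\<close> it is a nonzero constant. The weight \<open>hn p\<close> is positive
  throughout.\<close>

lemma expected_square_pos:
  assumes p: "p \<in> params" and nz: "x \<noteq> 0 \<or> u \<noteq> 0"
  shows "0 < (\<integral>y. hn p y * (ac * x + bn p y \<bullet> u)\<^sup>2 \<partial>gauss)"
proof -
  obtain \<Lambda> l \<mu> where pe: "p = (\<Lambda>, l, \<mu>)" by (cases p)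
  \<comment> \<open>A budget below \<open>\<Lambda>0\<close> permits no allocation that
    \<open>\<Lambda>0\<close> forbids, so positive definiteness is available for
    \<open>l\<close>.\<close>
  then have l: "l \<in> nonneg" and l0: "l \<in> allocations \<Lambda>0"
    using p by (auto simp: params_def nonneg_def allocations_def)
  have ne: "AE y in gauss. ac * x + bn p y \<bullet> u \<noteq> 0"
  proof (cases "u = 0")
    case True
    then show ?thesis using nz ac_pos by simp
  next
    case False
    have "0 < (norm (adjoint (berr l) u))\<^sup>2"
      unfolding norm_adjoint_berr[OF l] using posdef_b[OF t l0] False by (simp add: posdef_def)
    then have w: "adjoint (berr l) u \<noteq> 0" by auto
    have "ac * x + bn p y \<bullet> u = (ac * x + (cvec P + Dmat P *v \<mu>) \<bullet> u) + adjoint (berr l) u \<bullet> y" for y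
      by (simp add: pe bn_def nextb_eq inner_add_left adjoint_clauses[OF linear_berr] inner_commute[of "berr l _"])
    then show ?thesis using AE_gauss_hyperplane[OF w, of "ac * x + (cvec P + Dmat P *v \<mu>) \<bullet> u"]
      by (simp only:)
  qed
  have nn: "0 \<le> hn p y * (ac * x + bn p y \<bullet> u)\<^sup>2" for y
    using hn_pos[OF p, of y] by simp
  have "(\<integral>y. hn p y * (ac * x + bn p y \<bullet> u)\<^sup>2 \<partial>gauss) \<noteq> 0"
  proof
    assume "(\<integral>y. hn p y * (ac * x + bn p y \<bullet> u)\<^sup>2 \<partial>gauss) = 0"
    then have "AE y in gauss. hn p y * (ac * x + bn p y \<bullet> u)\<^sup>2 = 0"
      using nn by (subst (asm) integral_nonneg_eq_0_iff_AE[OF expected_square(1)[OF p]]) auto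
    with ne have "AE y :: ((real^'k) \<times> (real^'k)) \<times> (real^'n) in gauss. False"
    proof eventually_elim
      case (elim y)
      then show False using hn_pos[OF p, of y] by simp
    qed
    then show False by simp
  qed
  moreover have "0 \<le> (\<integral>y. hn p y * (ac * x + bn p y \<bullet> u)\<^sup>2 \<partial>gauss)"
    using nn by simp
  ultimately show ?thesis by linarith
qed

text \<open>The form of \<open>quad p\<close> is the conditional cost at state 0, and its expected
  square is strictly positive unless the control vanishes.\<close>

lemma posdef_quad:
  assumes p: "p \<in> params" shows "posdef (quad p)"
  unfolding posdef_def
proof (intro conjI allI impI)
  have bl: "bounded_linear (transpose :: real^'n^'n \<Rightarrow> real^'n^'n)"
    unfolding linear_conv_bounded_linear[symmetric] by (auto simp: linear_iff transpose_def vec_eq_iff)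
  have "transpose (Ebb p) = Ebb p"
    unfolding Ebb_def integral_bounded_linear[OF bl integrable_hbb[OF p], symmetric]
    by (intro Bochner_Integration.integral_cong) (auto simp: transpose_def outer_def vec_eq_iff mult.commute)
  then show "transpose (quad p) = quad p"
    using valid t by (simp add: quad_def transpose_add valid_data_def psd_def)
  fix u :: "real^'n" assume "u \<noteq> 0"
  then have "0 < stage_cost 0 u + (\<integral>y. hn p y * (ac * 0 + bn p y \<bullet> u)\<^sup>2 \<partial>gauss)"
    by (intro add_nonneg_pos stage_cost_nonneg expected_square_pos p) auto
  then show "0 < u \<bullet> (quad p *v u)"
    unfolding expected_square(2)[OF p] by simp
qed

lemma expected_cost:
  assumes p: "p \<in> params"
  shows "stage_cost x u + (\<integral>y. hn p y * (ac * x + bn p y \<bullet> u)\<^sup>2 \<partial>gauss)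
    = x\<^sup>2 * psi p + (u + x *\<^sub>R ctrl p) \<bullet> (quad p *v (u + x *\<^sub>R ctrl p))"
  unfolding expected_square(2)[OF p] psi_def ctrl_def
  using complete_square[OF posdef_quad[OF p], of u x "lin p"] by (simp add: algebra_simps)

lemma expected_cost_ge:
  assumes p: "p \<in> params"
  shows "x\<^sup>2 * psi p \<le> stage_cost x u + (\<integral>y. hn p y * (ac * x + bn p y \<bullet> u)\<^sup>2 \<partial>gauss)"
proof -
  have "0 \<le> w \<bullet> (quad p *v w)" for w
    using posdef_quad[OF p] by (cases "w = 0") (auto simp: posdef_def less_imp_le)
  then show ?thesis unfolding expected_cost[OF p] by simp
qed

lemma expected_cost_ctrl:
  assumes p: "p \<in> params"
  shows "stage_cost x (- (x *\<^sub>R ctrl p)) + (\<integral>y. hn p y * (ac * x + bn p y \<bullet> (- (x *\<^sub>R ctrl p)))\<^sup>2 \<partial>gauss)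
    = x\<^sup>2 * psi p"
  unfolding expected_cost[OF p] by simp

text \<open>At state 1, \<open>psi p\<close> is attained as a nonnegative stage cost plus an
  expected square that is positive because the state is nonzero.\<close>

lemma psi_pos: "p \<in> params \<Longrightarrow> 0 < psi p"
  using expected_cost_ctrl[of p 1] expected_square_pos[of p 1 "- ctrl p"] stage_cost_nonneg[of 1 "- ctrl p"]
  by simp

text \<open>Comparison with the zero control at state 1.\<close>

lemma psi_le: "p \<in> params \<Longrightarrow> psi p \<le> bound * ac\<^sup>2 + qcoef P t"
proof -
  assume p: "p \<in> params"
  have "Eh p \<le> (\<integral>y. bound \<partial>(gauss :: (((real^'k) \<times> (real^'k)) \<times> (real^'n)) measure))"
    unfolding Eh_def by (intro integral_mono integrable_h p hn_le) auto
  then have "Eh p \<le> bound" by (simp add: gauss.prob_space[simplified])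
  then have "Eh p * ac\<^sup>2 \<le> bound * ac\<^sup>2" by (simp add: mult_right_mono)
  then show ?thesis
    using expected_cost_ge[OF p, of 1 0] expected_square(2)[OF p, of 1 0] by simp
qed

lemma continuous_on_ctrl: "continuous_on params ctrl" and continuous_on_psi: "continuous_on params psi"
proof -
  have l: "continuous_on params lin"
    unfolding lin_def[abs_def] by (intro continuous_intros continuous_on_Eb)
  show c: "continuous_on params ctrl"
    unfolding ctrl_def[abs_def]
  proof (rule continuous_on_matrix_inv_mult[OF _ l])
    show "continuous_on params quad"
      unfolding quad_def[abs_def] by (intro continuous_intros continuous_on_Ebb)
  qed (rule posdef_invertible[OF posdef_quad])
  show "continuous_on params psi"
    unfolding psi_def[abs_def] by (intro continuous_intros continuous_on_Eh l c)
qed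

end


section \<open>Continuity of the value and measurable selection\<close>

lemma closed_allocations: "closed (allocations r)"
  unfolding allocations_def Collect_conj_eq
  by (intro closed_Int closed_Collect_all closed_Collect_le continuous_intros)

lemma compact_allocations: "compact (allocations r)"
  unfolding compact_eq_bounded_closed
proof (intro conjI closed_allocations)
  have "norm l \<le> r" if "l \<in> allocations r" for l
  proof -
    have "norm l \<le> (\<Sum>j\<in>UNIV. \<bar>l $ j\<bar>)" by (rule norm_le_l1_cart)
    also have "\<dots> \<le> r" using that by (simp add: allocations_def)
    finally show ?thesis .
  qed
  then show "bounded (allocations r)" by (auto simp: bounded_iff)
qed

lemma zero_in_allocations: "0 \<le> r \<Longrightarrow> 0 \<in> allocations r"
  by (simp add: allocations_def)

lemma scale_in_allocations: "0 \<le> r \<Longrightarrow> w \<in> allocations 1 \<Longrightarrow> r *\<^sub>R w \<in> allocations r"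
  by (auto simp: allocations_def mult_left_le simp flip: sum_distrib_left)

text \<open>Turns the constraint set that moves with the budget into the fixed compact set
  \<open>allocations 1\<close>. For \<open>r = 0\<close> both sides contain only the zero
  vector.\<close>

lemma allocations_scale:
  assumes r: "0 \<le> r" shows "allocations r = (*\<^sub>R) r ` allocations 1"
proof (intro equalityI subsetI)
  fix l :: "real^'k" assume l: "l \<in> allocations r"
  show "l \<in> (*\<^sub>R) r ` allocations 1"
  proof (cases "r = 0")
    case True
    have "l $ j = 0" for j
    proof -
      have "l $ j \<le> (\<Sum>j\<in>UNIV. l $ j)"
        using l by (intro member_le_sum) (simp_all add: allocations_def)
      moreover have "0 \<le> l $ j" "(\<Sum>j\<in>UNIV. l $ j) \<le> 0" using l True by (simp_all add: allocations_def)
      ultimately show ?thesis by linarith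
    qed
    then have "l = r *\<^sub>R 0" by (simp add: vec_eq_iff)
    then show ?thesis by (rule image_eqI) (simp add: zero_in_allocations)
  next
    case False
    have "(\<Sum>j\<in>UNIV. l $ j / r) \<le> 1"
      unfolding sum_divide_distrib[symmetric] using l r False by (simp add: allocations_def)
    then have "(1 / r) *\<^sub>R l \<in> allocations 1"
      using l r by (simp add: allocations_def)
    moreover have "l = r *\<^sub>R ((1 / r) *\<^sub>R l)" using False by simp
    ultimately show ?thesis by blast
  qed
qed (use scale_in_allocations[OF r] in auto)

lemma
  fixes F :: "'a::topological_space \<Rightarrow> 'b::topological_space \<Rightarrow> 'c::topological_space"
  assumes F: "continuous_on (Y \<times> W) (\<lambda>(y, w). F y w)"
  shows continuous_on_slice1: "y \<in> Y \<Longrightarrow> continuous_on W (F y)"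
    and continuous_on_slice2: "w \<in> W \<Longrightarrow> continuous_on Y (\<lambda>y. F y w)"
proof -
  assume y: "y \<in> Y"
  have "continuous_on W (\<lambda>w. (\<lambda>(y, w). F y w) (y, w))"
  proof (rule continuous_on_compose2[OF F])
    show "continuous_on W (\<lambda>w. (y, w))" by (intro continuous_on_Pair continuous_on_const continuous_on_id)
  qed (use y in auto)
  then show "continuous_on W (F y)" by simp
next
  assume w: "w \<in> W"
  have "continuous_on Y (\<lambda>y. (\<lambda>(y, w). F y w) (y, w))"
  proof (rule continuous_on_compose2[OF F])
    show "continuous_on Y (\<lambda>y. (y, w))" by (intro continuous_on_Pair continuous_on_const continuous_on_id)
  qed (use w in auto)
  then show "continuous_on Y (\<lambda>y. F y w)" by simp
qed

lemma cINF_attained: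
  fixes F :: "'b::topological_space \<Rightarrow> real"
  assumes "compact W" "W \<noteq> {}" "continuous_on W F"
  obtains w where "w \<in> W" "F w = (INF v\<in>W. F v)" "\<And>v. v \<in> W \<Longrightarrow> F w \<le> F v"
proof -
  obtain w where w: "w \<in> W" "\<And>v. v \<in> W \<Longrightarrow> F w \<le> F v"
    using continuous_attains_inf[OF assms] by auto
  have "(INF v\<in>W. F v) = F w" by (rule cInf_eq_minimum) (use w in auto)
  then show thesis using that w by auto
qed

text \<open>Compactness of \<open>W\<close> makes continuity in \<open>y\<close> uniform over
  \<open>w\<close>. The minimizer at either of two nearby points then competes at the other
  one.\<close>

lemma continuous_on_cINF:
  fixes F :: "'a::metric_space \<Rightarrow> 'b::topological_space \<Rightarrow> real"
  assumes W: "compact W" "W \<noteq> {}" and F: "continuous_on (Y \<times> W) (\<lambda>(y, w). F y w)"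
  shows "continuous_on Y (\<lambda>y. INF w\<in>W. F y w)"
  unfolding continuous_on_def
proof (intro ballI tendstoI)
  fix y0 and e :: real assume y0: "y0 \<in> Y" and e: "0 < e"
  have cont: "continuous_on W (F y)" if "y \<in> Y" for y
    by (rule continuous_on_slice1[OF F that])
  obtain X where X: "y0 \<in> X" "open X"
    and close: "\<forall>y\<in>X \<inter> Y. \<forall>w\<in>W. dist ((\<lambda>(y, w). F y w) (y, w)) ((\<lambda>(y, w). F y w) (y0, w)) \<le> e / 2"
    using continuous_on_prod_compactE[OF F W(1) y0, of "e / 2"] e by auto
  show "\<forall>\<^sub>F y in at y0 within Y. dist (INF w\<in>W. F y w) (INF w\<in>W. F y0 w) < e"
    unfolding eventually_at_topological
  proof (intro exI[of _ X] conjI ballI impI X)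
    fix y assume y: "y \<in> X" "y \<in> Y"
    obtain w where w: "w \<in> W" "F y w = (INF w\<in>W. F y w)" "\<And>v. v \<in> W \<Longrightarrow> F y w \<le> F y v"
      using cINF_attained[OF W cont[OF y(2)]] by metis
    obtain w0 where w0: "w0 \<in> W" "F y0 w0 = (INF w\<in>W. F y0 w)" "\<And>v. v \<in> W \<Longrightarrow> F y0 w0 \<le> F y0 v"
      using cINF_attained[OF W cont[OF y0]] by metis
    have "\<bar>F y w - F y0 w\<bar> \<le> e / 2" "\<bar>F y w0 - F y0 w0\<bar> \<le> e / 2"
      using close y w(1) w0(1) by (auto simp: dist_real_def)
    then show "dist (INF w\<in>W. F y w) (INF w\<in>W. F y0 w) < e"
      using w(3)[OF w0(1)] w0(3)[OF w(1)] e unfolding w(2)[symmetric] w0(2)[symmetric] dist_real_def by linarith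
  qed
qed

text \<open>A nonnegative continuous function on a compact set vanishes somewhere iff its values on
  a countable dense subset come arbitrarily close to zero. This replaces an uncountable union by
  countable operations.\<close>

lemma zero_attained_measurable:
  fixes G :: "'y \<Rightarrow> 'b::euclidean_space \<Rightarrow> real"
  assumes W: "compact W" and cont: "\<And>y. y \<in> space M \<Longrightarrow> continuous_on W (G y)"
    and meas: "\<And>w. w \<in> W \<Longrightarrow> (\<lambda>y. G y w) \<in> borel_measurable M"
    and nn: "\<And>y w. y \<in> space M \<Longrightarrow> w \<in> W \<Longrightarrow> 0 \<le> G y w"
  shows "{y \<in> space M. \<exists>w\<in>W. G y w = 0} \<in> sets M"
proof -
  obtain D where D: "countable D" "D \<subseteq> W" "W \<subseteq> closure D" using separable by metis
  have "{y \<in> space M. \<exists>w\<in>W. G y w = 0} = (\<Inter>n::nat. \<Union>d\<in>D. {y \<in> space M. G y d < 1 / real (Suc n)})"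
  proof (intro equalityI subsetI)
    fix y assume "y \<in> {y \<in> space M. \<exists>w\<in>W. G y w = 0}"
    then obtain w where y: "y \<in> space M" and w: "w \<in> W" "G y w = 0" by auto
    have "\<exists>d\<in>D. G y d < 1 / real (Suc n)" for n
    proof -
      obtain \<delta> where \<delta>: "0 < \<delta>" "\<And>v. v \<in> W \<Longrightarrow> dist v w < \<delta> \<Longrightarrow> dist (G y v) (G y w) < 1 / real (Suc n)"
        using cont[OF y] w(1) unfolding continuous_on_iff by (metis of_nat_0_less_iff zero_less_Suc zero_less_divide_1_iff)
      obtain d where "d \<in> D" "dist d w < \<delta>"
        using D(3) w(1) \<delta>(1) by (meson closure_approachable subsetD)
      then show ?thesis using \<delta>(2)[of d] D(2) w(2) by (intro bexI[of _ d]) (auto simp: dist_real_def abs_less_iff)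
    qed
    then show "y \<in> (\<Inter>n::nat. \<Union>d\<in>D. {y \<in> space M. G y d < 1 / real (Suc n)})" using y by auto
  next
    fix y assume "y \<in> (\<Inter>n::nat. \<Union>d\<in>D. {y \<in> space M. G y d < 1 / real (Suc n)})"
    then have y: "y \<in> space M" and d: "\<And>n. \<exists>d\<in>D. G y d < 1 / real (Suc n)" by auto
    then have "W \<noteq> {}" using D(2) by blast
    then obtain w where w: "w \<in> W" "\<And>v. v \<in> W \<Longrightarrow> G y w \<le> G y v"
      using continuous_attains_inf[OF W _ cont[OF y]] by auto
    have "\<not> 0 < G y w"
    proof
      assume "0 < G y w"
      then obtain n where "1 / real (Suc n) < G y w" using nat_approx_posE by metis
      moreover obtain v where "v \<in> D" "G y v < 1 / real (Suc n)" using d by blast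
      ultimately show False using w(2)[of v] D(2) by fastforce
    qed
    then show "y \<in> {y \<in> space M. \<exists>w\<in>W. G y w = 0}" using w(1) y nn[OF y w(1)] by force
  qed
  also have "\<dots> \<in> sets M"
  proof -
    have "(\<Union>d\<in>D. {y \<in> space M. G y d < 1 / real (Suc n)}) \<in> sets M" for n
    proof (rule sets.countable_UN'[OF D(1)], rule image_subsetI)
      fix d assume "d \<in> D"
      then have [measurable]: "(\<lambda>y. G y d) \<in> borel_measurable M" using meas D(2) by auto
      show "{y \<in> space M. G y d < 1 / real (Suc n)} \<in> sets M" by measurable
    qed
    then show ?thesis by (intro sets.countable_INT') auto
  qed
  finally show ?thesis .
qed

text \<open>Lexicographic selection: for every finite set \<open>J\<close> of coordinates there is a continuous
  nonnegative penalty whose zeros minimize \<open>F\<close> and agree on \<open>J\<close>. One more coordinate is fixed by adding its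
  distance to the smallest opt_value that it takes on the zero set.\<close>

lemma measurable_argmin:
  fixes F :: "'y \<Rightarrow> real^'i \<Rightarrow> real"
  assumes W: "compact W" "W \<noteq> {}" and cont: "\<And>y. y \<in> space M \<Longrightarrow> continuous_on W (F y)"
    and meas: "\<And>w. w \<in> W \<Longrightarrow> (\<lambda>y. F y w) \<in> borel_measurable M"
  shows "\<exists>\<sigma>\<in>borel_measurable M. \<forall>y\<in>space M. \<sigma> y \<in> W \<and> (\<forall>w\<in>W. F y (\<sigma> y) \<le> F y w)"
proof -
  define penalty where "penalty J G \<longleftrightarrow>
      (\<forall>w\<in>W. (\<lambda>y. G y w) \<in> borel_measurable M) \<and>
      (\<forall>y\<in>space M. continuous_on W (G y) \<and> (\<forall>w\<in>W. 0 \<le> G y w) \<and> (\<exists>w\<in>W. G y w = 0) \<and>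
        (\<forall>w\<in>W. G y w = 0 \<longrightarrow> (\<forall>v\<in>W. F y w \<le> F y v)) \<and>
        (\<forall>w\<in>W. \<forall>v\<in>W. G y w = 0 \<longrightarrow> G y v = 0 \<longrightarrow> (\<forall>j\<in>J. w $ j = v $ j)))"
    for J :: "'i set" and G :: "'y \<Rightarrow> real^'i \<Rightarrow> real"
  have least: "{y \<in> space M. \<exists>w\<in>W. G y w = 0 \<and> H w \<le> c} \<in> sets M"
    if G: "penalty J G" and H: "continuous_on W H" for J G and H :: "real^'i \<Rightarrow> real" and c
  proof -
    \<comment> \<open>The constraint \<open>H w \<le> c\<close> is encoded as the vanishing of a
      further nonnegative continuous term.\<close>
    have "{y \<in> space M. \<exists>w\<in>W. G y w + max 0 (H w - c) = 0} \<in> sets M"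
      by (rule zero_attained_measurable[OF W(1)])
        (use G H in \<open>auto simp: penalty_def intro!: continuous_intros\<close>)
    also have "{y \<in> space M. \<exists>w\<in>W. G y w + max 0 (H w - c) = 0} = {y \<in> space M. \<exists>w\<in>W. G y w = 0 \<and> H w \<le> c}"
      using G by (intro Collect_cong conj_cong bex_cong refl) (auto simp: penalty_def add_nonneg_eq_0_iff max_def)
    finally show ?thesis .
  qed
  have "\<exists>G. penalty J G" for J
  proof (induction J rule: finite_induct[OF finite])
    case 1
    define m where "m y = (INF w\<in>W. F y w)" for y
    have m: "\<exists>w\<in>W. F y w = m y \<and> (\<forall>v\<in>W. F y w \<le> F y v)" if "y \<in> space M" for y
      using cINF_attained[OF W cont[OF that]] unfolding m_def by metis
    have le: "m y \<le> F y v" if "y \<in> space M" "v \<in> W" for y v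
      using m[OF that(1)] that(2) by auto
    \<comment> \<open>The minimum is at most \<open>c\<close> iff the excess of \<open>F y\<close>
      over \<open>c\<close>, truncated at zero, has a zero.\<close>
    have "m \<in> borel_measurable M"
      unfolding borel_measurable_iff_le
    proof
      fix c
      have "{y \<in> space M. \<exists>w\<in>W. max 0 (F y w - c) = 0} \<in> sets M"
        by (rule zero_attained_measurable[OF W(1)]) (use cont meas in \<open>auto intro!: continuous_intros\<close>)
      also have "{y \<in> space M. \<exists>w\<in>W. max 0 (F y w - c) = 0} = {y \<in> space M. m y \<le> c}"
      proof (intro Collect_cong conj_cong refl)
        fix y assume y: "y \<in> space M"
        have "max 0 (F y w - c) = 0 \<longleftrightarrow> F y w \<le> c" for w by auto
        moreover have "(\<exists>w\<in>W. F y w \<le> c) \<longleftrightarrow> m y \<le> c"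
          using m[OF y] le[OF y] by (metis order_trans)
        ultimately show "(\<exists>w\<in>W. max 0 (F y w - c) = 0) \<longleftrightarrow> m y \<le> c"
          by (simp only:)
      qed
      finally show "{y \<in> space M. m y \<le> c} \<in> sets M" .
    qed
    then have mF: "\<forall>w\<in>W. (\<lambda>y. F y w - m y) \<in> borel_measurable M" using meas by simp
    have "penalty {} (\<lambda>y w. F y w - m y)"
      unfolding penalty_def
    proof (intro conjI ballI impI)
      fix y assume y: "y \<in> space M"
      show "continuous_on W (\<lambda>w. F y w - m y)" using cont[OF y] by (intro continuous_intros)
      show "\<exists>w\<in>W. F y w - m y = 0" using m[OF y] by auto
      fix w assume w: "w \<in> W"
      show "0 \<le> F y w - m y" using le[OF y w] by simp
      show "F y w \<le> F y v" if "F y w - m y = 0" "v \<in> W" for v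
        using le[OF y that(2)] that(1) by simp
    qed (use mF in auto)
    then show ?case by blast
  next
    case (2 i J)
    then obtain G where G: "penalty J G" by auto
    have agree: "w $ j = v $ j"
      if "y \<in> space M" "w \<in> W" "v \<in> W" "G y w = 0" "G y v = 0" "j \<in> J" for y w v j
      using G that unfolding penalty_def by blast
    define Z where "Z y = {w \<in> W. G y w = 0}" for y
    define m where "m y = (INF w\<in>Z y. w $ i)" for y
    have m: "\<exists>w\<in>Z y. w $ i = m y \<and> (\<forall>v\<in>Z y. w $ i \<le> v $ i)" if y: "y \<in> space M" for y
    proof -
      have "closed (Z y)"
        unfolding Z_def using G y compact_imp_closed[OF W(1)]
        by (intro continuous_closed_preimage_constant) (auto simp: penalty_def)
      then have "compact (Z y)"
        using W(1) by (metis (no_types, lifting) Z_def compact_Int_closed inf.absorb2 mem_Collect_eq subsetI)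
      moreover have "Z y \<noteq> {}" using G y by (auto simp: Z_def penalty_def)
      moreover have "continuous_on (Z y) (\<lambda>w. w $ i)" by (intro continuous_intros)
      ultimately show ?thesis using cINF_attained[of "Z y" "\<lambda>w. w $ i"] unfolding m_def by metis
    qed
    have mm: "m \<in> borel_measurable M"
      unfolding borel_measurable_iff_le
    proof
      fix c
      have "{y \<in> space M. m y \<le> c} = {y \<in> space M. \<exists>w\<in>W. G y w = 0 \<and> w $ i \<le> c}"
        using m by (intro Collect_cong conj_cong refl) (fastforce simp: Z_def)
      then show "{y \<in> space M. m y \<le> c} \<in> sets M"
        using least[OF G, of "\<lambda>w. w $ i" c] by (simp add: continuous_intros)
    qed
    have "penalty (insert i J) (\<lambda>y w. G y w + \<bar>w $ i - m y\<bar>)"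
      unfolding penalty_def
    proof (intro conjI ballI impI)
      fix w assume "w \<in> W"
      then show "(\<lambda>y. G y w + \<bar>w $ i - m y\<bar>) \<in> borel_measurable M"
        using G mm by (auto simp: penalty_def)
    next
      fix y assume y: "y \<in> space M"
      then have nn: "\<And>w. w \<in> W \<Longrightarrow> 0 \<le> G y w" using G by (auto simp: penalty_def)
      have zero: "G y w + \<bar>w $ i - m y\<bar> = 0 \<longleftrightarrow> G y w = 0 \<and> w $ i = m y" if "w \<in> W" for w
        using nn[OF that] by (auto simp: add_nonneg_eq_0_iff)
      show "continuous_on W (\<lambda>w. G y w + \<bar>w $ i - m y\<bar>)"
        using G y by (auto simp: penalty_def intro!: continuous_intros)
      show "\<exists>w\<in>W. G y w + \<bar>w $ i - m y\<bar> = 0"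
        using m[OF y] zero by (auto simp: Z_def)
      fix w assume w: "w \<in> W"
      show "0 \<le> G y w + \<bar>w $ i - m y\<bar>" using nn[OF w] by simp
      {
        assume "G y w + \<bar>w $ i - m y\<bar> = 0"
        then show "F y w \<le> F y v" if "v \<in> W" for v
          using that G y w zero[OF w] by (auto simp: penalty_def)
      }
      fix v j assume v: "v \<in> W" "G y w + \<bar>w $ i - m y\<bar> = 0" "G y v + \<bar>v $ i - m y\<bar> = 0" "j \<in> insert i J"
      then show "w $ j = v $ j"
        using agree[OF y w v(1)] zero[OF w] zero[OF v(1)] by auto
    qed
    then show ?case by blast
  qed
  then obtain G where G: "penalty UNIV G" by blast
  have "\<exists>w. w \<in> W \<and> G y w = 0" if "y \<in> space M" for y
    using G that by (auto simp: penalty_def)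
  then obtain \<sigma> where \<sigma>: "\<And>y. y \<in> space M \<Longrightarrow> \<sigma> y \<in> W \<and> G y (\<sigma> y) = 0" by metis
  \<comment> \<open>Zeros that agree in every coordinate coincide. So \<open>\<sigma> y\<close> is
    the only zero, and its coordinate sublevel sets are those handled by
    \<open>least\<close>.\<close>
  have uniq: "w = \<sigma> y" if "y \<in> space M" "w \<in> W" "G y w = 0" for y w
  proof -
    have "w $ j = \<sigma> y $ j" for j
      using G that \<sigma>[OF that(1)] unfolding penalty_def by blast
    then show ?thesis by (simp add: vec_eq_iff)
  qed
  have "(\<lambda>y. \<chi> i. \<sigma> y $ i) \<in> borel_measurable M"
  proof (rule borel_measurable_vec_lambda)
    fix i
    show "(\<lambda>y. \<sigma> y $ i) \<in> borel_measurable M"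
      unfolding borel_measurable_iff_le
    proof
      fix c
      have "{y \<in> space M. \<sigma> y $ i \<le> c} = {y \<in> space M. \<exists>w\<in>W. G y w = 0 \<and> w $ i \<le> c}"
        using \<sigma> uniq by (intro Collect_cong conj_cong refl) metis
      then show "{y \<in> space M. \<sigma> y $ i \<le> c} \<in> sets M"
        using least[OF G, of "\<lambda>w. w $ i" c] by (simp add: continuous_intros)
    qed
  qed
  then have "\<sigma> \<in> borel_measurable M" by simp
  then show ?thesis
    using \<sigma> G by (intro bexI[of _ \<sigma>]) (auto simp: penalty_def)
qed

section \<open>The stage objective as a function of budget, factor and attention\<close>

context linear_filter begin

lemma measurable_sig_of [measurable]: "sig_of f l \<in> borel_measurable borel"
  unfolding sig_of_def[abs_def] by measurable

lemma exp_pre_eq: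
  assumes l: "l \<in> nonneg" and G [measurable]: "G \<in> borel_measurable borel" and b: "\<And>s. \<bar>G s\<bar> \<le> C"
  shows "exp_pre P f l G = (\<integral>z. G (sig_of f l z) \<partial>gauss)"
proof -
  have int: "integrable gauss (\<lambda>z. G (sig_of f l z))"
    by (rule gauss.integrable_const_bound[of _ C]) (use b in auto)
  have "exp_pre P f l G = (\<integral>z. (\<integral>z'. G (signal l (prior_mean P f + Lm *v z) (vh l *v z')) \<partial>gauss) \<partial>gauss)"
    unfolding exp_pre_def mvnormal_Sig_v[OF l] mvnormal_eta by (simp add: integral_distr)
  also have "\<dots> = (\<integral>z. (\<integral>z'. G (sig_of f l (z, z')) \<partial>gauss) \<partial>gauss)"
    unfolding signal_eq[of _ _ "(_, _)", simplified fst_conv snd_conv] ..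
  also have "\<dots> = (\<integral>z. G (sig_of f l z) \<partial>gauss)"
    by (rule integral_gauss_prod[OF int, symmetric])
  finally show ?thesis .
qed

end

context lq_stage begin

lemma param_mem: "\<Lambda> \<in> {0..\<Lambda>0} \<Longrightarrow> l \<in> allocations \<Lambda> \<Longrightarrow> (\<Lambda>, l, \<mu>) \<in> params"
  by (simp add: params_def)

text \<open>Links the expectations in the stage problem to the moments on \<open>params\<close>,
  with the signal entering through the posterior mean alone.\<close>

lemma
  assumes \<Lambda>: "\<Lambda> \<in> {0..\<Lambda>0}" and l: "l \<in> allocations \<Lambda>"
  shows exp_post_h: "exp_post P f l s (\<lambda>f' b. h (\<Lambda> - (\<Sum>j\<in>UNIV. l $ j)) f') = Eh (\<Lambda>, l, post_mean P f l s)"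
    and lin_term_eq: "lin_term P t h \<Lambda> f l s = lin (\<Lambda>, l, post_mean P f l s)"
    and quad_term_eq: "quad_term P t h \<Lambda> f l s = quad (\<Lambda>, l, post_mean P f l s)"
proof -
  let ?p = "(\<Lambda>, l, post_mean P f l s)"
  have p: "?p \<in> params" by (rule param_mem[OF \<Lambda> l])
  have ln: "l \<in> nonneg" by (rule allocations_nonneg[OF l])
  have [measurable]: "h (rem \<Lambda> l) \<in> borel_measurable borel"
    by (rule h_measurable[OF rem_range[OF \<Lambda> l]])
  have eq: "hn ?p y = h (rem \<Lambda> l) (nextf l (post_mean P f l s) y)" "bn ?p y = nextb l (post_mean P f l s) y" for y
    by (simp_all add: hn_def bn_def)
  show "exp_post P f l s (\<lambda>f' b. h (\<Lambda> - (\<Sum>j\<in>UNIV. l $ j)) f') = Eh ?p"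
    unfolding rem_def[symmetric] Eh_def eq
    by (rule exp_post_eq[OF ln]) (use integrable_h[OF p] in \<open>simp_all add: eq[abs_def]\<close>)
  show "lin_term P t h \<Lambda> f l s = lin ?p"
    unfolding lin_term_def lin_def rem_def[symmetric] Eb_def eq
    by (subst exp_post_eq[OF ln]) (use integrable_hb[OF p] in \<open>simp_all add: eq[abs_def]\<close>)
  show "quad_term P t h \<Lambda> f l s = quad ?p"
    unfolding quad_term_def quad_def rem_def[symmetric] Ebb_def eq
    by (subst exp_post_eq[OF ln]) (use integrable_hbb[OF p] in \<open>simp_all add: eq[abs_def]\<close>)
qed

lemma psi_measurable:
  assumes \<Lambda>: "\<Lambda> \<in> {0..\<Lambda>0}" and l: "l \<in> allocations \<Lambda>"
  shows "(\<lambda>\<mu>. psi (\<Lambda>, l, \<mu>)) \<in> borel_measurable borel"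
  by (intro borel_measurable_continuous_onI continuous_on_compose2[OF continuous_on_psi] continuous_intros)
    (use param_mem[OF \<Lambda> l] in auto)

lemma measurable_post_mean [measurable]: "post_mean P f l \<in> borel_measurable borel"
  unfolding post_mean_def[abs_def] by measurable

lemma psi_abs_le: "p \<in> params \<Longrightarrow> \<bar>psi p\<bar> \<le> bound * ac\<^sup>2 + qcoef P t"
  using psi_pos[of p] psi_le[of p] by simp

text \<open>Before the signal is seen, the posterior mean is distributed as the prior mean plus
  \<open>dev\<close>. The signal itself disappears, and with it the discontinuity at zero
  attention.\<close>

lemma stage_objective_eq:
  assumes \<Lambda>: "\<Lambda> \<in> {0..\<Lambda>0}" and l: "l \<in> allocations \<Lambda>"
  shows "stage_objective P t h \<Lambda> f l = (\<integral>z. psi (\<Lambda>, l, prior_mean P f + dev l z) \<partial>gauss)"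
proof -
  note [measurable] = psi_measurable[OF \<Lambda> l]
  have "stage_objective P t h \<Lambda> f l = exp_pre P f l (\<lambda>s. psi (\<Lambda>, l, post_mean P f l s))"
    unfolding stage_objective_def exp_post_h[OF \<Lambda> l] lin_term_eq[OF \<Lambda> l] quad_term_eq[OF \<Lambda> l]
    by (simp add: psi_def ctrl_def)
  also have "\<dots> = (\<integral>z. psi (\<Lambda>, l, post_mean P f l (sig_of f l z)) \<partial>gauss)"
    by (rule exp_pre_eq[OF allocations_nonneg[OF l] _ psi_abs_le[OF param_mem[OF \<Lambda> l]]]) measurable
  finally show ?thesis by (simp add: post_mean_sig_of[OF allocations_nonneg[OF l]])
qed

definition domain :: "(real \<times> (real^'k) \<times> (real^'k)) set" where
  "domain = {(\<Lambda>, f, l). \<Lambda> \<in> {0..\<Lambda>0} \<and> l \<in> allocations \<Lambda>}"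

lemma
  shows continuous_on_stage_objective: "continuous_on domain (\<lambda>(\<Lambda>, f, l). stage_objective P t h \<Lambda> f l)"
    and integrable_psi: "\<Lambda> \<in> {0..\<Lambda>0} \<Longrightarrow> l \<in> allocations \<Lambda> \<Longrightarrow>
      integrable gauss (\<lambda>z. psi (\<Lambda>, l, prior_mean P f + dev l z))"
proof -
  let ?C = "bound * ac\<^sup>2 + qcoef P t"
  let ?\<phi> = "\<lambda>q z. psi (fst q, snd (snd q), prior_mean P (fst (snd q)) + dev (snd (snd q)) z)"
  have mem: "fst q \<in> {0..\<Lambda>0}" "snd (snd q) \<in> allocations (fst q)" if "q \<in> domain" for q
    using that by (auto simp: domain_def)
  have c: "continuous_on domain (\<lambda>q. ?\<phi> q z)" for z
  proof (rule continuous_on_compose2[OF continuous_on_psi])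
    have "continuous_on domain (\<lambda>q. dev (snd (snd q)) z)"
      by (rule continuous_on_compose2[OF continuous_on_dev])
        (auto intro!: continuous_intros allocations_nonneg[OF mem(2)])
    then show "continuous_on domain (\<lambda>q. (fst q, snd (snd q), prior_mean P (fst (snd q)) + dev (snd (snd q)) z))"
      unfolding prior_mean_def by (intro continuous_intros)
  qed (use mem param_mem in blast)
  have m: "?\<phi> q \<in> borel_measurable borel" if "q \<in> domain" for q
    using psi_measurable[OF mem[OF that]] by measurable
  have b: "norm (?\<phi> q z) \<le> ?C * (1 + (norm z)\<^sup>2)" if "q \<in> domain" for q z
  proof -
    have "0 \<le> ?C" using psi_abs_le[OF param_mem[OF mem[OF that]]] abs_ge_zero order_trans by blast
    then have "?C \<le> ?C * (1 + (norm z)\<^sup>2)" by (simp add: distrib_left)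
    then show ?thesis using psi_abs_le[OF param_mem[OF mem[OF that]]] unfolding real_norm_def
      by (rule order_trans[rotated])
  qed
  have "continuous_on domain (\<lambda>q. \<integral>z. ?\<phi> q z \<partial>gauss)"
    by (rule continuous_on_gauss_integral[OF c m b continuous_on_const])
  then show "continuous_on domain (\<lambda>(\<Lambda>, f, l). stage_objective P t h \<Lambda> f l)"
    by (rule continuous_on_cong[THEN iffD1, rotated -1]) (auto simp: domain_def stage_objective_eq)
  show "\<Lambda> \<in> {0..\<Lambda>0} \<Longrightarrow> l \<in> allocations \<Lambda> \<Longrightarrow> integrable gauss (\<lambda>z. psi (\<Lambda>, l, prior_mean P f + dev l z))"
    using integrable_gauss_bounded[OF c m b continuous_on_const, of "(\<Lambda>, f, l)"] by (simp add: domain_def)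
qed

lemma stage_objective_bounds:
  assumes \<Lambda>: "\<Lambda> \<in> {0..\<Lambda>0}" and l: "l \<in> allocations \<Lambda>"
  shows "0 < stage_objective P t h \<Lambda> f l" and "stage_objective P t h \<Lambda> f l \<le> bound * ac\<^sup>2 + qcoef P t"
proof -
  note int = integrable_psi[OF \<Lambda> l, of f]
  have "(\<integral>z. 0 \<partial>(gauss :: ((real^'k) \<times> (real^'k)) measure)) < stage_objective P t h \<Lambda> f l"
    unfolding stage_objective_eq[OF \<Lambda> l]
    by (rule gauss.integral_less_AE_space[OF _ int])
      (auto simp: psi_pos[OF param_mem[OF \<Lambda> l]] gauss.emeasure_space_1[simplified])
  then show "0 < stage_objective P t h \<Lambda> f l" by simp
  have "stage_objective P t h \<Lambda> f l \<le> (\<integral>z. bound * ac\<^sup>2 + qcoef P t \<partial>(gauss :: ((real^'k) \<times> (real^'k)) measure))"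
    unfolding stage_objective_eq[OF \<Lambda> l]
    by (intro integral_mono int psi_le param_mem \<Lambda> l) auto
  then show "stage_objective P t h \<Lambda> f l \<le> bound * ac\<^sup>2 + qcoef P t" by (simp add: gauss.prob_space[simplified])
qed

definition "scaled = (\<lambda>(\<Lambda>, f) w. stage_objective P t h \<Lambda> f (\<Lambda> *\<^sub>R w))"

lemma continuous_on_scaled: "continuous_on (({0..\<Lambda>0} \<times> UNIV) \<times> allocations 1) (\<lambda>(y, w). scaled y w)"
proof -
  have "continuous_on (({0..\<Lambda>0} \<times> UNIV) \<times> allocations 1)
      (\<lambda>q. (\<lambda>(\<Lambda>, f, l). stage_objective P t h \<Lambda> f l) (fst (fst q), snd (fst q), fst (fst q) *\<^sub>R snd q))"
    by (rule continuous_on_compose2[OF continuous_on_stage_objective])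
      (auto simp: domain_def intro!: continuous_intros scale_in_allocations)
  then show ?thesis by (simp add: scaled_def case_prod_beta)
qed

definition opt_value where
  "opt_value \<Lambda> f = (INF l\<in>allocations \<Lambda>. stage_objective P t h \<Lambda> f l)"

lemma opt_value_scaled: "\<Lambda> \<in> {0..\<Lambda>0} \<Longrightarrow> opt_value \<Lambda> f = (INF w\<in>allocations 1. scaled (\<Lambda>, f) w)"
  unfolding opt_value_def scaled_def by (subst allocations_scale) (simp_all add: image_image)

lemma one_alloc: "compact (allocations 1 :: (real^'k) set)" "allocations 1 \<noteq> ({} :: (real^'k) set)"
  using compact_allocations zero_in_allocations[of 1] by auto

lemma opt_value_attained:
  assumes \<Lambda>: "\<Lambda> \<in> {0..\<Lambda>0}"
  shows "\<exists>l\<in>allocations \<Lambda>. stage_objective P t h \<Lambda> f l = opt_value \<Lambda> f \<and>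
    (\<forall>l'\<in>allocations \<Lambda>. stage_objective P t h \<Lambda> f l \<le> stage_objective P t h \<Lambda> f l')"
proof -
  have "continuous_on (allocations \<Lambda>) (\<lambda>l. (\<lambda>(\<Lambda>, f, l). stage_objective P t h \<Lambda> f l) (\<Lambda>, f, l))"
    by (rule continuous_on_compose2[OF continuous_on_stage_objective])
      (use \<Lambda> in \<open>auto simp: domain_def intro!: continuous_intros\<close>)
  then have "continuous_on (allocations \<Lambda>) (stage_objective P t h \<Lambda> f)" by simp
  moreover have "allocations \<Lambda> \<noteq> ({} :: (real^'k) set)" using zero_in_allocations[of \<Lambda>] \<Lambda> by auto
  ultimately show ?thesis
    unfolding opt_value_def using cINF_attained[OF compact_allocations] by metis
qed

lemma nice_opt_value: "nice opt_value"
  unfolding nice_def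
proof (intro conjI exI ballI allI)
  have "continuous_on ({0..\<Lambda>0} \<times> UNIV) (\<lambda>y. INF w\<in>allocations 1. scaled y w)"
    by (rule continuous_on_cINF[OF one_alloc continuous_on_scaled])
  then show "continuous_on ({0..\<Lambda>0} \<times> UNIV) (\<lambda>(\<Lambda>, f). opt_value \<Lambda> f)"
    by (rule continuous_on_cong[THEN iffD1, rotated -1]) (auto simp: opt_value_scaled)
  fix \<Lambda> f assume \<Lambda>: "\<Lambda> \<in> {0..\<Lambda>0}"
  then show "0 < opt_value \<Lambda> f" "opt_value \<Lambda> f \<le> bound * ac\<^sup>2 + qcoef P t"
    using opt_value_attained[OF \<Lambda>, of f] stage_objective_bounds[OF \<Lambda>] by (metis)+
qed

text \<open>The selection takes place in \<open>allocations 1\<close> and is multiplied by the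
  budget; the result competes with every allocation because scaling is onto
  \<open>allocations \<Lambda>\<close>.\<close>

lemma argmin_exists:
  "\<exists>ls. (\<lambda>(\<Lambda>, f). ls \<Lambda> f) \<in> borel_measurable (restrict_space borel ({0..\<Lambda>0} \<times> UNIV)) \<and>
     (\<forall>\<Lambda>\<in>{0..\<Lambda>0}. \<forall>f. is_arg_min (stage_objective P t h \<Lambda> f) (\<lambda>l. l \<in> allocations \<Lambda>) (ls \<Lambda> f))"
proof -
  let ?M = "restrict_space borel ({0..\<Lambda>0} \<times> (UNIV :: (real^'k) set))"
  have sp: "space ?M = {0..\<Lambda>0} \<times> UNIV" by (simp add: space_restrict_space)
  have "continuous_on (allocations 1) (scaled y)" if "y \<in> space ?M" for y
    using that by (intro continuous_on_slice1[OF continuous_on_scaled]) (simp add: sp)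
  moreover have "(\<lambda>y. scaled y w) \<in> borel_measurable ?M" if "w \<in> allocations 1" for w
    by (intro borel_measurable_continuous_on_restrict continuous_on_slice2[OF continuous_on_scaled that])
  ultimately obtain \<sigma> where \<sigma>: "\<sigma> \<in> borel_measurable ?M"
    "\<And>y. y \<in> {0..\<Lambda>0} \<times> UNIV \<Longrightarrow> \<sigma> y \<in> allocations 1 \<and> (\<forall>w\<in>allocations 1. scaled y (\<sigma> y) \<le> scaled y w)"
    using measurable_argmin[OF one_alloc, of ?M scaled] unfolding sp by metis
  have "fst \<in> borel_measurable ?M"
    by (intro borel_measurable_continuous_on_restrict continuous_intros)
  then have "(\<lambda>y. fst y *\<^sub>R \<sigma> y) \<in> borel_measurable ?M" using \<sigma>(1) by measurable
  moreover have "is_arg_min (stage_objective P t h \<Lambda> f) (\<lambda>l. l \<in> allocations \<Lambda>) (\<Lambda> *\<^sub>R \<sigma> (\<Lambda>, f))"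
    if "\<Lambda> \<in> {0..\<Lambda>0}" for \<Lambda> f
    unfolding is_arg_min_linorder
  proof (intro conjI allI impI)
    show "\<Lambda> *\<^sub>R \<sigma> (\<Lambda>, f) \<in> allocations \<Lambda>"
      using \<sigma>(2)[of "(\<Lambda>, f)"] that by (auto intro!: scale_in_allocations)
    fix l :: "real^'k" assume "l \<in> allocations \<Lambda>"
    then have "l \<in> (*\<^sub>R) \<Lambda> ` allocations 1" using that by (subst (asm) allocations_scale) simp_all
    then obtain w where w: "w \<in> allocations 1" "l = \<Lambda> *\<^sub>R w" by blast
    have "scaled (\<Lambda>, f) (\<sigma> (\<Lambda>, f)) \<le> scaled (\<Lambda>, f) w" using \<sigma>(2)[of "(\<Lambda>, f)"] that w(1) by auto
    then show "stage_objective P t h \<Lambda> f (\<Lambda> *\<^sub>R \<sigma> (\<Lambda>, f)) \<le> stage_objective P t h \<Lambda> f l"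
      by (simp add: scaled_def w(2))
  qed
  ultimately show ?thesis
    by (intro exI[of _ "\<lambda>\<Lambda> f. \<Lambda> *\<^sub>R \<sigma> (\<Lambda>, f)"]) (simp add: case_prod_unfold)
qed

end

section \<open>Backward induction for the value functions\<close>

context lq begin

lemma nice_value_togo: "m \<le> horizon P \<Longrightarrow> nice (value_togo P m)"
proof (induction m)
  case 0
  show ?case using valid by (auto simp: nice_def valid_data_def case_prod_beta)
next
  case (Suc m)
  then interpret lq_stage P \<Lambda>0 "value_togo P m" "horizon P - Suc m"
    by unfold_locales auto
  show ?case using nice_opt_value unfolding opt_value_def[abs_def] by simp
qed

lemma nice_hfun: "nice (hfun P t)"
  unfolding hfun_def by (rule nice_value_togo) simp

lemma lq_stage_hfun: "t < horizon P \<Longrightarrow> lq_stage P \<Lambda>0 (hfun P (Suc t)) t"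
  by unfold_locales (simp_all add: nice_hfun)

lemma hfun_eq_value:
  assumes "t < horizon P"
  shows "hfun P t \<Lambda> f = (INF l\<in>allocations \<Lambda>. stage_objective P t (hfun P (Suc t)) \<Lambda> f l)"
  using assms by (simp add: hfun_def Suc_diff_Suc[symmetric] )

lemma argmin_selector_exists: "\<exists>ls. argmin_selector P \<Lambda>0 ls"
proof -
  have "\<forall>t. \<exists>ls. t < horizon P \<longrightarrow>
     (\<lambda>(\<Lambda>, f). ls \<Lambda> f) \<in> borel_measurable (restrict_space borel ({0..\<Lambda>0} \<times> UNIV)) \<and>
     (\<forall>\<Lambda>\<in>{0..\<Lambda>0}. \<forall>f. is_arg_min (stage_objective P t (hfun P (Suc t)) \<Lambda> f) (\<lambda>l. l \<in> allocations \<Lambda>) (ls \<Lambda> f))"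
    using lq_stage.argmin_exists[OF lq_stage_hfun] by blast
  from choice[OF this] show ?thesis unfolding argmin_selector_def by blast
qed

end


section \<open>The Bellman equation of one stage\<close>

lemma nn_integral_mvnormal_shift:
  fixes g :: "real^'i \<Rightarrow> ennreal"
  assumes [measurable]: "g \<in> borel_measurable borel"
  shows "(\<integral>\<^sup>+y. g y \<partial>mvnormal m S) = (\<integral>\<^sup>+y. g (m + y) \<partial>mvnormal 0 S)"
  unfolding mvnormal_gauss by (simp add: nn_integral_distr)

text \<open>The Doob-Dynkin factorization, by induction from indicators to suprema of increasing
  sequences.\<close>

lemma measurable_factor_ennreal:
  fixes u :: "'a \<Rightarrow> ennreal"
  assumes u: "u \<in> borel_measurable (vimage_algebra X g N)" and g: "g \<in> X \<rightarrow> space N"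
  shows "\<exists>\<phi>\<in>borel_measurable N. \<forall>x\<in>X. u x = \<phi> (g x)"
  using u
proof (induction rule: borel_measurable_induct)
  case (cong f h)
  then show ?case by auto
next
  case (set A)
  then obtain B where B: "B \<in> sets N" "A = g -` B \<inter> X"
    using sets_vimage_algebra2[OF g] by auto
  then show ?case
    by (intro bexI[of _ "indicator B"]) (auto simp: indicator_def)
next
  case (mult u c)
  obtain \<phi> where "\<phi> \<in> borel_measurable N" "\<And>x. x \<in> X \<Longrightarrow> u x = \<phi> (g x)" using mult.IH by metis
  then show ?case by (intro bexI[of _ "\<lambda>y. c * \<phi> y"] ballI) simp_all
next
  case (add u v)
  obtain \<phi> where "\<phi> \<in> borel_measurable N" "\<And>x. x \<in> X \<Longrightarrow> u x = \<phi> (g x)" using add.IH(1) by metis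
  moreover obtain \<psi> where "\<psi> \<in> borel_measurable N" "\<And>x. x \<in> X \<Longrightarrow> v x = \<psi> (g x)" using add.IH(2) by metis
  ultimately show ?case by (intro bexI[of _ "\<lambda>y. \<psi> y + \<phi> y"] ballI) simp_all
next
  case (seq U)
  have "\<forall>i. \<exists>\<phi>. \<phi> \<in> borel_measurable N \<and> (\<forall>x\<in>X. U i x = \<phi> (g x))" using seq.IH by blast
  from choice[OF this] obtain \<phi> where "\<And>i. \<phi> i \<in> borel_measurable N" "\<And>i x. x \<in> X \<Longrightarrow> U i x = \<phi> i (g x)"
    by blast
  then show ?case
    by (intro bexI[of _ "\<lambda>y. SUP i. \<phi> i y"] ballI) (simp_all add: image_image SUP_apply)
qed

lemma measurable_factor:
  fixes u :: "'a \<Rightarrow> real^'i"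
  assumes u: "u \<in> borel_measurable (vimage_algebra X g N)" and g: "g \<in> X \<rightarrow> space N"
  shows "\<exists>\<phi>\<in>borel_measurable N. \<forall>x\<in>X. u x = \<phi> (g x)"
proof -
  have "\<exists>\<phi>. \<phi> \<in> borel_measurable N \<and> (\<forall>x\<in>X. u x $ i = \<phi> (g x))" for i
  proof -
    have "(\<lambda>x. ennreal (u x $ i)) \<in> borel_measurable (vimage_algebra X g N)"
      "(\<lambda>x. ennreal (- (u x $ i))) \<in> borel_measurable (vimage_algebra X g N)"
      using u by measurable
    then obtain a b where "a \<in> borel_measurable N" "\<And>x. x \<in> X \<Longrightarrow> ennreal (u x $ i) = a (g x)"
      "b \<in> borel_measurable N" "\<And>x. x \<in> X \<Longrightarrow> ennreal (- (u x $ i)) = b (g x)"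
      using measurable_factor_ennreal[OF _ g] by metis
    \<comment> \<open>Coordinates are recovered from positive and negative parts, since
      \<open>ennreal\<close> truncates negative numbers to zero.\<close>
    moreover have "r = enn2real (ennreal r) - enn2real (ennreal (- r))" for r
      by (cases "0 \<le> r") (auto simp: ennreal_neg)
    ultimately show ?thesis
      by (intro exI[of _ "\<lambda>y. enn2real (a y) - enn2real (b y)"]) (auto, metis)
  qed
  then have "\<forall>i. \<exists>\<phi>. \<phi> \<in> borel_measurable N \<and> (\<forall>x\<in>X. u x $ i = \<phi> (g x))" by blast
  from choice[OF this] obtain \<phi> where \<phi>: "\<And>i. \<phi> i \<in> borel_measurable N" "\<And>i x. x \<in> X \<Longrightarrow> u x $ i = \<phi> i (g x)"
    by auto
  show ?thesis
    by (intro bexI[of _ "\<lambda>y. \<chi> i. \<phi> i y"] borel_measurable_vec_lambda) (auto simp: \<phi> vec_eq_iff)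
qed

lemma borel_measurable_continuous_on_compose:
  fixes G :: "'b::topological_space \<Rightarrow> 'c::topological_space"
  assumes G: "continuous_on K G" and g: "g \<in> borel_measurable M" and K: "\<And>x. x \<in> space M \<Longrightarrow> g x \<in> K"
  shows "(\<lambda>x. G (g x)) \<in> borel_measurable M"
proof (rule measurable_compose[OF _ borel_measurable_continuous_on_restrict[OF G]])
  show "g \<in> measurable M (restrict_space borel K)"
    using g K by (intro measurable_restrict_space2) auto
qed

section \<open>Integrals over the shocks of one period\<close>

context linear_filter begin

abbreviation "shock_integral l m G \<equiv> \<integral>\<^sup>+f'. (\<integral>\<^sup>+v. (\<integral>\<^sup>+e. G f' v e \<partial>mvnormal 0 (Sig_eps P))
  \<partial>mvnormal 0 (Sig_v P l)) \<partial>mvnormal m (Sig_eta P)"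

text \<open>The constants \<open>a\<close> and \<open>b\<close> will be the cost already incurred
  and the indicator of a past event. The shift by \<open>m\<close> recentres the factor shock at the
  prior mean.\<close>

lemma shock_integral_affine:
  assumes [measurable]: "R \<in> borel_measurable (borel \<Otimes>\<^sub>M (borel \<Otimes>\<^sub>M borel))"
  shows "shock_integral l 0 (\<lambda>y v e. (a + R (m + y, v, e)) * b)
    = (a + shock_integral l m (\<lambda>f' v e. R (f', v, e))) * b"
proof -
  have "shock_integral l 0 (\<lambda>y v e. (a + R (m + y, v, e)) * b) = shock_integral l m (\<lambda>f' v e. (a + R (f', v, e)) * b)"
    by (rule nn_integral_mvnormal_shift[symmetric]) measurable
  then show ?thesis
    by (simp add: nn_integral_multc nn_integral_add mvnormal.emeasure_space_1[simplified])
qed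

end

context lq_stage begin

text \<open>Along a trajectory the attention is random as well, which calls for joint measurability.
  It follows from continuity, after the gain is rewritten through \<open>core\<close> on nonnegative
  attention.\<close>

lemma measurable_ctrl:
  assumes [measurable]: "\<Lambda> \<in> borel_measurable M" "f \<in> borel_measurable M" "l \<in> borel_measurable M" "s \<in> borel_measurable M"
    and mem: "\<And>x. x \<in> space M \<Longrightarrow> \<Lambda> x \<in> {0..\<Lambda>0} \<and> l x \<in> allocations (\<Lambda> x)"
  shows "(\<lambda>x. ctrl (\<Lambda> x, l x, post_mean P (f x) (l x) (s x))) \<in> borel_measurable M"
proof -
  let ?K = "{q :: (real^'k) \<times> (real^'k). fst q \<in> nonneg}"
  have "continuous_on ?K (\<lambda>q. core (fst q) *v (Prec_v P (fst q) *v snd q))"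
  proof -
    have "continuous_on ?K (\<lambda>q. Prec_v P (fst q))"
      by (rule continuous_on_compose2[OF continuous_on_Prec[of UNIV]]) (auto intro!: continuous_intros)
    then show ?thesis
      unfolding core_def matrix_vector_mul_assoc[symmetric]
      by (intro continuous_on_matrix_vector_mult continuous_on_matrix_inv_mult continuous_on_const
          continuous_on_add continuous_on_matrix_matrix_mult invertible_core)
        (auto intro!: continuous_intros)
  qed
  then have "(\<lambda>x. core (fst (l x, s x - prior_mean P (f x))) *v (Prec_v P (fst (l x, s x - prior_mean P (f x)))
      *v snd (l x, s x - prior_mean P (f x)))) \<in> borel_measurable M"
    by (rule borel_measurable_continuous_on_compose)
      (use mem allocations_nonneg in \<open>auto simp: prior_mean_def\<close>)
  then have g: "(\<lambda>x. core (l x) *v (Prec_v P (l x) *v (s x - prior_mean P (f x)))) \<in> borel_measurable M"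
    by simp
  have "(\<lambda>x. post_mean P (f x) (l x) (s x)) \<in> borel_measurable M
    \<longleftrightarrow> (\<lambda>x. prior_mean P (f x) + core (l x) *v (Prec_v P (l x) *v (s x - prior_mean P (f x)))) \<in> borel_measurable M"
  proof (intro measurable_cong)
    fix x assume "x \<in> space M"
    then have "gain P (l x) = core (l x) ** Prec_v P (l x)"
      by (intro gain_eq_core allocations_nonneg) (use mem in blast)
    then show "post_mean P (f x) (l x) (s x)
        = prior_mean P (f x) + core (l x) *v (Prec_v P (l x) *v (s x - prior_mean P (f x)))"
      by (simp add: post_mean_def matrix_vector_mul_assoc)
  qed
  also have "\<dots>"
    using g unfolding prior_mean_def by measurable
  finally have [measurable]: "(\<lambda>x. post_mean P (f x) (l x) (s x)) \<in> borel_measurable M" .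
  show ?thesis
    by (rule borel_measurable_continuous_on_compose[OF continuous_on_ctrl])
      (use mem param_mem in auto)
qed

lemma nn_integral_expected_cost:
  assumes p: "p \<in> params"
  shows "(\<integral>\<^sup>+y. ennreal (stage_cost x u + hn p y * (ac * x + bn p y \<bullet> u)\<^sup>2) \<partial>gauss)
    = ennreal (stage_cost x u + (\<integral>y. hn p y * (ac * x + bn p y \<bullet> u)\<^sup>2 \<partial>gauss))"
proof -
  note int = expected_square(1)[OF p, of x u]
  have "0 \<le> hn p y * (ac * x + bn p y \<bullet> u)\<^sup>2" for y using hn_pos[OF p, of y] by simp
  then have "(\<integral>\<^sup>+y. ennreal (stage_cost x u + hn p y * (ac * x + bn p y \<bullet> u)\<^sup>2) \<partial>gauss)
    = ennreal (\<integral>y. stage_cost x u + hn p y * (ac * x + bn p y \<bullet> u)\<^sup>2 \<partial>gauss)"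
    using int stage_cost_nonneg[of x u] by (intro nn_integral_eq_integral) auto
  also have "(\<integral>y. stage_cost x u + hn p y * (ac * x + bn p y \<bullet> u)\<^sup>2 \<partial>gauss)
    = stage_cost x u + (\<integral>y. hn p y * (ac * x + bn p y \<bullet> u)\<^sup>2 \<partial>gauss)"
    using int by (simp add: gauss.prob_space[simplified])
  finally show ?thesis .
qed

text \<open>Here \<open>U\<close> is an arbitrary measurable feedback on the signal. Once
  \<open>nn_integral_signal\<close> separates the signal from the posterior error, the control is
  constant in the inner integral and the square can be completed there; averaging \<open>psi\<close>
  over the signal gives the stage objective.\<close>

lemma
  fixes U :: "real^'k \<Rightarrow> real^'n" and x :: real and f :: "real^'k"
  assumes \<Lambda>: "\<Lambda> \<in> {0..\<Lambda>0}" and l: "l \<in> allocations \<Lambda>" and U [measurable]: "U \<in> borel_measurable borel"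
  defines "I \<equiv> shock_integral l (prior_mean P f) (\<lambda>f' v e. ennreal (stage_cost x (U (signal l f' v)) +
      h (rem \<Lambda> l) f' * (ac * x + (cvec P + Dmat P *v f' + e) \<bullet> U (signal l f' v))\<^sup>2))"
  shows bellman_ge: "ennreal (x\<^sup>2 * stage_objective P t h \<Lambda> f l) \<le> I"
    and bellman_eq: "(\<And>s. U s = - (x *\<^sub>R ctrl (\<Lambda>, l, post_mean P f l s))) \<Longrightarrow>
      I = ennreal (x\<^sup>2 * stage_objective P t h \<Lambda> f l)"
proof -
  have ln: "l \<in> nonneg" by (rule allocations_nonneg[OF l])
  have hm: "h (rem \<Lambda> l) \<in> borel_measurable borel"
    by (rule h_measurable[OF rem_range[OF \<Lambda> l]])
  let ?F = "\<lambda>f' s e. ennreal (stage_cost x (U s) +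
      h (rem \<Lambda> l) f' * (ac * x + (cvec P + Dmat P *v f' + e) \<bullet> U s)\<^sup>2)"
  let ?p = "\<lambda>z. (\<Lambda>, l, prior_mean P f + dev l z)"
  have p: "?p z \<in> params" for z by (rule param_mem[OF \<Lambda> l])
  have cm: "(\<lambda>s. stage_cost x (U s)) \<in> borel_measurable borel"
    unfolding cost_def by measurable
  note [measurable (raw)] = measurable_compose[OF _ cm] measurable_compose[OF _ hm]
  have "I = (\<integral>\<^sup>+z. (\<integral>\<^sup>+z'. (\<integral>\<^sup>+e. ?F (prior_mean P f + dev l z + err l z') (sig_of f l z) e
      \<partial>mvnormal 0 (Sig_eps P)) \<partial>gauss) \<partial>gauss)"
    unfolding I_def by (rule nn_integral_signal[OF ln]) measurable
  also have "\<dots> = (\<integral>\<^sup>+z. ennreal (stage_cost x (U (sig_of f l z)) +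
      (\<integral>y. hn (?p z) y * (ac * x + bn (?p z) y \<bullet> U (sig_of f l z))\<^sup>2 \<partial>gauss)) \<partial>gauss)"
  proof (rule nn_integral_cong)
    fix z
    let ?u = "U (sig_of f l z)"
    let ?H = "\<lambda>y. ennreal (stage_cost x ?u + hn (?p z) y * (ac * x + bn (?p z) y \<bullet> ?u)\<^sup>2)"
    have [measurable]: "hn (?p z) \<in> borel_measurable borel" by (rule hn_measurable[OF p])
    have "(\<integral>\<^sup>+z'. (\<integral>\<^sup>+e. ?F (prior_mean P f + dev l z + err l z') (sig_of f l z) e
      \<partial>mvnormal 0 (Sig_eps P)) \<partial>gauss) = (\<integral>\<^sup>+z'. (\<integral>\<^sup>+w. ?H (z', w) \<partial>gauss) \<partial>gauss)"
      unfolding mvnormal_gauss[of 0 "Sig_eps P"]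
      by (simp add: nn_integral_distr hn_def bn_def nextb_def nextf_def Le_def)
    also have "\<dots> = (\<integral>\<^sup>+y. ?H y \<partial>gauss)"
      by (rule nn_integral_gauss_prod[symmetric]) measurable
    also have "\<dots> = ennreal (stage_cost x ?u + (\<integral>y. hn (?p z) y * (ac * x + bn (?p z) y \<bullet> ?u)\<^sup>2 \<partial>gauss))"
      by (rule nn_integral_expected_cost[OF p])
    finally show "(\<integral>\<^sup>+z'. (\<integral>\<^sup>+e. ?F (prior_mean P f + dev l z + err l z') (sig_of f l z) e
      \<partial>mvnormal 0 (Sig_eps P)) \<partial>gauss)
      = ennreal (stage_cost x ?u + (\<integral>y. hn (?p z) y * (ac * x + bn (?p z) y \<bullet> ?u)\<^sup>2 \<partial>gauss))" .
  qed
  finally have I: "I = (\<integral>\<^sup>+z. ennreal (stage_cost x (U (sig_of f l z)) +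
      (\<integral>y. hn (?p z) y * (ac * x + bn (?p z) y \<bullet> U (sig_of f l z))\<^sup>2 \<partial>gauss)) \<partial>gauss)" .
  have J: "(\<integral>\<^sup>+z. ennreal (x\<^sup>2 * psi (?p z)) \<partial>gauss) = ennreal (x\<^sup>2 * stage_objective P t h \<Lambda> f l)"
    unfolding stage_objective_eq[OF \<Lambda> l] integral_mult_right_zero[symmetric]
  proof (rule nn_integral_eq_integral)
    show "integrable gauss (\<lambda>z. x\<^sup>2 * psi (?p z))"
      using integrable_psi[OF \<Lambda> l, of f] by (rule integrable_mult_right)
    show "AE z in gauss. 0 \<le> x\<^sup>2 * psi (?p z)"
      by (intro AE_I2 mult_nonneg_nonneg zero_le_power2 less_imp_le psi_pos p)
  qed
  show "ennreal (x\<^sup>2 * stage_objective P t h \<Lambda> f l) \<le> I"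
    unfolding I J[symmetric] by (intro nn_integral_mono ennreal_leI expected_cost_ge p)
  assume U: "\<And>s. U s = - (x *\<^sub>R ctrl (\<Lambda>, l, post_mean P f l s))"
  show "I = ennreal (x\<^sup>2 * stage_objective P t h \<Lambda> f l)"
    unfolding I J[symmetric] U post_mean_sig_of[OF ln] expected_cost_ctrl[OF p] ..
qed

end


section \<open>Information and independence\<close>

lemma events_of_measurable:
  assumes "space F = space M" and "events_of M X \<subseteq> sets F"
  shows "X \<in> borel_measurable F"
  by (rule measurableI) (use assms in \<open>auto simp: events_of_def\<close>)

lemma measurable_events_of:
  assumes "space F = space M" and "X \<in> borel_measurable F"
  shows "events_of M X \<subseteq> sets F"
  using assms by (auto simp: events_of_def dest: measurable_sets)

lemma sigma_subalgebra:
  assumes "space F = X" and "A \<subseteq> sets F"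
  shows "subalgebra F (sigma X A)"
proof -
  have "A \<subseteq> Pow X" using assms sets.sets_into_space by blast
  then show ?thesis
    using sets.sigma_sets_subset[OF assms(2)] assms(1) by (simp add: subalgebra_def space_measure_of_conv)
qed

lemma subset_sets_sigma: "A \<subseteq> Pow X \<Longrightarrow> A \<subseteq> sets (sigma X A)"
  by (auto simp: sets_measure_of intro: sigma_sets.Basic)

lemma Int_stable_events_of: "Int_stable (events_of M X)"
proof (rule Int_stableI)
  fix a b assume "a \<in> events_of M X" "b \<in> events_of M X"
  then obtain A B where "A \<in> sets borel" "B \<in> sets borel" "a = X -` A \<inter> space M" "b = X -` B \<inter> space M"
    by (auto simp: events_of_def)
  then show "a \<inter> b \<in> events_of M X"
    by (auto simp: events_of_def intro!: exI[of _ "A \<inter> B"])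
qed

lemma subalgebra_trans: "subalgebra M F \<Longrightarrow> subalgebra F G \<Longrightarrow> subalgebra M G"
  by (auto simp: subalgebra_def)

section \<open>Sources of randomness and their independence\<close>

locale lq_model = lq P \<Lambda>0
  for P :: "('n::finite, 'k::finite) lq_data" and \<Lambda>0 :: real +
  fixes N :: "('w, 'n, 'k) shocks"
  assumes shocks: "valid_shocks P N"
begin

abbreviation "M \<equiv> base N"

sublocale prob_space M
  using shocks by (simp add: valid_shocks_def)

definition sources :: "source set" where
  "sources = {Init} \<union> Eps ` {1..horizon P} \<union> Eta ` {1..horizon P} \<union> Vis ` {1..horizon P}"

text \<open>Includes the observation noise for every possible attention. The generated algebra is
  thus the same for all policies, unlike \<open>info\<close>.\<close>

definition past :: "nat \<Rightarrow> source set" where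
  "past t = {Init} \<union> Eps ` {1..t} \<union> Eta ` {1..t} \<union> Vis ` {1..t}"

definition alg :: "source set \<Rightarrow> 'w measure" where
  "alg I = sigma (space M) (\<Union>i\<in>I. source_events N i)"

lemma indep_sources: "indep_sets (source_events N) sources"
  using shocks by (simp add: valid_shocks_def sources_def)

lemma
  assumes "t \<in> {1..horizon P}"
  shows distr_eps: "distr M borel (eps N t) = mvnormal 0 (Sig_eps P)"
    and distr_eta: "distr M borel (eta N t) = mvnormal 0 (Sig_eta P)"
    and distr_vnoise: "l \<in> nonneg \<Longrightarrow> distr M borel (vnoise N t l) = mvnormal 0 (Sig_v P l)"
    and measurable_vnoise: "(\<lambda>(l, \<omega>). vnoise N t l \<omega>) \<in> borel_measurable (borel \<Otimes>\<^sub>M vnoise_algebra N t)"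
  using shocks assms unfolding valid_shocks_def nonneg_def by blast+

lemma source_events_Pow: "source_events N i \<subseteq> Pow (space M)"
proof (cases i)
  case (Vis t)
  have "space (vnoise_algebra N t) = space M" by (simp add: vnoise_algebra_def space_measure_of_conv)
  then show ?thesis using sets.sets_into_space[of _ "vnoise_algebra N t"] by (auto simp: Vis)
qed (auto simp: events_of_def)

lemma space_alg [simp]: "space (alg I) = space M"
  by (simp add: alg_def space_measure_of_conv)

lemma sets_alg: "sets (alg I) = sigma_sets (space M) (\<Union>i\<in>I. source_events N i)"
  unfolding alg_def using source_events_Pow by (intro sets_measure_of) blast

lemma source_sets_alg: "i \<in> I \<Longrightarrow> source_events N i \<subseteq> sets (alg I)"
  unfolding sets_alg by (auto intro: sigma_sets.Basic)

lemma subalgebra_alg_mono: "I \<subseteq> J \<Longrightarrow> subalgebra (alg J) (alg I)"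
  unfolding subalgebra_def by (auto simp: sets_alg intro: sigma_sets_mono' [THEN subsetD, rotated])

lemma subalgebra_alg: "I \<subseteq> sources \<Longrightarrow> subalgebra M (alg I)"
  unfolding subalgebra_def sets_alg
  using indep_sources by (intro conjI space_alg sets.sigma_sets_subset UN_least) (auto simp: indep_sets_def)

lemma Int_stable_source: "Int_stable (source_events N i)"
  by (cases i) (auto simp: sets.Int_stable Int_stable_events_of)

text \<open>Disjoint groups of sources generate independent algebras, so the joint law is a product
  and Fubini applies. The targets \<open>S\<close> and \<open>T\<close> are general so that
  \<open>X\<close> and \<open>Y\<close> can be identity maps, which freezes the entire past.\<close>

lemma nn_integral_indep:
  assumes IJ: "I \<inter> J = {}" "I \<subseteq> sources" "J \<subseteq> sources"
    and X: "X \<in> measurable (alg I) S" and Y: "Y \<in> measurable (alg J) T"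
    and g [measurable]: "g \<in> borel_measurable (S \<Otimes>\<^sub>M T)"
  shows "(\<integral>\<^sup>+\<omega>. g (X \<omega>, Y \<omega>) \<partial>M) = (\<integral>\<^sup>+\<omega>. (\<integral>\<^sup>+\<omega>'. g (X \<omega>, Y \<omega>') \<partial>M) \<partial>M)"
proof -
  have [measurable]: "X \<in> measurable M S" "Y \<in> measurable M T"
    using measurable_from_subalg[OF subalgebra_alg] IJ X Y by blast+
  have "indep_sets (\<lambda>b. sigma_sets (space M) (\<Union>i\<in>case_bool I J b. source_events N i)) UNIV"
  proof (rule indep_sets_collect_sigma)
    show "indep_sets (source_events N) (\<Union>b\<in>UNIV. case_bool I J b)"
      by (rule indep_sets_mono_index[OF _ indep_sources]) (use IJ in \<open>auto split: bool.splits\<close>)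
    show "disjoint_family_on (case_bool I J) UNIV"
      using IJ(1) by (auto simp: disjoint_family_on_def split: bool.splits)
  qed (rule Int_stable_source)
  moreover have "(\<lambda>b. sigma_sets (space M) (\<Union>i\<in>case_bool I J b. source_events N i))
      = case_bool (sets (alg I)) (sets (alg J))"
    by (auto simp: sets_alg fun_eq_iff split: bool.split)
  ultimately have ind: "indep_sets (case_bool (sets (alg I)) (sets (alg J))) UNIV" by simp
  then have mult: "prob (a \<inter> b) = prob a * prob b" if "a \<in> sets (alg I)" "b \<in> sets (alg J)" for a b
    using that by (simp add: indep_sets2_eq flip: indep_set_def)
  have d: "distr M S X \<Otimes>\<^sub>M distr M T Y = distr M (S \<Otimes>\<^sub>M T) (\<lambda>x. (X x, Y x))"
  proof (rule pair_measure_eqI)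
    show "sigma_finite_measure (distr M S X)" "sigma_finite_measure (distr M T Y)"
      by (auto intro!: prob_space_imp_sigma_finite prob_space_distr)
    fix A B assume A: "A \<in> sets (distr M S X)" and B: "B \<in> sets (distr M T Y)"
    have "X -` A \<inter> space M \<in> sets (alg I)" "Y -` B \<inter> space M \<in> sets (alg J)"
      using A B measurable_sets[OF X, of A] measurable_sets[OF Y, of B] by simp_all
    moreover have "(\<lambda>x. (X x, Y x)) -` (A \<times> B) \<inter> space M = (X -` A \<inter> space M) \<inter> (Y -` B \<inter> space M)" by auto
    ultimately show "emeasure (distr M S X) A * emeasure (distr M T Y) B
        = emeasure (distr M (S \<Otimes>\<^sub>M T) (\<lambda>x. (X x, Y x))) (A \<times> B)"
      using A B by (simp add: emeasure_distr emeasure_eq_measure mult ennreal_mult)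
  qed simp
  interpret T: prob_space "distr M T Y" by (rule prob_space_distr) simp
  have "(\<integral>\<^sup>+\<omega>. g (X \<omega>, Y \<omega>) \<partial>M) = (\<integral>\<^sup>+y. g y \<partial>(distr M S X \<Otimes>\<^sub>M distr M T Y))"
    unfolding d by (rule nn_integral_distr[symmetric]) measurable
  also have "\<dots> = (\<integral>\<^sup>+x. (\<integral>\<^sup>+y. g (x, y) \<partial>distr M T Y) \<partial>distr M S X)"
    by (rule T.nn_integral_fst[symmetric]) measurable
  also have "\<dots> = (\<integral>\<^sup>+\<omega>. (\<integral>\<^sup>+y. g (X \<omega>, y) \<partial>distr M T Y) \<partial>M)"
    by (rule nn_integral_distr) (auto intro!: T.borel_measurable_nn_integral)
  also have "\<dots> = (\<integral>\<^sup>+\<omega>. (\<integral>\<^sup>+\<omega>'. g (X \<omega>, Y \<omega>') \<partial>M) \<partial>M)"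
  proof (rule nn_integral_cong)
    fix \<omega> assume "\<omega> \<in> space M"
    then have "X \<omega> \<in> space S" by (rule measurable_space[rotated]) simp
    then show "(\<integral>\<^sup>+y. g (X \<omega>, y) \<partial>distr M T Y) = (\<integral>\<^sup>+\<omega>'. g (X \<omega>, Y \<omega>') \<partial>M)"
      by (intro nn_integral_distr measurable_compose[OF measurable_Pair1' g]) auto
  qed
  finally show ?thesis .
qed

lemma finit_alg: "Init \<in> I \<Longrightarrow> finit N \<in> borel_measurable (alg I)"
  and eps_alg: "Eps t \<in> I \<Longrightarrow> eps N t \<in> borel_measurable (alg I)"
  and eta_alg: "Eta t \<in> I \<Longrightarrow> eta N t \<in> borel_measurable (alg I)"
  using source_sets_alg[of Init I] source_sets_alg[of "Eps t" I] source_sets_alg[of "Eta t" I]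
  by (auto intro!: events_of_measurable[where M = M])

text \<open>The noise at a random attention is the jointly measurable field composed with the pair
  of attention and outcome.\<close>

lemma vnoise_alg:
  assumes "t \<in> {1..horizon P}" "Vis t \<in> I"
    and K: "subalgebra K (alg I)" and L: "L \<in> borel_measurable K"
  shows "(\<lambda>\<omega>. vnoise N t (L \<omega>) \<omega>) \<in> borel_measurable K"
proof -
  have "sets (vnoise_algebra N t) \<subseteq> sets K"
    using source_sets_alg[OF assms(2)] K by (auto simp: subalgebra_def)
  moreover have "space (vnoise_algebra N t) = space K"
    using K by (simp add: vnoise_algebra_def space_measure_of_conv subalgebra_def)
  ultimately have "(\<lambda>\<omega>. \<omega>) \<in> measurable K (vnoise_algebra N t)"
    by (auto intro!: measurableI)
  then have "(\<lambda>\<omega>. (L \<omega>, \<omega>)) \<in> measurable K (borel \<Otimes>\<^sub>M vnoise_algebra N t)"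
    using L by measurable
  from measurable_compose[OF this measurable_vnoise[OF assms(1)]] show ?thesis by simp
qed

text \<open>Independence is used twice: the factor shock is split from the other two, and then those
  are split from each other. The attention is a constant here.\<close>

lemma nn_integral_shocks:
  assumes t: "t \<in> {1..horizon P}" and l: "l \<in> nonneg"
    and g [measurable]: "g \<in> borel_measurable (borel \<Otimes>\<^sub>M (borel \<Otimes>\<^sub>M borel))"
  shows "(\<integral>\<^sup>+\<omega>. g (eta N t \<omega>, vnoise N t l \<omega>, eps N t \<omega>) \<partial>M)
    = shock_integral l 0 (\<lambda>y v e. g (y, v, e))"
proof -
  have e: "eps N t \<in> borel_measurable (alg {Eps t})" "eps N t \<in> borel_measurable (alg {Vis t, Eps t})"
    by (auto intro: eps_alg)
  have y: "eta N t \<in> borel_measurable (alg {Eta t})" by (auto intro: eta_alg)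
  have v: "vnoise N t l \<in> borel_measurable (alg I)" if "Vis t \<in> I" for I
    using vnoise_alg[OF t that, of "alg I" "\<lambda>_. l"] by (simp add: subalgebra_def)
  have sub: "subalgebra M (alg {Vis t})" "subalgebra M (alg {Eps t})" "subalgebra M (alg {Eta t})"
    using t by (auto intro!: subalgebra_alg simp: sources_def)
  have [measurable]: "eps N t \<in> borel_measurable M" "eta N t \<in> borel_measurable M" "vnoise N t l \<in> borel_measurable M"
    using measurable_from_subalg[OF sub(2) e(1)] measurable_from_subalg[OF sub(3) y]
      measurable_from_subalg[OF sub(1) v] by auto
  have "(\<integral>\<^sup>+\<omega>. g (eta N t \<omega>, vnoise N t l \<omega>, eps N t \<omega>) \<partial>M)
      = (\<integral>\<^sup>+\<omega>. (\<integral>\<^sup>+\<omega>'. g (eta N t \<omega>, vnoise N t l \<omega>', eps N t \<omega>') \<partial>M) \<partial>M)"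
    using t by (intro nn_integral_indep[of "{Eta t}" "{Vis t, Eps t}" "eta N t" borel
          "\<lambda>\<omega>. (vnoise N t l \<omega>, eps N t \<omega>)" "borel \<Otimes>\<^sub>M borel" g] y measurable_Pair v e g)
      (auto simp: sources_def)
  also have "\<dots> = (\<integral>\<^sup>+\<omega>. (\<integral>\<^sup>+\<omega>'. (\<integral>\<^sup>+\<omega>''. g (eta N t \<omega>, vnoise N t l \<omega>', eps N t \<omega>'') \<partial>M) \<partial>M) \<partial>M)"
  proof (rule nn_integral_cong)
    fix \<omega>
    have "(\<lambda>p. g (eta N t \<omega>, p)) \<in> borel_measurable (borel \<Otimes>\<^sub>M borel)" by measurable
    then show "(\<integral>\<^sup>+\<omega>'. g (eta N t \<omega>, vnoise N t l \<omega>', eps N t \<omega>') \<partial>M)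
      = (\<integral>\<^sup>+\<omega>'. (\<integral>\<^sup>+\<omega>''. g (eta N t \<omega>, vnoise N t l \<omega>', eps N t \<omega>'') \<partial>M) \<partial>M)"
      using t by (intro nn_integral_indep[of "{Vis t}" "{Eps t}" "vnoise N t l" borel "eps N t" borel
            "\<lambda>p. g (eta N t \<omega>, p)"] v e) (auto simp: sources_def)
  qed
  also have "\<dots> = shock_integral l 0 (\<lambda>y v e. g (y, v, e))"
    unfolding distr_eps[OF t, symmetric] distr_eta[OF t, symmetric] distr_vnoise[OF t l, symmetric]
    using mvnormal.sigma_finite_measure_axioms[of 0 "Sig_eps P"] mvnormal.sigma_finite_measure_axioms[of 0 "Sig_v P l"]
    unfolding distr_eps[OF t, symmetric] distr_vnoise[OF t l, symmetric]
    by (simp add: nn_integral_distr sigma_finite_measure.borel_measurable_nn_integral)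
  finally show ?thesis .
qed

section \<open>Measurability of trajectories under admissible policies\<close>

lemma past_mono: "s \<le> t \<Longrightarrow> past s \<subseteq> past t"
  by (auto simp: past_def)

lemma Init_past: "Init \<in> past t"
  and Eps_past: "i \<in> {1..t} \<Longrightarrow> Eps i \<in> past t"
  and Eta_past: "i \<in> {1..t} \<Longrightarrow> Eta i \<in> past t"
  and Vis_past: "i \<in> {1..t} \<Longrightarrow> Vis i \<in> past t"
  by (auto simp: past_def)

lemmas past_alg = finit_alg[OF Init_past] eps_alg[OF Eps_past] eta_alg[OF Eta_past]

lemma past_sources: "t \<le> horizon P \<Longrightarrow> past t \<subseteq> sources"
  by (auto simp: past_def sources_def)

lemma measurable_past_mono:
  "X \<in> borel_measurable (alg (past s)) \<Longrightarrow> s \<le> t \<Longrightarrow> X \<in> borel_measurable (alg (past t))"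
  using measurable_from_subalg[OF subalgebra_alg_mono[OF past_mono]] by blast

lemma measurable_past: "X \<in> borel_measurable (alg (past t)) \<Longrightarrow> t \<le> horizon P \<Longrightarrow> X \<in> borel_measurable M"
  using measurable_from_subalg[OF subalgebra_alg[OF past_sources]] by blast

lemma measurable_factor_of:
  assumes "space F = space M" "finit N \<in> borel_measurable F" "\<And>i. i \<in> {1..t} \<Longrightarrow> eta N i \<in> borel_measurable F"
  shows "factor P N t \<in> borel_measurable F"
  using assms(3)
proof (induction t)
  case 0
  have "factor P N 0 = finit N" by (simp add: fun_eq_iff)
  then show ?case using assms(2) by simp
next
  case (Suc t)
  then have [measurable]: "factor P N t \<in> borel_measurable F" "eta N (Suc t) \<in> borel_measurable F" by auto
  have "factor P N (Suc t) = (\<lambda>\<omega>. (mat 1 - Phi P) *v factor P N t \<omega> + eta N (Suc t) \<omega>)"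
    by (simp add: fun_eq_iff)
  then show ?case by simp
qed

lemma factor_past: "factor P N t \<in> borel_measurable (alg (past t))"
  by (rule measurable_factor_of) (simp, rule past_alg, rule past_alg)

lemma space_info [simp]: "space (info P N lam t) = space M"
  and space_info_plus [simp]: "space (info_plus P N lam t) = space M"
  by (simp_all add: info_def info_plus_def space_measure_of_conv)

lemma
  shows info_finit: "finit N \<in> borel_measurable (info P N lam t)"
    and info_eps: "i \<in> {1..t} \<Longrightarrow> eps N i \<in> borel_measurable (info P N lam t)"
    and info_eta: "i \<in> {1..t} \<Longrightarrow> eta N i \<in> borel_measurable (info P N lam t)"
    and info_sig: "i < t \<Longrightarrow> sig P N lam i \<in> borel_measurable (info P N lam t)"
proof -
  let ?G = "events_of (base N) (finit N) \<union>
      (\<Union>i\<in>{1..t}. events_of (base N) (eps N i) \<union> events_of (base N) (eta N i)) \<union>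
      (\<Union>i<t. events_of (base N) (sig P N lam i))"
  have "?G \<subseteq> Pow (space M)" by (auto simp: events_of_def)
  then have *: "?G \<subseteq> sets (info P N lam t)"
    unfolding info_def by (rule subset_sets_sigma)
  show "finit N \<in> borel_measurable (info P N lam t)"
    "i \<in> {1..t} \<Longrightarrow> eps N i \<in> borel_measurable (info P N lam t)"
    "i \<in> {1..t} \<Longrightarrow> eta N i \<in> borel_measurable (info P N lam t)"
    "i < t \<Longrightarrow> sig P N lam i \<in> borel_measurable (info P N lam t)"
    by (intro events_of_measurable[where M = M] space_info; use * in blast)+
qed

lemma
  shows info_plus_sig: "sig P N lam t \<in> borel_measurable (info_plus P N lam t)"
    and info_plus_info: "subalgebra (info_plus P N lam t) (info P N lam t)"
proof -
  let ?G = "sets (info P N lam t) \<union> events_of (base N) (sig P N lam t)"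
  have "?G \<subseteq> Pow (space M)" using sets.sets_into_space[of _ "info P N lam t"] by (auto simp: events_of_def)
  then have *: "?G \<subseteq> sets (info_plus P N lam t)"
    unfolding info_plus_def by (rule subset_sets_sigma)
  then show "sig P N lam t \<in> borel_measurable (info_plus P N lam t)"
    by (intro events_of_measurable[where M = M]) auto
  show "subalgebra (info_plus P N lam t) (info P N lam t)"
    using * by (auto simp: subalgebra_def)
qed

lemma subalgebra_info_of:
  assumes "space F = space M" "finit N \<in> borel_measurable F"
    "\<And>i. i \<in> {1..t} \<Longrightarrow> eps N i \<in> borel_measurable F" "\<And>i. i \<in> {1..t} \<Longrightarrow> eta N i \<in> borel_measurable F"
    "\<And>i. i < t \<Longrightarrow> sig P N lam i \<in> borel_measurable F"
  shows "subalgebra F (info P N lam t)"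
  unfolding info_def
  by (rule sigma_subalgebra[OF assms(1)]) (use measurable_events_of[OF assms(1)] assms in \<open>intro Un_least UN_least; blast\<close>)

lemma subalgebra_info_plus_of:
  assumes "subalgebra F (info P N lam t)" "sig P N lam t \<in> borel_measurable F"
  shows "subalgebra F (info_plus P N lam t)"
proof -
  have "space F = space M" using assms(1) by (simp add: subalgebra_def)
  then show ?thesis
    unfolding info_plus_def
    by (intro sigma_subalgebra) (use assms measurable_events_of[of F M] in \<open>auto simp: subalgebra_def\<close>)
qed

lemma info_mono: "subalgebra (info P N lam (Suc t)) (info_plus P N lam t)"
  by (intro subalgebra_info_plus_of subalgebra_info_of info_sig) (auto intro: info_finit info_eps info_eta info_sig)

lemma sig_past:
  assumes t: "t < horizon P" and lam: "lam t \<in> borel_measurable (alg (past t))"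
  shows "sig P N lam t \<in> borel_measurable (alg (past (Suc t)))"
proof -
  have [measurable]: "lam t \<in> borel_measurable (alg (past (Suc t)))"
    using measurable_past_mono[OF lam] by simp
  have [measurable]: "(\<lambda>\<omega>. vnoise N (Suc t) (lam t \<omega>) \<omega>) \<in> borel_measurable (alg (past (Suc t)))"
    using t by (intro vnoise_alg[OF _ Vis_past[of "Suc t" "Suc t"]]) (simp_all add: subalgebra_def)
  have [measurable]: "factor P N (Suc t) \<in> borel_measurable (alg (past (Suc t)))" by (rule factor_past)
  show ?thesis unfolding sig_def[abs_def] by measurable
qed

text \<open>The definitions are intertwined: \<open>info\<close> is generated by signals that depend
  on earlier attention, which in turn is measurable for earlier \<open>info\<close>. Strong
  induction on time unravels this, since period \<open>t\<close> involves only signals of earlier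
  periods.\<close>

lemma admissible_past:
  assumes adm: "admissible P N \<Lambda>0 lam u"
  shows "t < horizon P \<Longrightarrow> lam t \<in> borel_measurable (alg (past t))"
    and "t \<le> horizon P \<Longrightarrow> subalgebra (alg (past t)) (info P N lam t)"
proof -
  have "(t \<le> horizon P \<longrightarrow> subalgebra (alg (past t)) (info P N lam t)) \<and>
      (t < horizon P \<longrightarrow> lam t \<in> borel_measurable (alg (past t)))" for t
  proof (induction t rule: less_induct)
    case (less t)
    have sub: "subalgebra (alg (past t)) (info P N lam t)" if "t \<le> horizon P"
    proof (rule subalgebra_info_of)
      show "sig P N lam i \<in> borel_measurable (alg (past t))" if "i < t" for i
        using sig_past[of i lam] less.IH[OF that] that \<open>t \<le> horizon P\<close> by (auto intro: measurable_past_mono[of _ "Suc i"])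
    qed (simp, (rule past_alg; assumption)+)
    moreover have "lam t \<in> borel_measurable (alg (past t))" if "t < horizon P"
      using measurable_from_subalg[OF sub] adm that by (auto simp: admissible_def)
    ultimately show ?case by blast
  qed
  then show "t < horizon P \<Longrightarrow> lam t \<in> borel_measurable (alg (past t))"
    "t \<le> horizon P \<Longrightarrow> subalgebra (alg (past t)) (info P N lam t)" by blast+
qed

lemma measurable_budget_of:
  assumes "\<And>i. i < t \<Longrightarrow> lam i \<in> borel_measurable F"
  shows "budget \<Lambda>0 lam t \<in> borel_measurable F"
  using assms
proof (induction t)
  case 0
  have "budget \<Lambda>0 lam 0 = (\<lambda>_. \<Lambda>0)" by (simp add: fun_eq_iff)
  then show ?case by simp
next
  case (Suc t)
  then have [measurable]: "budget \<Lambda>0 lam t \<in> borel_measurable F" "lam t \<in> borel_measurable F" by auto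
  have "budget \<Lambda>0 lam (Suc t) = (\<lambda>\<omega>. budget \<Lambda>0 lam t \<omega> - (\<Sum>j\<in>UNIV. lam t \<omega> $ j))"
    by (simp add: fun_eq_iff)
  then show ?case by simp
qed

lemma measurable_state_of:
  assumes "space F = space M" "finit N \<in> borel_measurable F"
    "\<And>i. i \<in> {1..t} \<Longrightarrow> eps N i \<in> borel_measurable F" "\<And>i. i \<in> {1..t} \<Longrightarrow> eta N i \<in> borel_measurable F"
    "\<And>i. i < t \<Longrightarrow> u i \<in> borel_measurable F"
  shows "state P N x0 u t \<in> borel_measurable F"
  using assms
proof (induction t)
  case 0
  have "state P N x0 u 0 = (\<lambda>_. x0)" by (simp add: fun_eq_iff)
  then show ?case by simp
next
  case (Suc t)
  then have [measurable]: "state P N x0 u t \<in> borel_measurable F" "u t \<in> borel_measurable F"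
    "eps N (Suc t) \<in> borel_measurable F" by auto
  have [measurable]: "factor P N (Suc t) \<in> borel_measurable F"
    using Suc.prems by (intro measurable_factor_of) auto
  have "state P N x0 u (Suc t) = (\<lambda>\<omega>. acoef P (Suc t) * state P N x0 u t \<omega>
      + (cvec P + Dmat P *v factor P N (Suc t) \<omega> + eps N (Suc t) \<omega>) \<bullet> u t \<omega>)"
    by (simp add: fun_eq_iff bvec_def)
  then show ?case by (simp del: factor.simps)
qed

lemma admissible_control_past:
  assumes adm: "admissible P N \<Lambda>0 lam u" and t: "t < horizon P"
  shows "u t \<in> borel_measurable (alg (past (Suc t)))"
proof -
  have "subalgebra (alg (past (Suc t))) (info_plus P N lam t)"
    using subalgebra_trans[OF admissible_past(2)[OF adm, of "Suc t"] info_mono] t by simp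
  moreover have "u t \<in> borel_measurable (info_plus P N lam t)" using adm t by (simp add: admissible_def)
  ultimately show ?thesis by (rule measurable_from_subalg)
qed

lemma admissible_state_past:
  assumes adm: "admissible P N \<Lambda>0 lam u" and t: "t \<le> horizon P"
  shows "state P N x0 u t \<in> borel_measurable (alg (past t))"
proof (rule measurable_state_of)
  show "u i \<in> borel_measurable (alg (past t))" if "i < t" for i
    using measurable_past_mono[OF admissible_control_past[OF adm, of i], of t] t that by simp
qed (simp, (rule past_alg; assumption)+)

lemma admissible_budget_past:
  assumes adm: "admissible P N \<Lambda>0 lam u" and t: "t \<le> horizon P"
  shows "budget \<Lambda>0 lam t \<in> borel_measurable (alg (past t))"
  by (rule measurable_budget_of) (use t in \<open>auto intro!: measurable_past_mono[OF admissible_past(1)[OF adm]]\<close>)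

lemma budget_range:
  fixes lam :: "nat \<Rightarrow> 'w \<Rightarrow> real^'k"
  assumes "\<And>i. i < t \<Longrightarrow> lam i \<omega> \<in> allocations (budget \<Lambda>0 lam i \<omega>)"
  shows "budget \<Lambda>0 lam t \<omega> \<in> {0..\<Lambda>0}"
  using assms
proof (induction t)
  case 0
  then show ?case using \<Lambda>0 by simp
next
  case (Suc t)
  then show ?case using rem_range[of "budget \<Lambda>0 lam t \<omega>" "lam t \<omega>"] by (simp add: rem_def)
qed

text \<open>To average over the next shocks with the past frozen, the control must be an explicit
  function of the past outcome and the signal. Doob-Dynkin supplies it, because pulling back along
  that pair yields an algebra containing \<open>info_plus\<close>.\<close>

lemma control_factor:
  assumes adm: "admissible P N \<Lambda>0 lam u" and t: "t < horizon P"
  shows "\<exists>\<phi>\<in>borel_measurable (alg (past t) \<Otimes>\<^sub>M borel). \<forall>\<omega>\<in>space M. u t \<omega> = \<phi> (\<omega>, sig P N lam t \<omega>)"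
proof -
  let ?g = "\<lambda>\<omega>. (\<omega>, sig P N lam t \<omega>)" and ?N = "alg (past t) \<Otimes>\<^sub>M (borel :: (real^'k) measure)"
  let ?V = "vimage_algebra (space M) ?g ?N"
  have g: "?g \<in> space M \<rightarrow> space ?N" by (auto simp: space_pair_measure)
  have gm: "?g \<in> measurable ?V ?N" by (rule measurable_vimage_algebra1[OF g])
  have sp: "space ?V = space M" by simp
  have "sig P N lam t \<in> borel_measurable ?V"
    using measurable_compose[OF gm measurable_snd] by simp
  moreover have "subalgebra ?V (info P N lam t)"
  proof -
    \<comment> \<open>Measurability of the identity says that the pulled-back algebra contains all
      past events.\<close>
    have "(\<lambda>\<omega>. \<omega>) \<in> measurable ?V (alg (past t))"
      using measurable_compose[OF gm measurable_fst] by simp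
    then have "sets (alg (past t)) \<subseteq> sets ?V"
      using measurable_sets[of "\<lambda>\<omega>. \<omega>" ?V "alg (past t)"] sets.sets_into_space[of _ "alg (past t)"]
      by (fastforce simp: Int_absorb2)
    then show ?thesis
      using admissible_past(2)[OF adm, of t] t by (auto simp: subalgebra_def)
  qed
  ultimately have "subalgebra ?V (info_plus P N lam t)"
    by (intro subalgebra_info_plus_of)
  then have "u t \<in> borel_measurable ?V"
    by (rule measurable_from_subalg) (use adm t in \<open>simp add: admissible_def\<close>)
  from measurable_factor[OF this g] show ?thesis .
qed

end


section \<open>The cost-to-go process\<close>

text \<open>Values may be infinite, so nothing is subtracted. Instead, the maximum of
  \<open>J\<close> and the conditional expectation is shown to have the integrals of
  \<open>g\<close> over all events of \<open>F\<close>; by uniqueness it is the conditional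
  expectation.\<close>

lemma (in sigma_finite_subalgebra) nn_cond_exp_ge:
  assumes J [measurable]: "J \<in> borel_measurable F" and g [measurable]: "g \<in> borel_measurable M"
    and le: "\<And>A. A \<in> sets F \<Longrightarrow> (\<integral>\<^sup>+x\<in>A. J x \<partial>M) \<le> (\<integral>\<^sup>+x\<in>A. g x \<partial>M)"
  shows "AE x in M. J x \<le> nn_cond_exp M F g x"
proof -
  let ?n = "nn_cond_exp M F g" and ?K = "\<lambda>x. max (J x) (nn_cond_exp M F g x)"
  have JM [measurable]: "J \<in> borel_measurable M"
    by (rule measurable_from_subalg[OF subalg J])
  have n [measurable]: "?n \<in> borel_measurable F" "?n \<in> borel_measurable M"
    by (auto intro: borel_measurable_nn_cond_exp borel_measurable_nn_cond_exp2)
  have sp: "space F = space M" and sub: "\<And>A. A \<in> sets F \<Longrightarrow> A \<in> sets M"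
    using subalg by (auto simp: subalgebra_def)
  have ng: "(\<integral>\<^sup>+x\<in>A. ?n x \<partial>M) = (\<integral>\<^sup>+x\<in>A. g x \<partial>M)" if "A \<in> sets F" for A
    using nn_cond_exp_intg[of "indicator A" g] that by (simp add: mult.commute)
  \<comment> \<open>Where the claim fails. The maximum is \<open>J\<close> on this event, where
    \<open>le\<close> applies, and the conditional expectation off it.\<close>
  define B where "B = {x \<in> space F. ?n x < J x}"
  have B: "B \<in> sets F" unfolding B_def by measurable
  have "(\<integral>\<^sup>+x\<in>A. g x \<partial>M) = (\<integral>\<^sup>+x\<in>A. ?K x \<partial>M)" if A: "A \<in> sets F" for A
  proof (rule antisym)
    have "(\<integral>\<^sup>+x\<in>A. g x \<partial>M) = (\<integral>\<^sup>+x\<in>A. ?n x \<partial>M)" using ng[OF A] by simp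
    also have "\<dots> \<le> (\<integral>\<^sup>+x\<in>A. ?K x \<partial>M)" by (intro nn_integral_mono mult_right_mono) auto
    finally show "(\<integral>\<^sup>+x\<in>A. g x \<partial>M) \<le> (\<integral>\<^sup>+x\<in>A. ?K x \<partial>M)" .
    have AB: "A \<inter> B \<in> sets F" "A - B \<in> sets F" using A B by auto
    note [measurable] = sub[OF AB(1)] sub[OF AB(2)]
    have "(\<integral>\<^sup>+x\<in>A. ?K x \<partial>M) = (\<integral>\<^sup>+x. J x * indicator (A \<inter> B) x + ?n x * indicator (A - B) x \<partial>M)"
      by (intro nn_integral_cong) (auto simp: B_def sp indicator_def max_def)
    also have "\<dots> = (\<integral>\<^sup>+x\<in>A \<inter> B. J x \<partial>M) + (\<integral>\<^sup>+x\<in>A - B. ?n x \<partial>M)"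
      by (rule nn_integral_add) measurable
    also have "\<dots> \<le> (\<integral>\<^sup>+x\<in>A \<inter> B. g x \<partial>M) + (\<integral>\<^sup>+x\<in>A - B. g x \<partial>M)"
      using le[OF AB(1)] ng[OF AB(2)] by (intro add_mono) auto
    also have "\<dots> = (\<integral>\<^sup>+x. g x * indicator (A \<inter> B) x + g x * indicator (A - B) x \<partial>M)"
      by (rule nn_integral_add[symmetric]) measurable
    also have "\<dots> = (\<integral>\<^sup>+x\<in>A. g x \<partial>M)"
      by (intro nn_integral_cong) (auto simp: indicator_def)
    finally show "(\<integral>\<^sup>+x\<in>A. ?K x \<partial>M) \<le> (\<integral>\<^sup>+x\<in>A. g x \<partial>M)" .
  qed
  then have "AE x in M. ?K x = ?n x"
    by (intro nn_cond_exp_charact) auto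
  then show ?thesis by eventually_elim (metis max.cobounded1)
qed

context lq_model begin

text \<open>Clamping the budget to \<open>[0, \<Lambda>0]\<close>, where \<open>hfun\<close> is continuous, makes \<open>hc\<close> measurable everywhere.\<close>

definition hc :: "nat \<Rightarrow> real \<Rightarrow> real^'k \<Rightarrow> real" where
  "hc t \<Lambda> f = hfun P t (max 0 (min \<Lambda>0 \<Lambda>)) f"

lemma hc_eq: "\<Lambda> \<in> {0..\<Lambda>0} \<Longrightarrow> hc t \<Lambda> f = hfun P t \<Lambda> f"
  by (simp add: hc_def)

lemma hc_nonneg: "0 \<le> hc t \<Lambda> f"
  using nice_hfun[of t] \<Lambda>0 by (auto simp: nice_def hc_def intro!: less_imp_le)

lemma measurable_hc [measurable (raw)]:
  assumes "\<Lambda> \<in> borel_measurable F" "f \<in> borel_measurable F"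
  shows "(\<lambda>\<omega>. hc t (\<Lambda> \<omega>) (f \<omega>)) \<in> borel_measurable F"
proof -
  have "(\<lambda>\<omega>. (\<lambda>(\<Lambda>, f). hfun P t \<Lambda> f) (max 0 (min \<Lambda>0 (\<Lambda> \<omega>)), f \<omega>)) \<in> borel_measurable F"
    by (rule borel_measurable_continuous_on_compose) (use nice_hfun[of t] assms \<Lambda>0 in \<open>auto simp: nice_def\<close>)
  then show ?thesis by (simp add: hc_def)
qed

lemma measurable_cost [measurable (raw)]:
  assumes [measurable]: "x \<in> borel_measurable F" "u \<in> borel_measurable F"
  shows "(\<lambda>\<omega>. cost t (x \<omega>) (u \<omega>)) \<in> borel_measurable F"
  unfolding cost_def by measurable

definition running where
  "running x0 u t \<omega> = (\<Sum>i<t. cost i (state P N x0 u i \<omega>) (u i \<omega>))"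

definition togo where
  "togo x0 lam u t \<omega> = running x0 u t \<omega>
    + hc t (budget \<Lambda>0 lam t \<omega>) (factor P N t \<omega>) * (state P N x0 u t \<omega>)\<^sup>2"

lemma running_nonneg: "t \<le> horizon P \<Longrightarrow> 0 \<le> running x0 u t \<omega>"
  unfolding running_def by (intro sum_nonneg cost_nonneg) auto

lemma running_past:
  assumes adm: "admissible P N \<Lambda>0 lam u" and t: "t \<le> horizon P"
  shows "running x0 u t \<in> borel_measurable (alg (past t))"
  unfolding running_def[abs_def]
proof (intro borel_measurable_sum measurable_cost)
  fix i assume "i \<in> {..<t}"
  then show "state P N x0 u i \<in> borel_measurable (alg (past t))" "u i \<in> borel_measurable (alg (past t))"
    using measurable_past_mono[OF admissible_state_past[OF adm, of i], of t]
      measurable_past_mono[OF admissible_control_past[OF adm, of i], of t] t by auto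
qed

lemma admissible_budget_range:
  assumes adm: "admissible P N \<Lambda>0 lam u" and t: "t \<le> horizon P" and \<omega>: "\<omega> \<in> space M"
  shows "budget \<Lambda>0 lam t \<omega> \<in> {0..\<Lambda>0}"
  by (rule budget_range) (use assms in \<open>auto simp: admissible_def\<close>)

text \<open>Both parts come from one identity: the integral of the next \<open>togo\<close> is an
  integral over the past of the cost so far plus the one-stage integral \<open>I\<close>. The
  Bellman relation then compares \<open>I\<close> with the current value, outcome by
  outcome.\<close>

lemma
  assumes adm: "admissible P N \<Lambda>0 lam u" and t: "t < horizon P"
    and \<phi>: "\<phi> \<in> borel_measurable (alg (past t) \<Otimes>\<^sub>M borel)"
    and u: "\<And>\<omega>. \<omega> \<in> space M \<Longrightarrow> u t \<omega> = \<phi> (\<omega>, sig P N lam t \<omega>)"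
    and A: "A \<in> sets (alg (past t))"
  shows togo_step_le: "(\<integral>\<^sup>+\<omega>\<in>A. ennreal (togo x0 lam u t \<omega>) \<partial>M) \<le> (\<integral>\<^sup>+\<omega>\<in>A. ennreal (togo x0 lam u (Suc t) \<omega>) \<partial>M)"
    and togo_step_eq: "(\<And>\<omega> s. \<omega> \<in> space M \<Longrightarrow> \<phi> (\<omega>, s) = - (state P N x0 u t \<omega> *\<^sub>R
          lq_stage.ctrl P (hfun P (Suc t)) t (budget \<Lambda>0 lam t \<omega>, lam t \<omega>, post_mean P (factor P N t \<omega>) (lam t \<omega>) s))) \<Longrightarrow>
        (\<And>\<omega>. \<omega> \<in> space M \<Longrightarrow> stage_objective P t (hfun P (Suc t)) (budget \<Lambda>0 lam t \<omega>) (factor P N t \<omega>) (lam t \<omega>)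
          = hfun P t (budget \<Lambda>0 lam t \<omega>) (factor P N t \<omega>)) \<Longrightarrow>
        (\<integral>\<^sup>+\<omega>\<in>A. ennreal (togo x0 lam u (Suc t) \<omega>) \<partial>M) = (\<integral>\<^sup>+\<omega>\<in>A. ennreal (togo x0 lam u t \<omega>) \<partial>M)"
proof -
  interpret S: lq_stage P \<Lambda>0 "hfun P (Suc t)" t by (rule lq_stage_hfun[OF t])
  define x where "x = state P N x0 u t"
  define \<Lambda> where "\<Lambda> = budget \<Lambda>0 lam t"
  define f where "f = factor P N t"
  define l where "l = lam t"
  define C where "C = running x0 u t"
  have t1: "Suc t \<in> {1..horizon P}" and tle: "t \<le> horizon P" using t by auto
  have x_m [measurable]: "x \<in> borel_measurable (alg (past t))" and \<Lambda>_m [measurable]: "\<Lambda> \<in> borel_measurable (alg (past t))"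
    and f_m [measurable]: "f \<in> borel_measurable (alg (past t))" and l_m [measurable]: "l \<in> borel_measurable (alg (past t))"
    and C_m [measurable]: "C \<in> borel_measurable (alg (past t))"
    unfolding x_def \<Lambda>_def f_def l_def C_def
    using admissible_state_past[OF adm] admissible_budget_past[OF adm] factor_past admissible_past(1)[OF adm t]
      running_past[OF adm] t by auto
  note [measurable] = \<phi> A
  have \<Lambda>r: "\<Lambda> \<omega> \<in> {0..\<Lambda>0}" and lr: "l \<omega> \<in> allocations (\<Lambda> \<omega>)" if "\<omega> \<in> space M" for \<omega>
    unfolding \<Lambda>_def l_def using admissible_budget_range[OF adm _ that] adm t that by (auto simp: admissible_def)
  define Q where "Q = (\<lambda>\<omega> f' s e. cost t (x \<omega>) (\<phi> (\<omega>, s)) + hc (Suc t) (rem (\<Lambda> \<omega>) (l \<omega>)) f' *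
      (acoef P (Suc t) * x \<omega> + (cvec P + Dmat P *v f' + e) \<bullet> \<phi> (\<omega>, s))\<^sup>2)"
  have Qnn: "0 \<le> Q \<omega> f' s e" for \<omega> f' s e
    unfolding Q_def using hc_nonneg cost_nonneg[OF t] by simp
  \<comment> \<open>The next \<open>togo\<close> restricted to \<open>A\<close>, with the past
    outcome and the three new shocks as separate arguments.\<close>
  define \<Phi> where "\<Phi> = (\<lambda>(\<omega>, y, v, e). (ennreal (C \<omega>) + ennreal (Q \<omega> (prior_mean P (f \<omega>) + y)
      (signal (l \<omega>) (prior_mean P (f \<omega>) + y) v) e)) * indicator A \<omega>)"
  have \<Phi>_m [measurable]: "\<Phi> \<in> borel_measurable (alg (past t) \<Otimes>\<^sub>M (borel \<Otimes>\<^sub>M (borel \<Otimes>\<^sub>M borel)))"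
    unfolding \<Phi>_def Q_def rem_def prior_mean_def by measurable
  let ?J = "{Eta (Suc t), Vis (Suc t), Eps (Suc t)}"
  \<comment> \<open>Two outcomes are kept apart: \<open>\<omega>\<close> determines the past,
    including the attention at which the noise field is evaluated, and \<open>\<omega>'\<close> only
    the new shocks. The diagonal is the actual trajectory.\<close>
  define \<Psi> where "\<Psi> = (\<lambda>(\<omega>, \<omega>'). \<Phi> (\<omega>, eta N (Suc t) \<omega>', vnoise N (Suc t) (l \<omega>) \<omega>', eps N (Suc t) \<omega>'))"
  have [measurable]: "eta N (Suc t) \<in> borel_measurable (alg ?J)" "eps N (Suc t) \<in> borel_measurable (alg ?J)"
    by (auto intro: eta_alg eps_alg)
  have vis: "(\<lambda>\<omega>. \<omega>) \<in> measurable (alg ?J) (vnoise_algebra N (Suc t))"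
    using source_sets_alg[of "Vis (Suc t)" ?J] sets.sets_into_space[of _ "vnoise_algebra N (Suc t)"]
    by (intro measurableI) (auto simp: vnoise_algebra_def space_measure_of_conv Int_absorb2)
  have "(\<lambda>p. (l (fst p), snd p)) \<in> measurable (alg (past t) \<Otimes>\<^sub>M alg ?J) (borel \<Otimes>\<^sub>M vnoise_algebra N (Suc t))"
    using measurable_compose[OF measurable_fst l_m] measurable_compose[OF measurable_snd vis] by (rule measurable_Pair)
  from measurable_compose[OF this measurable_vnoise[OF t1]]
  have [measurable]: "(\<lambda>p. vnoise N (Suc t) (l (fst p)) (snd p)) \<in> borel_measurable (alg (past t) \<Otimes>\<^sub>M alg ?J)"
    by simp
  have \<Psi>_m: "\<Psi> \<in> borel_measurable (alg (past t) \<Otimes>\<^sub>M alg ?J)"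
    unfolding \<Psi>_def case_prod_beta by measurable
  have "(\<integral>\<^sup>+\<omega>\<in>A. ennreal (togo x0 lam u (Suc t) \<omega>) \<partial>M) = (\<integral>\<^sup>+\<omega>. \<Psi> (\<omega>, \<omega>) \<partial>M)"
  proof (rule nn_integral_cong)
    fix \<omega> assume \<omega>: "\<omega> \<in> space M"
    have f': "prior_mean P (f \<omega>) + eta N (Suc t) \<omega> = factor P N (Suc t) \<omega>"
      by (simp add: prior_mean_def f_def)
    have s': "signal (l \<omega>) (factor P N (Suc t) \<omega>) (vnoise N (Suc t) (l \<omega>) \<omega>) = sig P N lam t \<omega>"
      by (simp add: sig_def l_def)
    have "togo x0 lam u (Suc t) \<omega> = C \<omega> + Q \<omega> (factor P N (Suc t) \<omega>) (sig P N lam t \<omega>) (eps N (Suc t) \<omega>)"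
      unfolding togo_def running_def Q_def C_def x_def \<Lambda>_def l_def rem_def
      by (simp add: u[OF \<omega>] bvec_def del: factor.simps)
    moreover have "0 \<le> C \<omega>" unfolding C_def by (rule running_nonneg[OF tle])
    ultimately show "ennreal (togo x0 lam u (Suc t) \<omega>) * indicator A \<omega> = \<Psi> (\<omega>, \<omega>)"
      unfolding \<Psi>_def \<Phi>_def using Qnn by (simp add: f' s' del: factor.simps)
  qed
  \<comment> \<open>Independence decouples the two outcomes, with identity maps into the algebras of
    the past and of the new shocks.\<close>
  also have "\<dots> = (\<integral>\<^sup>+\<omega>. (\<integral>\<^sup>+\<omega>'. \<Psi> (\<omega>, \<omega>') \<partial>M) \<partial>M)"
    by (rule nn_integral_indep[of "past t" ?J "\<lambda>\<omega>. \<omega>" "alg (past t)" "\<lambda>\<omega>. \<omega>" "alg ?J" \<Psi>])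
      (use past_sources[OF tle] t \<Psi>_m in \<open>auto simp: past_def sources_def\<close>)
  finally have next_eq: "(\<integral>\<^sup>+\<omega>\<in>A. ennreal (togo x0 lam u (Suc t) \<omega>) \<partial>M) = (\<integral>\<^sup>+\<omega>. (\<integral>\<^sup>+\<omega>'. \<Psi> (\<omega>, \<omega>') \<partial>M) \<partial>M)" .
  define I where "I = (\<lambda>\<omega>. shock_integral (l \<omega>) (prior_mean P (f \<omega>))
    (\<lambda>f' v e. ennreal (Q \<omega> f' (signal (l \<omega>) f' v) e)))"
  have inner: "(\<integral>\<^sup>+\<omega>'. \<Psi> (\<omega>, \<omega>') \<partial>M) = (ennreal (C \<omega>) + I \<omega>) * indicator A \<omega>" if \<omega>: "\<omega> \<in> space M" for \<omega>
  proof -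
    have ln: "l \<omega> \<in> nonneg" by (rule allocations_nonneg[OF lr[OF \<omega>]])
    have \<omega>p: "\<omega> \<in> space (alg (past t))" using \<omega> by simp
    have [measurable]: "(\<lambda>s. \<phi> (\<omega>, s)) \<in> borel_measurable borel"
      by (rule measurable_compose[OF measurable_Pair1'[OF \<omega>p] \<phi>])
    define U where "U = (\<lambda>s. \<phi> (\<omega>, s))"
    have U [measurable]: "U \<in> borel_measurable borel" unfolding U_def by measurable
    have Qm: "(\<lambda>(f', v, e). ennreal (Q \<omega> f' (signal (l \<omega>) f' v) e)) \<in> borel_measurable (borel \<Otimes>\<^sub>M (borel \<Otimes>\<^sub>M borel))"
      unfolding Q_def U_def[symmetric, THEN fun_cong] by measurable
    define R where "R = (\<lambda>(f', v, e). ennreal (Q \<omega> f' (signal (l \<omega>) f' v) e))"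
    have R [measurable]: "R \<in> borel_measurable (borel \<Otimes>\<^sub>M (borel \<Otimes>\<^sub>M borel))" using Qm by (simp add: R_def)
    have "(\<integral>\<^sup>+\<omega>'. \<Psi> (\<omega>, \<omega>') \<partial>M) = (\<integral>\<^sup>+\<omega>'. (\<lambda>q. \<Phi> (\<omega>, q)) (eta N (Suc t) \<omega>', vnoise N (Suc t) (l \<omega>) \<omega>', eps N (Suc t) \<omega>') \<partial>M)"
      by (simp add: \<Psi>_def)
    also have "\<dots> = shock_integral (l \<omega>) 0 (\<lambda>y v e. \<Phi> (\<omega>, y, v, e))"
      by (rule nn_integral_shocks[OF t1 ln]) (rule measurable_compose[OF measurable_Pair1'[OF \<omega>p] \<Phi>_m])
    also have "\<dots> = shock_integral (l \<omega>) 0 (\<lambda>y v e. (ennreal (C \<omega>) + R (prior_mean P (f \<omega>) + y, v, e)) * indicator A \<omega>)"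
      by (simp add: \<Phi>_def R_def)
    also have "\<dots> = (ennreal (C \<omega>) + I \<omega>) * indicator A \<omega>"
      unfolding shock_integral_affine[OF R] by (simp add: I_def R_def)
    finally show ?thesis .
  qed
  have I_eq: "I \<omega> = shock_integral (l \<omega>) (prior_mean P (f \<omega>)) (\<lambda>f' v e. ennreal (cost t (x \<omega>) (\<phi> (\<omega>, signal (l \<omega>) f' v)) +
      hfun P (Suc t) (rem (\<Lambda> \<omega>) (l \<omega>)) f' *
        (acoef P (Suc t) * x \<omega> + (cvec P + Dmat P *v f' + e) \<bullet> \<phi> (\<omega>, signal (l \<omega>) f' v))\<^sup>2))"
    if \<omega>: "\<omega> \<in> space M" for \<omega>
    unfolding I_def Q_def by (simp only: hc_eq[OF rem_range[OF \<Lambda>r[OF \<omega>] lr[OF \<omega>]]])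
  have \<phi>_sec: "(\<lambda>s. \<phi> (\<omega>, s)) \<in> borel_measurable borel" if "\<omega> \<in> space M" for \<omega>
    using that by (intro measurable_compose[OF measurable_Pair1' \<phi>]) simp
  let ?so = "\<lambda>\<omega>. stage_objective P t (hfun P (Suc t)) (\<Lambda> \<omega>) (f \<omega>) (l \<omega>)"
  have togo_eq: "ennreal (togo x0 lam u t \<omega>) = ennreal (C \<omega>) + ennreal ((x \<omega>)\<^sup>2 * hfun P t (\<Lambda> \<omega>) (f \<omega>))"
    if \<omega>: "\<omega> \<in> space M" for \<omega>
  proof -
    have "togo x0 lam u t \<omega> = C \<omega> + (x \<omega>)\<^sup>2 * hfun P t (\<Lambda> \<omega>) (f \<omega>)"
      unfolding togo_def C_def x_def f_def \<Lambda>_def using hc_eq[OF \<Lambda>r[OF \<omega>, unfolded \<Lambda>_def]] by simp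
    moreover have "0 \<le> C \<omega>" unfolding C_def by (rule running_nonneg[OF tle])
    moreover have "0 \<le> (x \<omega>)\<^sup>2 * hfun P t (\<Lambda> \<omega>) (f \<omega>)"
      using hc_nonneg[of t "\<Lambda> \<omega>" "f \<omega>"] hc_eq[OF \<Lambda>r[OF \<omega>]] by simp
    ultimately show ?thesis by simp
  qed
  show "(\<integral>\<^sup>+\<omega>\<in>A. ennreal (togo x0 lam u t \<omega>) \<partial>M) \<le> (\<integral>\<^sup>+\<omega>\<in>A. ennreal (togo x0 lam u (Suc t) \<omega>) \<partial>M)"
    unfolding next_eq
  proof (rule nn_integral_mono)
    fix \<omega> assume \<omega>: "\<omega> \<in> space M"
    obtain l' where l': "\<And>l. l \<in> allocations (\<Lambda> \<omega>) \<Longrightarrow>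
        stage_objective P t (hfun P (Suc t)) (\<Lambda> \<omega>) (f \<omega>) l' \<le> stage_objective P t (hfun P (Suc t)) (\<Lambda> \<omega>) (f \<omega>) l"
      "stage_objective P t (hfun P (Suc t)) (\<Lambda> \<omega>) (f \<omega>) l' = S.opt_value (\<Lambda> \<omega>) (f \<omega>)"
      using S.opt_value_attained[OF \<Lambda>r[OF \<omega>]] by blast
    have "hfun P t (\<Lambda> \<omega>) (f \<omega>) \<le> ?so \<omega>"
      using l'(1)[OF lr[OF \<omega>]] l'(2) by (simp add: hfun_eq_value[OF t] S.opt_value_def)
    then have "ennreal ((x \<omega>)\<^sup>2 * hfun P t (\<Lambda> \<omega>) (f \<omega>)) \<le> ennreal ((x \<omega>)\<^sup>2 * ?so \<omega>)"
      by (intro ennreal_leI mult_left_mono) auto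
    also have "\<dots> \<le> I \<omega>"
      unfolding I_eq[OF \<omega>] by (rule S.bellman_ge[OF \<Lambda>r[OF \<omega>] lr[OF \<omega>] \<phi>_sec[OF \<omega>]])
    finally show "ennreal (togo x0 lam u t \<omega>) * indicator A \<omega> \<le> (\<integral>\<^sup>+\<omega>'. \<Psi> (\<omega>, \<omega>') \<partial>M)"
      unfolding inner[OF \<omega>] togo_eq[OF \<omega>] by (intro mult_right_mono add_left_mono) auto
  qed
  assume ctrl: "\<And>\<omega> s. \<omega> \<in> space M \<Longrightarrow> \<phi> (\<omega>, s) = - (state P N x0 u t \<omega> *\<^sub>R
          S.ctrl (budget \<Lambda>0 lam t \<omega>, lam t \<omega>, post_mean P (factor P N t \<omega>) (lam t \<omega>) s))"
    and opt: "\<And>\<omega>. \<omega> \<in> space M \<Longrightarrow> stage_objective P t (hfun P (Suc t)) (budget \<Lambda>0 lam t \<omega>) (factor P N t \<omega>) (lam t \<omega>)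
          = hfun P t (budget \<Lambda>0 lam t \<omega>) (factor P N t \<omega>)"
  show "(\<integral>\<^sup>+\<omega>\<in>A. ennreal (togo x0 lam u (Suc t) \<omega>) \<partial>M) = (\<integral>\<^sup>+\<omega>\<in>A. ennreal (togo x0 lam u t \<omega>) \<partial>M)"
    unfolding next_eq
  proof (rule nn_integral_cong)
    fix \<omega> assume \<omega>: "\<omega> \<in> space M"
    have "I \<omega> = ennreal ((x \<omega>)\<^sup>2 * ?so \<omega>)"
      unfolding I_eq[OF \<omega>]
      by (rule S.bellman_eq[OF \<Lambda>r[OF \<omega>] lr[OF \<omega>] \<phi>_sec[OF \<omega>]])
        (unfold x_def \<Lambda>_def l_def f_def, rule ctrl[OF \<omega>])
    also have "?so \<omega> = hfun P t (\<Lambda> \<omega>) (f \<omega>)"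
      unfolding \<Lambda>_def l_def f_def by (rule opt[OF \<omega>])
    finally show "(\<integral>\<^sup>+\<omega>'. \<Psi> (\<omega>, \<omega>') \<partial>M) = ennreal (togo x0 lam u t \<omega>) * indicator A \<omega>"
      unfolding inner[OF \<omega>] togo_eq[OF \<omega>] by simp
  qed
qed

end


section \<open>Optimality\<close>

context lq_model begin

lemma togo_zero: "togo x0 lam u 0 \<omega> = hfun P 0 \<Lambda>0 (finit N \<omega>) * x0\<^sup>2"
  using \<Lambda>0 by (simp add: togo_def running_def hc_eq)

lemma togo_horizon:
  assumes "admissible P N \<Lambda>0 lam u" "\<omega> \<in> space M"
  shows "togo x0 lam u (horizon P) \<omega> = total_cost P N x0 u \<omega>"
  using hc_eq[OF admissible_budget_range[OF assms(1) order_refl assms(2)]]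
  by (simp add: togo_def running_def total_cost_def cost_def hfun_def)

lemma subalgebra_info:
  assumes "admissible P N \<Lambda>0 lam u"
  shows "subalgebra M (info P N lam 0)"
  by (rule subalgebra_trans[OF subalgebra_alg[OF past_sources] admissible_past(2)[OF assms]]) auto

lemma sets_info_past:
  assumes "admissible P N \<Lambda>0 lam u" and "A \<in> sets (info P N lam 0)"
  shows "A \<in> sets (alg (past t))"
  using admissible_past(2)[OF assms(1), of 0] assms(2) subalgebra_alg_mono[OF past_mono[of 0 t]]
  by (auto simp: subalgebra_def)

text \<open>An event of the initial information belongs to every past algebra, so the one-step
  inequalities can be chained over it.\<close>

lemma value_le_cost:
  assumes adm: "admissible P N \<Lambda>0 lam u" and A: "A \<in> sets (info P N lam 0)"
  shows "(\<integral>\<^sup>+\<omega>\<in>A. ennreal (hfun P 0 \<Lambda>0 (finit N \<omega>) * x0\<^sup>2) \<partial>M) \<le> (\<integral>\<^sup>+\<omega>\<in>A. ennreal (total_cost P N x0 u \<omega>) \<partial>M)"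
proof -
  have "t \<le> horizon P \<Longrightarrow> (\<integral>\<^sup>+\<omega>\<in>A. ennreal (togo x0 lam u 0 \<omega>) \<partial>M) \<le> (\<integral>\<^sup>+\<omega>\<in>A. ennreal (togo x0 lam u t \<omega>) \<partial>M)" for t
  proof (induction t)
    case (Suc t)
    then have t: "t < horizon P" by simp
    obtain \<phi> where "\<phi> \<in> borel_measurable (alg (past t) \<Otimes>\<^sub>M borel)"
      "\<And>\<omega>. \<omega> \<in> space M \<Longrightarrow> u t \<omega> = \<phi> (\<omega>, sig P N lam t \<omega>)"
      using control_factor[OF adm t] by blast
    from togo_step_le[OF adm t this sets_info_past[OF adm A]] Suc show ?case
      by (meson Suc_leD order_trans)
  qed simp
  from this[OF order_refl] show ?thesis
    unfolding togo_zero by (simp add: togo_horizon[OF adm] cong: nn_integral_cong)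
qed

lemma measurable_total_cost:
  assumes adm: "admissible P N \<Lambda>0 lam u"
  shows "total_cost P N x0 u \<in> borel_measurable M"
proof -
  have [measurable]: "running x0 u (horizon P) \<in> borel_measurable M"
    by (rule measurable_past[OF running_past[OF adm]]) auto
  have [measurable]: "state P N x0 u (horizon P) \<in> borel_measurable M"
    by (rule measurable_past[OF admissible_state_past[OF adm]]) auto
  have "total_cost P N x0 u = (\<lambda>\<omega>. running x0 u (horizon P) \<omega> + qcoef P (horizon P) * (state P N x0 u (horizon P) \<omega>)\<^sup>2)"
    by (simp add: fun_eq_iff total_cost_def running_def cost_def)
  then show ?thesis by simp
qed

lemma measurable_optimal_cost:
  "(\<lambda>\<omega>. ennreal (hfun P 0 \<Lambda>0 (finit N \<omega>) * x0\<^sup>2)) \<in> borel_measurable (info P N lam 0)"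
proof -
  note [measurable] = info_finit[of lam 0]
  have "(\<lambda>\<omega>. ennreal (hc 0 \<Lambda>0 (finit N \<omega>) * x0\<^sup>2)) \<in> borel_measurable (info P N lam 0)"
    by measurable
  then show ?thesis using \<Lambda>0 by (simp add: hc_eq)
qed

lemma cond_exp_subalgebra:
  assumes "admissible P N \<Lambda>0 lam u"
  shows "sigma_finite_subalgebra M (info P N lam 0)"
  by (intro finite_measure_subalgebra_is_sigma_finite finite_measure_subalgebra.intro
      finite_measure_subalgebra_axioms.intro subalgebra_info[OF assms] finite_measure_axioms)

lemma optimal_cost_le_objective:
  assumes adm: "admissible P N \<Lambda>0 lam u"
  shows "AE \<omega> in M. ennreal (hfun P 0 \<Lambda>0 (finit N \<omega>) * x0\<^sup>2) \<le> objective P N x0 lam u \<omega>"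
  unfolding objective_def
  by (rule sigma_finite_subalgebra.nn_cond_exp_ge[OF cond_exp_subalgebra[OF adm] measurable_optimal_cost _ value_le_cost[OF adm]])
    (use measurable_total_cost[OF adm] in measurable)

lemma control_law_eq:
  assumes t: "t < horizon P" and "\<Lambda> \<in> {0..\<Lambda>0}" and "ls t \<Lambda> f \<in> allocations \<Lambda>"
  shows "control_law P ls t x \<Lambda> f s
    = - (x *\<^sub>R lq_stage.ctrl P (hfun P (Suc t)) t (\<Lambda>, ls t \<Lambda> f, post_mean P f (ls t \<Lambda> f) s))"
proof -
  interpret S: lq_stage P \<Lambda>0 "hfun P (Suc t)" t by (rule lq_stage_hfun[OF t])
  show ?thesis
    unfolding control_law_def S.lin_term_eq[OF assms(2,3)] S.quad_term_eq[OF assms(2,3)] S.ctrl_def ..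
qed

section \<open>Policies that follow a selector\<close>

context
  fixes ls :: "nat \<Rightarrow> real \<Rightarrow> real^'k \<Rightarrow> real^'k"
  assumes ls: "argmin_selector P \<Lambda>0 ls"
begin

lemma
  assumes t: "t < horizon P" and \<Lambda>: "\<Lambda> \<in> {0..\<Lambda>0}"
  shows ls_mem: "ls t \<Lambda> f \<in> allocations \<Lambda>"
    and ls_opt: "stage_objective P t (hfun P (Suc t)) \<Lambda> f (ls t \<Lambda> f) = hfun P t \<Lambda> f"
proof -
  have *: "is_arg_min (stage_objective P t (hfun P (Suc t)) \<Lambda> f) (\<lambda>l. l \<in> allocations \<Lambda>) (ls t \<Lambda> f)"
    using ls t \<Lambda> by (simp add: argmin_selector_def)
  then show mem: "ls t \<Lambda> f \<in> allocations \<Lambda>" by (simp add: is_arg_min_def)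
  show "stage_objective P t (hfun P (Suc t)) \<Lambda> f (ls t \<Lambda> f) = hfun P t \<Lambda> f"
    unfolding hfun_eq_value[OF t]
    by (rule cInf_eq_minimum[symmetric]) (use mem * in \<open>auto simp: is_arg_min_linorder\<close>)
qed

lemma measurable_ls:
  assumes t: "t < horizon P" and "\<Lambda> \<in> borel_measurable F" "f \<in> borel_measurable F"
    and \<Lambda>: "\<And>\<omega>. \<omega> \<in> space F \<Longrightarrow> \<Lambda> \<omega> \<in> {0..\<Lambda>0}"
  shows "(\<lambda>\<omega>. ls t (\<Lambda> \<omega>) (f \<omega>)) \<in> borel_measurable F"
proof -
  have sel: "(\<lambda>(\<Lambda>, f). ls t \<Lambda> f) \<in> borel_measurable (restrict_space borel ({0..\<Lambda>0} \<times> UNIV))"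
    using ls t by (simp add: argmin_selector_def)
  have "(\<lambda>\<omega>. (\<Lambda> \<omega>, f \<omega>)) \<in> measurable F (restrict_space borel ({0..\<Lambda>0} \<times> UNIV))"
    using assms(2,3) \<Lambda> by (intro measurable_restrict_space2) auto
  from measurable_compose[OF this sel] show ?thesis by simp
qed

lemma measurable_control_law:
  assumes t: "t < horizon P" and [measurable]: "x \<in> borel_measurable F" "\<Lambda> \<in> borel_measurable F"
    "f \<in> borel_measurable F" "s \<in> borel_measurable F"
    and \<Lambda>: "\<And>\<omega>. \<omega> \<in> space F \<Longrightarrow> \<Lambda> \<omega> \<in> {0..\<Lambda>0}"
  shows "(\<lambda>\<omega>. control_law P ls t (x \<omega>) (\<Lambda> \<omega>) (f \<omega>) (s \<omega>)) \<in> borel_measurable F"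
proof -
  interpret S: lq_stage P \<Lambda>0 "hfun P (Suc t)" t by (rule lq_stage_hfun[OF t])
  have [measurable]: "(\<lambda>\<omega>. ls t (\<Lambda> \<omega>) (f \<omega>)) \<in> borel_measurable F"
    by (rule measurable_ls[OF t _ _ \<Lambda>]) measurable
  have [measurable]: "(\<lambda>\<omega>. S.ctrl (\<Lambda> \<omega>, ls t (\<Lambda> \<omega>) (f \<omega>), post_mean P (f \<omega>) (ls t (\<Lambda> \<omega>) (f \<omega>)) (s \<omega>))) \<in> borel_measurable F"
    by (rule S.measurable_ctrl) (use \<Lambda> ls_mem[OF t] in auto)
  have "(\<lambda>\<omega>. control_law P ls t (x \<omega>) (\<Lambda> \<omega>) (f \<omega>) (s \<omega>)) \<in> borel_measurable F \<longleftrightarrow>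
    (\<lambda>\<omega>. - (x \<omega> *\<^sub>R S.ctrl (\<Lambda> \<omega>, ls t (\<Lambda> \<omega>) (f \<omega>), post_mean P (f \<omega>) (ls t (\<Lambda> \<omega>) (f \<omega>)) (s \<omega>)))) \<in> borel_measurable F"
    by (intro measurable_cong control_law_eq[where ls = ls, OF t \<Lambda> ls_mem[OF t \<Lambda>]])
  also have "\<dots>" by measurable
  finally show ?thesis .
qed

text \<open>The policy refers to budget and state, which are themselves computed from the policy.
  The recursion is solved in order: the budget path \<open>B\<close>, then the attention and its
  signals, then the state path \<open>X\<close> and the control; afterwards \<open>B\<close> and
  \<open>X\<close> are recognized as the budget and state of the policy.\<close>

lemma follows_exists: "\<exists>lam u. follows P N x0 \<Lambda>0 ls lam u"
proof -
  define B where "B = rec_nat (\<lambda>\<omega>. \<Lambda>0) (\<lambda>t b \<omega>. b \<omega> - (\<Sum>j\<in>UNIV. ls t (b \<omega>) (factor P N t \<omega>) $ j))"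
  define lam where "lam t \<omega> = ls t (B t \<omega>) (factor P N t \<omega>)" for t \<omega>
  have B: "budget \<Lambda>0 lam t \<omega> = B t \<omega>" for t \<omega>
    by (induction t) (simp_all add: B_def lam_def)
  define X where "X = rec_nat (\<lambda>\<omega>. x0) (\<lambda>t x \<omega>. acoef P (Suc t) * x \<omega> + bvec P N (Suc t) \<omega> \<bullet>
      control_law P ls t (x \<omega>) (B t \<omega>) (factor P N t \<omega>) (sig P N lam t \<omega>))"
  define u where "u t \<omega> = control_law P ls t (X t \<omega>) (B t \<omega>) (factor P N t \<omega>) (sig P N lam t \<omega>)" for t \<omega>
  have X: "state P N x0 u t \<omega> = X t \<omega>" for t \<omega>
    by (induction t) (simp_all add: X_def u_def)
  have "follows P N x0 \<Lambda>0 ls lam u"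
    unfolding follows_def B X by (simp add: lam_def u_def)
  then show ?thesis by blast
qed

context
  fixes lam :: "nat \<Rightarrow> 'w \<Rightarrow> real^'k" and u :: "nat \<Rightarrow> 'w \<Rightarrow> real^'n" and x0 :: real
  assumes fol: "follows P N x0 \<Lambda>0 ls lam u"
begin

lemma follows_lam: "t < horizon P \<Longrightarrow> \<omega> \<in> space M \<Longrightarrow> lam t \<omega> = ls t (budget \<Lambda>0 lam t \<omega>) (factor P N t \<omega>)"
  and follows_control: "t < horizon P \<Longrightarrow> \<omega> \<in> space M \<Longrightarrow> u t \<omega> =
    control_law P ls t (state P N x0 u t \<omega>) (budget \<Lambda>0 lam t \<omega>) (factor P N t \<omega>) (sig P N lam t \<omega>)"
  using fol unfolding follows_def by blast+

lemma follows_budget: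
  assumes "\<omega> \<in> space M" shows "t \<le> horizon P \<Longrightarrow> budget \<Lambda>0 lam t \<omega> \<in> {0..\<Lambda>0}"
proof (induction t)
  case 0
  then show ?case using \<Lambda>0 by simp
next
  case (Suc t)
  then have "lam t \<omega> \<in> allocations (budget \<Lambda>0 lam t \<omega>)"
    using follows_lam[of t \<omega>] assms ls_mem[of t] by simp
  then show ?case using rem_range Suc by (simp add: rem_def)
qed

text \<open>By induction on time: if the earlier decisions are measurable for their information,
  then budget, factor and state are known at time \<open>t\<close>, and measurability of the
  selector and of the control law carries this over to the decisions at \<open>t\<close>.\<close>

lemma follows_admissible: "admissible P N \<Lambda>0 lam u"
proof -
  have "(\<forall>i<t. lam i \<in> borel_measurable (info P N lam i) \<and> u i \<in> borel_measurable (info_plus P N lam i))"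
    if "t \<le> horizon P" for t
    using that
  proof (induction t)
    case (Suc t)
    then have t: "t < horizon P" and IH: "\<And>i. i < t \<Longrightarrow> lam i \<in> borel_measurable (info P N lam i)"
      "\<And>i. i < t \<Longrightarrow> u i \<in> borel_measurable (info_plus P N lam i)" by auto
    have sub: "subalgebra (info P N lam t) (info P N lam i)" if "i \<le> t" for i
      using that by (intro subalgebra_info_of) (auto intro: info_finit info_eps info_eta info_sig)
    have lam_i: "lam i \<in> borel_measurable (info P N lam t)" if "i < t" for i
      by (rule measurable_from_subalg[OF sub IH(1)]) (use that in auto)
    have u_i: "u i \<in> borel_measurable (info P N lam t)" if "i < t" for i
      by (rule measurable_from_subalg[OF subalgebra_trans[OF sub info_mono] IH(2)]) (use that in auto)
    have b: "budget \<Lambda>0 lam t \<in> borel_measurable (info P N lam t)"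
      by (rule measurable_budget_of[OF lam_i])
    have f: "factor P N t \<in> borel_measurable (info P N lam t)"
      by (rule measurable_factor_of) (auto intro: info_finit info_eta)
    have x: "state P N x0 u t \<in> borel_measurable (info P N lam t)"
      by (rule measurable_state_of[OF _ _ _ _ u_i]) (auto intro: info_finit info_eps info_eta)
    have br: "budget \<Lambda>0 lam t \<omega> \<in> {0..\<Lambda>0}" if "\<omega> \<in> space M" for \<omega>
      using follows_budget[OF that, of t] t by simp
    have "(\<lambda>\<omega>. ls t (budget \<Lambda>0 lam t \<omega>) (factor P N t \<omega>)) \<in> borel_measurable (info P N lam t)"
      by (rule measurable_ls[OF t b f]) (use br in simp)
    then have "lam t \<in> borel_measurable (info P N lam t)"
      by (rule measurable_cong[THEN iffD1, rotated]) (use follows_lam[OF t] in simp)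
    moreover have "(\<lambda>\<omega>. control_law P ls t (state P N x0 u t \<omega>) (budget \<Lambda>0 lam t \<omega>) (factor P N t \<omega>) (sig P N lam t \<omega>))
        \<in> borel_measurable (info_plus P N lam t)"
      by (rule measurable_control_law[OF t])
        (use br measurable_from_subalg[OF info_plus_info] b f x info_plus_sig in auto)
    then have "u t \<in> borel_measurable (info_plus P N lam t)"
      by (rule measurable_cong[THEN iffD1, rotated]) (use follows_control[OF t] in simp)
    ultimately show ?case using IH by (auto simp: less_Suc_eq)
  qed simp
  from this[OF order_refl] show ?thesis
    unfolding admissible_def using follows_lam follows_budget ls_mem by (simp add: less_imp_le)
qed

lemma follows_objective: "AE \<omega> in M. objective P N x0 lam u \<omega> = ennreal (hfun P 0 \<Lambda>0 (finit N \<omega>) * x0\<^sup>2)"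
proof -
  note adm = follows_admissible
  have "(\<integral>\<^sup>+\<omega>\<in>A. ennreal (total_cost P N x0 u \<omega>) \<partial>M) = (\<integral>\<^sup>+\<omega>\<in>A. ennreal (hfun P 0 \<Lambda>0 (finit N \<omega>) * x0\<^sup>2) \<partial>M)"
    if A: "A \<in> sets (info P N lam 0)" for A
  proof -
    have "t \<le> horizon P \<Longrightarrow> (\<integral>\<^sup>+\<omega>\<in>A. ennreal (togo x0 lam u t \<omega>) \<partial>M) = (\<integral>\<^sup>+\<omega>\<in>A. ennreal (togo x0 lam u 0 \<omega>) \<partial>M)" for t
    proof (induction t)
      case (Suc t)
      then have t: "t < horizon P" by simp
      have br: "budget \<Lambda>0 lam t \<omega> \<in> {0..\<Lambda>0}" if "\<omega> \<in> space M" for \<omega>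
        using follows_budget[OF that, of t] t by simp
      \<comment> \<open>For this policy the control law itself is the required function of past
        outcome and signal.\<close>
      let ?\<phi> = "\<lambda>p. control_law P ls t (state P N x0 u t (fst p)) (budget \<Lambda>0 lam t (fst p)) (factor P N t (fst p)) (snd p)"
      have "(\<integral>\<^sup>+\<omega>\<in>A. ennreal (togo x0 lam u (Suc t) \<omega>) \<partial>M) = (\<integral>\<^sup>+\<omega>\<in>A. ennreal (togo x0 lam u t \<omega>) \<partial>M)"
      proof (rule togo_step_eq[OF adm t])
        show "?\<phi> \<in> borel_measurable (alg (past t) \<Otimes>\<^sub>M borel)"
          using t br by (intro measurable_control_law measurable_compose[OF measurable_fst] measurable_snd
              admissible_state_past[OF adm] admissible_budget_past[OF adm] factor_past)
            (auto simp: space_pair_measure)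
        show "u t \<omega> = ?\<phi> (\<omega>, sig P N lam t \<omega>)" if "\<omega> \<in> space M" for \<omega>
          using follows_control[OF t that] by simp
        show "A \<in> sets (alg (past t))" by (rule sets_info_past[OF adm A])
        show "?\<phi> (\<omega>, s) = - (state P N x0 u t \<omega> *\<^sub>R lq_stage.ctrl P (hfun P (Suc t)) t
            (budget \<Lambda>0 lam t \<omega>, lam t \<omega>, post_mean P (factor P N t \<omega>) (lam t \<omega>) s))" if "\<omega> \<in> space M" for \<omega> s
          using control_law_eq[where ls = ls, OF t br[OF that] ls_mem[OF t br[OF that]]] follows_lam[OF t that] by simp
        show "stage_objective P t (hfun P (Suc t)) (budget \<Lambda>0 lam t \<omega>) (factor P N t \<omega>) (lam t \<omega>)
            = hfun P t (budget \<Lambda>0 lam t \<omega>) (factor P N t \<omega>)" if "\<omega> \<in> space M" for \<omega>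
          using ls_opt[OF t br[OF that]] follows_lam[OF t that] by simp
      qed
      then show ?case using Suc by simp
    qed simp
    from this[OF order_refl] show ?thesis
      unfolding togo_zero by (simp add: togo_horizon[OF adm] cong: nn_integral_cong)
  qed
  then have "AE \<omega> in M. ennreal (hfun P 0 \<Lambda>0 (finit N \<omega>) * x0\<^sup>2)
      = nn_cond_exp M (info P N lam 0) (\<lambda>\<omega>. ennreal (total_cost P N x0 u \<omega>)) \<omega>"
    by (rule sigma_finite_subalgebra.nn_cond_exp_charact[OF cond_exp_subalgebra[OF adm] _
          measurable_compose[OF measurable_total_cost[OF adm] measurable_ennreal] measurable_optimal_cost])
  then show ?thesis unfolding objective_def by eventually_elim simp
qed

lemma follows_optimal: "optimal_policy P N x0 \<Lambda>0 lam u"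
  unfolding optimal_policy_def
proof (intro conjI allI impI follows_admissible)
  fix lam' u' assume adm: "admissible P N \<Lambda>0 lam' u'"
  show "AE \<omega> in M. objective P N x0 lam u \<omega> \<le> objective P N x0 lam' u' \<omega>"
    using follows_objective optimal_cost_le_objective[OF adm, of x0] by eventually_elim simp
qed

end

end

lemma optimal_value_hfun: "optimal_value P N x0 \<Lambda>0 (\<lambda>\<omega>. ennreal (hfun P 0 \<Lambda>0 (finit N \<omega>) * x0\<^sup>2))"
proof -
  obtain ls where ls: "argmin_selector P \<Lambda>0 ls" using argmin_selector_exists by blast
  obtain lam u where fol: "follows P N x0 \<Lambda>0 ls lam u" using follows_exists[OF ls] by blast
  show ?thesis
    unfolding optimal_value_def
    using optimal_cost_le_objective follows_admissible[OF ls fol] follows_objective[OF ls fol] by blast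
qed

end

theorem theorem3p1:
  fixes P :: "('n::finite, 'k::finite) lq_data"
    and N :: "('w, 'n, 'k) shocks"
    and x0 \<Lambda>0 :: real
  assumes "valid_data P"
    and "valid_shocks P N"
    and "0 \<le> \<Lambda>0"
    and "\<And>t l. t < horizon P \<Longrightarrow> l \<in> allocations \<Lambda>0 \<Longrightarrow> posdef (Sig_b P l)"
  shows "(\<exists>ls. argmin_selector P \<Lambda>0 ls) \<and>
    (\<forall>ls. argmin_selector P \<Lambda>0 ls \<longrightarrow>
       (\<exists>lam u. follows P N x0 \<Lambda>0 ls lam u) \<and>
       (\<forall>lam u. follows P N x0 \<Lambda>0 ls lam u \<longrightarrow> optimal_policy P N x0 \<Lambda>0 lam u)) \<and>
    optimal_value P N x0 \<Lambda>0 (\<lambda>\<omega>. ennreal (hfun P 0 \<Lambda>0 (finit N \<omega>) * x0\<^sup>2))"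
proof -
  interpret lq_model P \<Lambda>0 N
    by unfold_locales (use assms in auto)
  show ?thesis
    using argmin_selector_exists follows_exists follows_optimal optimal_value_hfun by blast
qed

end
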